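(* For every topological group $G$, the following are equivalent: \begin{enumerate} \item $G \cong \operatorname{Iso}(U)$ for some (uniformly) discrete homogeneous Polish ultrametric space $U$; \item $G \cong \operatorname{Aut}(\mathcal{T})$ for some linear order $L$ with a minimum and some countable homogeneous pruned $L$-tree $\mathcal{T}$; \item $G \cong \operatorname{Wr}^{\operatorname{LF}}_{\delta \in \Delta} \operatorname{Sym}(N_\delta)$ for some countable linear skeleton $\langle \Delta, N \rangle$ such that $\Delta$ has a minimum; \item $G \cong \operatorname{Wr}^{S}_{\delta \in \Delta} \operatorname{Sym}(N_\delta)$ for some countable linear skeleton $\langle \Delta, N \rangle$ such that $\Delta$ has a minimum and some approximately homogeneous closed separable domain $S \subseteq S^{\operatorname{Max}}$; \item $G \cong \operatorname{Wr}^{\mathbf{S}}_{\delta \in \Delta} \operatorname{Sym}(N_\delta)$ for some countable linear skeleton $\langle \Delta, N \rangle$ such that $\Delta$ has a minimum and some countable locally homogeneous family of local domains $\mathbf{S} \subseteq \mathbf{S}^{\operatorname{Max}}$; \item $G \cong \operatorname{Wr}^{\mathbf{S},\boldsymbol{\pi}}_{\delta \in \Delta} \operatorname{Sym}(N_\delta)$ for some countable linear skeleton $\langle \Delta, N \rangle$ such that $\Delta$ has a minimum and some countable locally homogeneous system of projections $\langle \mathbf{S}, \boldsymbol{\pi} \rangle$ with $\mathbf{S} \subseteq \mathbf{S}^{\operatorname{Max}}$; \item $G \cong \operatorname{Wr}^{\operatorname{Fin}}_{\delta \in \Delta} \operatorname{Sym}(N_\delta)$ for some countable linear skeleton $\langle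 \Delta, N \rangle$, where $\operatorname{Wr}^{\operatorname{Fin}}_{\delta \in \Delta} \operatorname{Sym}(N_\delta)$ is equipped with the topology $\tau^*$. \end{enumerate}
   Context: $\cong$ denotes isomorphism of topological groups. $\operatorname{Iso}(U)$ is the isometry group of $U$ with the pointwise convergence topology; a Polish ultrametric space is a separable complete metric space with $d(x,z)\le\max\{d(x,y),d(y,z)\}$; it is homogeneous if $\operatorname{Iso}(U)$ acts transitively on $U$, and uniformly discrete if there is $r>0$ with $d(x,y)\ge r$ for all distinct $x,y$ (for homogeneous spaces, discrete and uniformly discrete are equivalent). $L$-trees. Let $(L,\le_L)$ be a linear order. An $L$-tree is $\mathcal{T}=(T,\le_T,\lambda_T)$ with $(T,\le_T)$ a partial order, $\lambda_T\colon T\to L$ surjective, such that for all $t,t'$: (1) $t<_Tt'$ implies $\lambda_T(t)<_L\lambda_T(t')$; (2) for every $\ell\ge_L\lambda_T(t)$ there is a unique $t''\ge_Tt$ with $\lambda_T(t'')=\ell$, written $t|_\ell$; (3) $t|_\ell=t'|_\ell$ for some $\ell\ge_L\max\{\lambda_T(t),\lambda_T(t')\}$; (4) if $t,t'$ are incomparable, $\{\ell\ge_L\max\{\lambda_T(t),\lambda_T(t')\}:t|_\ell\ne t'|_\ell\}$ has a maximum. A branch is $b\colon L\to T$ with $\lambda_T(b(\ell))=\ell$ and $b$ monotone; $\mathcal{T}$ is pruned if each $t$ equals $b(\lambda_T(t))$ for some branch $b$. $\operatorname{Aut}(\mathcal{T})$ is the group of level-preserving order automorphisms of $T$ with the pointwise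 convergence topology ($T$ discrete). $\mathcal{T}$ is homogeneous if for all $t,t'$ with $\lambda_T(t)=\lambda_T(t')$ there is $f\in\operatorname{Aut}(\mathcal{T})$ with $f(t)=t'$. Skeletons and global domains. A skeleton $\langle\Delta,N\rangle$ is a nonempty partial order $\Delta$ with nonzero cardinals $N_\delta$ ($\delta\in\Delta$), each identified with the set of smaller ordinals; countable if $\Delta$ is countable and each $N_\delta\le\omega$; linear if $\Delta$ is linearly ordered. $z|_\delta$ is the restriction of $z$ to $\{\gamma\in\Delta:\gamma\ge\delta\}$; $\operatorname{supp}(z)=\{\gamma:z(\gamma)\ne0\}$; for $z\in\prod_{\gamma\ge\delta}N_\gamma$, $z^\delta_i$ agrees with $z$ above $\delta$ and has value $i$ at $\delta$. $\operatorname{Fin}$ = finite subsets of $\Delta$; $\operatorname{LF}$ = sets $A\subseteq\Delta$ with $A\cap\{\gamma:\gamma\ge\delta\}$ finite for all $\delta$; $\operatorname{Max}$ = sets with no infinite strictly increasing chain. A domain is $S\subseteq\prod_{\delta\in\Delta}N_\delta$ such that for all $x\in S$, $\delta$, $i\in N_\delta$ some $y\in S$ has $y(\delta)=i$ and $y|_\gamma=x|_\gamma$ for all $\gamma>\delta$. For $\mathscr{A}\in\{\operatorname{Fin},\operatorname{LF},\operatorname{Max}\}$, $S^{\mathscr{A}}=\{x:\operatorname{supp}(x)\in\mathscr{A}\}$. $\operatorname{Wr}^S_{\delta\in\Delta}\operatorname{Sym}(N_\delta)$ is the group of $g\in\operatorname{Sym}(S)$ such that for all $x,y\in S$ and $\delta$: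 $x|_\delta=y|_\delta\iff g(x)|_\delta=g(y)|_\delta$; $\operatorname{Wr}^{\mathscr{A}}=\operatorname{Wr}^{S^{\mathscr{A}}}$. Let $\tau_\Delta$ be the topology on $\prod_\delta N_\delta$ generated by the sets $\{y:y|_\gamma=x|_\gamma\}$; unless stated otherwise $\operatorname{Wr}^S$ carries the pointwise convergence topology w.r.t. $\tau_\Delta$ restricted to $S$. The topology $\tau^*$ on $\operatorname{Wr}^{\operatorname{Fin}}_{\delta\in\Delta}\operatorname{Sym}(N_\delta)$ (for countable skeletons, where $S^{\operatorname{Fin}}$ is countable) is instead the pointwise convergence topology with respect to the discrete topology on $S^{\operatorname{Fin}}$. $S$ is closed if $\tau_\Delta$-closed and separable if separable in the relative topology; $S$ is approximately homogeneous if for all $x,y\in S$ and $\delta$ some $g\in\operatorname{Wr}^S_{\delta\in\Delta}\operatorname{Sym}(N_\delta)$ has $g(x)|_\delta=y|_\delta$. Local domains and projections. For $\mathbf{S}\subseteq\bigcup_\delta\prod_{\gamma\ge\delta}N_\gamma$, $\mathbf{S}_\delta=\mathbf{S}\cap\prod_{\gamma\ge\delta}N_\gamma$; $\mathbf{S}^{\operatorname{Max}}=\{x|_\delta:\delta\in\Delta,\operatorname{supp}(x)\in\operatorname{Max}\}$. A family of local domains: all $\mathbf{S}_\delta\ne\emptyset$, $\mathbf{S}_\gamma=\{z|_\gamma:z\in\mathbf{S}_\delta\}$ for $\gamma\ge\delta$, and $z^\delta_i\in\mathbf{S}_\delta$ for $z\in\mathbf{S}_\delta$. $\operatorname{Wr}^{\mathbf{S}}_{\delta\in\Delta}\operatorname{Sym}(N_\delta)$: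 all $g\in\operatorname{Sym}(\mathbf{S})$ with $g(\mathbf{S}_\delta)=\mathbf{S}_\delta$ and $g(z|_\gamma)=g(z)|_\gamma$. A system of projections $\langle\mathbf{S},\boldsymbol{\pi}\rangle$: $\mathbf{S}$ with all $\mathbf{S}_\delta$ nonempty and closed under $z\mapsto z^\delta_i$, and surjections $\pi_{\delta\gamma}\colon\mathbf{S}_\delta\to\mathbf{S}_\gamma$ ($\gamma\ge\delta$) with $\pi_{\delta\gamma}(z)=\pi_{\delta\gamma}(z')\iff z|_\gamma=z'|_\gamma$ and $\pi_{\gamma\beta}\circ\pi_{\delta\gamma}=\pi_{\delta\beta}$. $\operatorname{Wr}^{\mathbf{S},\boldsymbol{\pi}}_{\delta\in\Delta}\operatorname{Sym}(N_\delta)$: all $g\in\operatorname{Sym}(\mathbf{S})$ with $g(\mathbf{S}_\delta)=\mathbf{S}_\delta$ and $g(\pi_{\delta\gamma}(z))=\pi_{\delta\gamma}(g(z))$. Countable means $\mathbf{S}$ countable; locally homogeneous means for all $\delta$ and $z,z'\in\mathbf{S}_\delta$ some $g$ in the corresponding wreath product has $g(z)=z'$. These groups carry the pointwise convergence topology with $\mathbf{S}$ discrete. *)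

theory Defs
  imports
    "HOL-Analysis.Analysis"
    "HOL-Algebra.Bij"
    "HOL-Library.Extended_Nat"
    "HOL-Library.Infinite_Typeclass"
begin

section \<open>Topological groups\<close>

type_synonym 'a topgroup = "'a monoid \<times> 'a topology"

definition topological_group :: "'a topgroup \<Rightarrow> bool" where
  "topological_group \<G> \<longleftrightarrow> (case \<G> of (G, X) \<Rightarrow>
     group G \<and> topspace X = carrier G \<and>
     continuous_map (prod_topology X X) X (\<lambda>(x, y). x \<otimes>\<^bsub>G\<^esub> y) \<and>
     continuous_map X X (\<lambda>x. inv\<^bsub>G\<^esub> x))"

definition topgroup_iso :: "'a topgroup \<Rightarrow> 'b topgroup \<Rightarrow> bool"  (infix "\<cong>\<^sub>t" 60) where
  "\<G> \<cong>\<^sub>t \<H> \<longleftrightarrow>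
     (\<exists>h. h \<in> iso (fst \<G>) (fst \<H>) \<and> homeomorphic_map (snd \<G>) (snd \<H>) h)"

text \<open>
  The group of those permutations of (the underlying set of) the space \<open>X\<close> that lie in \<open>K\<close>, with
  the topology of pointwise convergence with respect to \<open>X\<close>.  Permutations are extensional
  functions, as in \<^const>\<open>BijGroup\<close>; this matches the points of \<^const>\<open>product_topology\<close>.
\<close>

definition perm_topgroup :: "'a topology \<Rightarrow> ('a \<Rightarrow> 'a) set \<Rightarrow> ('a \<Rightarrow> 'a) topgroup" where
  "perm_topgroup X K =
     ((BijGroup (topspace X))\<lparr>carrier := K\<rparr>,
      subtopology (product_topology (\<lambda>_. X) (topspace X)) K)"


section \<open>Polish ultrametric spaces\<close>

definition polish_ultrametric :: "'u metric \<Rightarrow> bool" where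
  "polish_ultrametric U \<longleftrightarrow>
     separable_space (mtopology_of U) \<and> mcomplete_of U \<and>
     (\<forall>x\<in>mspace U. \<forall>y\<in>mspace U. \<forall>z\<in>mspace U.
        mdist U x z \<le> max (mdist U x y) (mdist U y z))"

definition isometries :: "'u metric \<Rightarrow> ('u \<Rightarrow> 'u) set" where
  "isometries U = {f \<in> Bij (mspace U).
     \<forall>x\<in>mspace U. \<forall>y\<in>mspace U. mdist U (f x) (f y) = mdist U x y}"

definition Iso :: "'u metric \<Rightarrow> ('u \<Rightarrow> 'u) topgroup" where
  "Iso U = perm_topgroup (mtopology_of U) (isometries U)"

definition homogeneous_metric :: "'u metric \<Rightarrow> bool" where
  "homogeneous_metric U \<longleftrightarrow> (\<forall>x\<in>mspace U. \<forall>y\<in>mspace U. \<exists>f\<in>isometries U. f x = y)"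

definition discrete_metric_space :: "'u metric \<Rightarrow> bool" where
  "discrete_metric_space U \<longleftrightarrow> mtopology_of U = discrete_topology (mspace U)"

definition uniformly_discrete_metric_space :: "'u metric \<Rightarrow> bool" where
  "uniformly_discrete_metric_space U \<longleftrightarrow>
     (\<exists>r>0. \<forall>x\<in>mspace U. \<forall>y\<in>mspace U. x \<noteq> y \<longrightarrow> r \<le> mdist U x y)"


section \<open>Trees over a linear order\<close>

text \<open>
  An order relation \<open>r\<close> contains the pair \<open>(x, y)\<close> iff \<open>x\<close> is below or equal to \<open>y\<close>.
\<close>

definition has_minimum :: "'a set \<Rightarrow> 'a rel \<Rightarrow> bool" where
  "has_minimum A r \<longleftrightarrow> (\<exists>m\<in>A. \<forall>x\<in>A. (m, x) \<in> r)"

definition has_maximum :: "'a set \<Rightarrow> 'a rel \<Rightarrow> bool" where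
  "has_maximum A r \<longleftrightarrow> (\<exists>m\<in>A. \<forall>x\<in>A. (x, m) \<in> r)"

definition upset :: "'a set \<Rightarrow> 'a rel \<Rightarrow> 'a \<Rightarrow> 'a set" where
  "upset A r a = {x \<in> A. (a, x) \<in> r}"

text \<open>The node \<open>t|\<^sub>l\<close> above \<open>t\<close> on level \<open>l\<close>; only meaningful for \<open>l\<close> above the level of \<open>t\<close>.\<close>

definition node_above :: "'t set \<Rightarrow> 't rel \<Rightarrow> ('t \<Rightarrow> 'l) \<Rightarrow> 't \<Rightarrow> 'l \<Rightarrow> 't" where
  "node_above T rT lev t l = (THE s. s \<in> T \<and> (t, s) \<in> rT \<and> lev s = l)"

definition L_tree :: "'l set \<Rightarrow> 'l rel \<Rightarrow> 't set \<Rightarrow> 't rel \<Rightarrow> ('t \<Rightarrow> 'l) \<Rightarrow> bool" where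
  "L_tree L rL T rT lev \<longleftrightarrow>
     linear_order_on L rL \<and> partial_order_on T rT \<and> lev ` T = L \<and>
     (\<forall>t\<in>T. \<forall>t'\<in>T. (t, t') \<in> rT \<and> t \<noteq> t' \<longrightarrow> (lev t, lev t') \<in> rL \<and> lev t \<noteq> lev t') \<and>
     (\<forall>t\<in>T. \<forall>l\<in>upset L rL (lev t). \<exists>!s. s \<in> T \<and> (t, s) \<in> rT \<and> lev s = l) \<and>
     (\<forall>t\<in>T. \<forall>t'\<in>T. \<exists>l \<in> upset L rL (lev t) \<inter> upset L rL (lev t').
        node_above T rT lev t l = node_above T rT lev t' l) \<and>
     (\<forall>t\<in>T. \<forall>t'\<in>T. (t, t') \<notin> rT \<and> (t', t) \<notin> rT \<longrightarrow>
        has_maximum {l \<in> upset L rL (lev t) \<inter> upset L rL (lev t').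
          node_above T rT lev t l \<noteq> node_above T rT lev t' l} rL)"

definition branch :: "'l set \<Rightarrow> 'l rel \<Rightarrow> 't set \<Rightarrow> 't rel \<Rightarrow> ('t \<Rightarrow> 'l) \<Rightarrow> ('l \<Rightarrow> 't) \<Rightarrow> bool" where
  "branch L rL T rT lev b \<longleftrightarrow>
     (\<forall>l\<in>L. b l \<in> T \<and> lev (b l) = l) \<and>
     (\<forall>l\<in>L. \<forall>l'\<in>L. (l, l') \<in> rL \<longrightarrow> (b l, b l') \<in> rT)"

definition pruned_tree :: "'l set \<Rightarrow> 'l rel \<Rightarrow> 't set \<Rightarrow> 't rel \<Rightarrow> ('t \<Rightarrow> 'l) \<Rightarrow> bool" where
  "pruned_tree L rL T rT lev \<longleftrightarrow> (\<forall>t\<in>T. \<exists>b. branch L rL T rT lev b \<and> b (lev t) = t)"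

definition tree_automorphisms :: "'t set \<Rightarrow> 't rel \<Rightarrow> ('t \<Rightarrow> 'l) \<Rightarrow> ('t \<Rightarrow> 't) set" where
  "tree_automorphisms T rT lev = {f \<in> Bij T.
     (\<forall>t\<in>T. lev (f t) = lev t) \<and>
     (\<forall>t\<in>T. \<forall>t'\<in>T. (f t, f t') \<in> rT \<longleftrightarrow> (t, t') \<in> rT)}"

definition Aut :: "'t set \<Rightarrow> 't rel \<Rightarrow> ('t \<Rightarrow> 'l) \<Rightarrow> ('t \<Rightarrow> 't) topgroup" where
  "Aut T rT lev = perm_topgroup (discrete_topology T) (tree_automorphisms T rT lev)"

definition homogeneous_tree :: "'t set \<Rightarrow> 't rel \<Rightarrow> ('t \<Rightarrow> 'l) \<Rightarrow> bool" where
  "homogeneous_tree T rT lev \<longleftrightarrow>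
     (\<forall>t\<in>T. \<forall>t'\<in>T. lev t = lev t' \<longrightarrow> (\<exists>f\<in>tree_automorphisms T rT lev. f t = t'))"


section \<open>Skeletons\<close>

text \<open>
  Only countable skeletons are needed, so the cardinals \<open>N\<^sub>\<delta> \<le> \<omega>\<close> are represented by
  elements of \<^typ>\<open>enat\<close>; \<open>below (N \<delta>)\<close> is the set of ordinals smaller than \<open>N\<^sub>\<delta>\<close>.
\<close>

definition below :: "enat \<Rightarrow> nat set" where
  "below n = {i. enat i < n}"

definition countable_skeleton :: "'d set \<Rightarrow> 'd rel \<Rightarrow> ('d \<Rightarrow> enat) \<Rightarrow> bool" where
  "countable_skeleton \<Delta> r N \<longleftrightarrow>
     \<Delta> \<noteq> {} \<and> partial_order_on \<Delta> r \<and> (\<forall>\<delta>\<in>\<Delta>. N \<delta> \<noteq> 0) \<and> countable \<Delta>"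

definition countable_linear_skeleton :: "'d set \<Rightarrow> 'd rel \<Rightarrow> ('d \<Rightarrow> enat) \<Rightarrow> bool" where
  "countable_linear_skeleton \<Delta> r N \<longleftrightarrow> countable_skeleton \<Delta> r N \<and> linear_order_on \<Delta> r"

text \<open>
  Elements of a product over an index set \<open>A\<close> are partial maps with domain exactly \<open>A\<close>.  Hence
  products over different index sets are disjoint, and restriction is \<^const>\<open>restrict_map\<close>.
\<close>

definition skel_prod :: "('d \<Rightarrow> enat) \<Rightarrow> 'd set \<Rightarrow> ('d \<rightharpoonup> nat) set" where
  "skel_prod N A = {z. dom z = A \<and> (\<forall>\<gamma>\<in>A. the (z \<gamma>) \<in> below (N \<gamma>))}"

definition supp :: "('d \<rightharpoonup> nat) \<Rightarrow> 'd set" where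
  "supp z = {\<gamma> \<in> dom z. the (z \<gamma>) \<noteq> 0}"

definition Fin :: "'d set \<Rightarrow> 'd rel \<Rightarrow> 'd set set" where
  "Fin \<Delta> r = {A. A \<subseteq> \<Delta> \<and> finite A}"

definition LF :: "'d set \<Rightarrow> 'd rel \<Rightarrow> 'd set set" where
  "LF \<Delta> r = {A. A \<subseteq> \<Delta> \<and> (\<forall>\<delta>\<in>\<Delta>. finite (A \<inter> upset \<Delta> r \<delta>))}"

definition Max_sets :: "'d set \<Rightarrow> 'd rel \<Rightarrow> 'd set set" where
  "Max_sets \<Delta> r = {A. A \<subseteq> \<Delta> \<and>
     \<not> (\<exists>c::nat \<Rightarrow> 'd. \<forall>n. c n \<in> A \<and> (c n, c (Suc n)) \<in> r \<and> c n \<noteq> c (Suc n))}"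


section \<open>Domains and wreath products over them\<close>

definition is_domain :: "'d set \<Rightarrow> 'd rel \<Rightarrow> ('d \<Rightarrow> enat) \<Rightarrow> ('d \<rightharpoonup> nat) set \<Rightarrow> bool" where
  "is_domain \<Delta> r N S \<longleftrightarrow> S \<subseteq> skel_prod N \<Delta> \<and>
     (\<forall>x\<in>S. \<forall>\<delta>\<in>\<Delta>. \<forall>i\<in>below (N \<delta>). \<exists>y\<in>S. y \<delta> = Some i \<and>
        (\<forall>\<gamma>\<in>upset \<Delta> r \<delta> - {\<delta>}. y |` upset \<Delta> r \<gamma> = x |` upset \<Delta> r \<gamma>))"

definition supp_domain ::
    "'d set \<Rightarrow> ('d \<Rightarrow> enat) \<Rightarrow> 'd set set \<Rightarrow> ('d \<rightharpoonup> nat) set" where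
  "supp_domain \<Delta> N \<A> = {x \<in> skel_prod N \<Delta>. supp x \<in> \<A>}"

definition tau :: "'d set \<Rightarrow> 'd rel \<Rightarrow> ('d \<Rightarrow> enat) \<Rightarrow> ('d \<rightharpoonup> nat) topology" where
  "tau \<Delta> r N = topology_generated_by
     {{y \<in> skel_prod N \<Delta>. y |` upset \<Delta> r \<gamma> = x |` upset \<Delta> r \<gamma>} | x \<gamma>.
        x \<in> skel_prod N \<Delta> \<and> \<gamma> \<in> \<Delta>}"

definition wreath :: "'d set \<Rightarrow> 'd rel \<Rightarrow> ('d \<rightharpoonup> nat) set \<Rightarrow> (('d \<rightharpoonup> nat) \<Rightarrow> ('d \<rightharpoonup> nat)) set" where
  "wreath \<Delta> r S = {g \<in> Bij S. \<forall>x\<in>S. \<forall>y\<in>S. \<forall>\<delta>\<in>\<Delta>.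
     x |` upset \<Delta> r \<delta> = y |` upset \<Delta> r \<delta> \<longleftrightarrow> g x |` upset \<Delta> r \<delta> = g y |` upset \<Delta> r \<delta>}"

definition Wr ::
    "'d set \<Rightarrow> 'd rel \<Rightarrow> ('d \<Rightarrow> enat) \<Rightarrow> ('d \<rightharpoonup> nat) set \<Rightarrow> (('d \<rightharpoonup> nat) \<Rightarrow> ('d \<rightharpoonup> nat)) topgroup" where
  "Wr \<Delta> r N S = perm_topgroup (subtopology (tau \<Delta> r N) S) (wreath \<Delta> r S)"

definition Wr_LF :: "'d set \<Rightarrow> 'd rel \<Rightarrow> ('d \<Rightarrow> enat) \<Rightarrow> (('d \<rightharpoonup> nat) \<Rightarrow> ('d \<rightharpoonup> nat)) topgroup" where
  "Wr_LF \<Delta> r N = Wr \<Delta> r N (supp_domain \<Delta> N (LF \<Delta> r))"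

text \<open>The same abstract group as \<open>Wr\<close> for finite supports, but with the topology \<open>\<tau>\<^sup>*\<close>.\<close>

definition Wr_Fin_star ::
    "'d set \<Rightarrow> 'd rel \<Rightarrow> ('d \<Rightarrow> enat) \<Rightarrow> (('d \<rightharpoonup> nat) \<Rightarrow> ('d \<rightharpoonup> nat)) topgroup" where
  "Wr_Fin_star \<Delta> r N =
     perm_topgroup (discrete_topology (supp_domain \<Delta> N (Fin \<Delta> r)))
       (wreath \<Delta> r (supp_domain \<Delta> N (Fin \<Delta> r)))"

definition approx_homogeneous :: "'d set \<Rightarrow> 'd rel \<Rightarrow> ('d \<rightharpoonup> nat) set \<Rightarrow> bool" where
  "approx_homogeneous \<Delta> r S \<longleftrightarrow>
     (\<forall>x\<in>S. \<forall>y\<in>S. \<forall>\<delta>\<in>\<Delta>. \<exists>g\<in>wreath \<Delta> r S. g x |` upset \<Delta> r \<delta> = y |` upset \<Delta> r \<delta>)"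


section \<open>Local domains and systems of projections\<close>

definition local_part ::
    "'d set \<Rightarrow> 'd rel \<Rightarrow> ('d \<Rightarrow> enat) \<Rightarrow> ('d \<rightharpoonup> nat) set \<Rightarrow> 'd \<Rightarrow> ('d \<rightharpoonup> nat) set" where
  "local_part \<Delta> r N SS \<delta> = SS \<inter> skel_prod N (upset \<Delta> r \<delta>)"

definition local_Max :: "'d set \<Rightarrow> 'd rel \<Rightarrow> ('d \<Rightarrow> enat) \<Rightarrow> ('d \<rightharpoonup> nat) set" where
  "local_Max \<Delta> r N =
     {x |` upset \<Delta> r \<delta> | x \<delta>. \<delta> \<in> \<Delta> \<and> x \<in> supp_domain \<Delta> N (Max_sets \<Delta> r)}"

text \<open>
  The conditions common to families of local domains and systems of projections.
  The map \<open>z(\<delta> \<mapsto> i)\<close> is \<open>z\<^sup>\<delta>\<^sub>i\<close>.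
\<close>

definition local_family :: "'d set \<Rightarrow> 'd rel \<Rightarrow> ('d \<Rightarrow> enat) \<Rightarrow> ('d \<rightharpoonup> nat) set \<Rightarrow> bool" where
  "local_family \<Delta> r N SS \<longleftrightarrow>
     SS \<subseteq> (\<Union>\<delta>\<in>\<Delta>. skel_prod N (upset \<Delta> r \<delta>)) \<and>
     (\<forall>\<delta>\<in>\<Delta>. local_part \<Delta> r N SS \<delta> \<noteq> {}) \<and>
     (\<forall>\<delta>\<in>\<Delta>. \<forall>z\<in>local_part \<Delta> r N SS \<delta>. \<forall>i\<in>below (N \<delta>). z(\<delta> \<mapsto> i) \<in> local_part \<Delta> r N SS \<delta>)"

definition local_domains :: "'d set \<Rightarrow> 'd rel \<Rightarrow> ('d \<Rightarrow> enat) \<Rightarrow> ('d \<rightharpoonup> nat) set \<Rightarrow> bool" where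
  "local_domains \<Delta> r N SS \<longleftrightarrow> local_family \<Delta> r N SS \<and>
     (\<forall>\<delta>\<in>\<Delta>. \<forall>\<gamma>\<in>upset \<Delta> r \<delta>.
        local_part \<Delta> r N SS \<gamma> = (\<lambda>z. z |` upset \<Delta> r \<gamma>) ` local_part \<Delta> r N SS \<delta>)"

definition projection_system ::
    "'d set \<Rightarrow> 'd rel \<Rightarrow> ('d \<Rightarrow> enat) \<Rightarrow> ('d \<rightharpoonup> nat) set \<Rightarrow>
     ('d \<Rightarrow> 'd \<Rightarrow> ('d \<rightharpoonup> nat) \<Rightarrow> ('d \<rightharpoonup> nat)) \<Rightarrow> bool" where
  "projection_system \<Delta> r N SS pr \<longleftrightarrow> local_family \<Delta> r N SS \<and>
     (\<forall>\<delta>\<in>\<Delta>. \<forall>\<gamma>\<in>upset \<Delta> r \<delta>.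
        pr \<delta> \<gamma> ` local_part \<Delta> r N SS \<delta> = local_part \<Delta> r N SS \<gamma> \<and>
        (\<forall>z\<in>local_part \<Delta> r N SS \<delta>. \<forall>z'\<in>local_part \<Delta> r N SS \<delta>.
           pr \<delta> \<gamma> z = pr \<delta> \<gamma> z' \<longleftrightarrow> z |` upset \<Delta> r \<gamma> = z' |` upset \<Delta> r \<gamma>) \<and>
        (\<forall>\<beta>\<in>upset \<Delta> r \<gamma>. \<forall>z\<in>local_part \<Delta> r N SS \<delta>. pr \<gamma> \<beta> (pr \<delta> \<gamma> z) = pr \<delta> \<beta> z))"

definition wreath_proj ::
    "'d set \<Rightarrow> 'd rel \<Rightarrow> ('d \<Rightarrow> enat) \<Rightarrow> ('d \<rightharpoonup> nat) set \<Rightarrow>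
     ('d \<Rightarrow> 'd \<Rightarrow> ('d \<rightharpoonup> nat) \<Rightarrow> ('d \<rightharpoonup> nat)) \<Rightarrow> (('d \<rightharpoonup> nat) \<Rightarrow> ('d \<rightharpoonup> nat)) set" where
  "wreath_proj \<Delta> r N SS pr = {g \<in> Bij SS.
     (\<forall>\<delta>\<in>\<Delta>. g ` local_part \<Delta> r N SS \<delta> = local_part \<Delta> r N SS \<delta>) \<and>
     (\<forall>\<delta>\<in>\<Delta>. \<forall>\<gamma>\<in>upset \<Delta> r \<delta>. \<forall>z\<in>local_part \<Delta> r N SS \<delta>. g (pr \<delta> \<gamma> z) = pr \<delta> \<gamma> (g z))}"

definition Wr_proj ::
    "'d set \<Rightarrow> 'd rel \<Rightarrow> ('d \<Rightarrow> enat) \<Rightarrow> ('d \<rightharpoonup> nat) set \<Rightarrow>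
     ('d \<Rightarrow> 'd \<Rightarrow> ('d \<rightharpoonup> nat) \<Rightarrow> ('d \<rightharpoonup> nat)) \<Rightarrow> (('d \<rightharpoonup> nat) \<Rightarrow> ('d \<rightharpoonup> nat)) topgroup" where
  "Wr_proj \<Delta> r N SS pr = perm_topgroup (discrete_topology SS) (wreath_proj \<Delta> r N SS pr)"

definition locally_homogeneous_proj ::
    "'d set \<Rightarrow> 'd rel \<Rightarrow> ('d \<Rightarrow> enat) \<Rightarrow> ('d \<rightharpoonup> nat) set \<Rightarrow>
     ('d \<Rightarrow> 'd \<Rightarrow> ('d \<rightharpoonup> nat) \<Rightarrow> ('d \<rightharpoonup> nat)) \<Rightarrow> bool" where
  "locally_homogeneous_proj \<Delta> r N SS pr \<longleftrightarrow>
     (\<forall>\<delta>\<in>\<Delta>. \<forall>z\<in>local_part \<Delta> r N SS \<delta>. \<forall>z'\<in>local_part \<Delta> r N SS \<delta>.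
        \<exists>g\<in>wreath_proj \<Delta> r N SS pr. g z = z')"

definition wreath_local ::
    "'d set \<Rightarrow> 'd rel \<Rightarrow> ('d \<Rightarrow> enat) \<Rightarrow> ('d \<rightharpoonup> nat) set \<Rightarrow> (('d \<rightharpoonup> nat) \<Rightarrow> ('d \<rightharpoonup> nat)) set" where
  "wreath_local \<Delta> r N SS = {g \<in> Bij SS.
     (\<forall>\<delta>\<in>\<Delta>. g ` local_part \<Delta> r N SS \<delta> = local_part \<Delta> r N SS \<delta>) \<and>
     (\<forall>\<delta>\<in>\<Delta>. \<forall>\<gamma>\<in>upset \<Delta> r \<delta>. \<forall>z\<in>local_part \<Delta> r N SS \<delta>.
        g (z |` upset \<Delta> r \<gamma>) = g z |` upset \<Delta> r \<gamma>)}"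

definition Wr_local ::
    "'d set \<Rightarrow> 'd rel \<Rightarrow> ('d \<Rightarrow> enat) \<Rightarrow> ('d \<rightharpoonup> nat) set \<Rightarrow> (('d \<rightharpoonup> nat) \<Rightarrow> ('d \<rightharpoonup> nat)) topgroup" where
  "Wr_local \<Delta> r N SS = perm_topgroup (discrete_topology SS) (wreath_local \<Delta> r N SS)"

definition locally_homogeneous ::
    "'d set \<Rightarrow> 'd rel \<Rightarrow> ('d \<Rightarrow> enat) \<Rightarrow> ('d \<rightharpoonup> nat) set \<Rightarrow> bool" where
  "locally_homogeneous \<Delta> r N SS \<longleftrightarrow>
     (\<forall>\<delta>\<in>\<Delta>. \<forall>z\<in>local_part \<Delta> r N SS \<delta>. \<forall>z'\<in>local_part \<Delta> r N SS \<delta>.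
        \<exists>g\<in>wreath_local \<Delta> r N SS. g z = z')"


section \<open>Equivalence of a list of conditions\<close>

definition all_equivalent :: "bool list \<Rightarrow> bool" where
  "all_equivalent Ps \<longleftrightarrow> (\<forall>P\<in>set Ps. \<forall>Q\<in>set Ps. P \<longleftrightarrow> Q)"

text \<open>
  Conventions for the main statement.  HOL cannot quantify existentially over types, so the points
  of the spaces, trees, linear orders and skeletons are drawn from carrier types that are arbitrary
  infinite type variables, and hence universally quantified.  This loses no generality: all objects
  in question are countable (a discrete separable space is countable, and the level map of a tree
  is surjective), and an infinite type contains a copy of every countable set.
\<close>

end

theory Submission
  imports Defs
begin

text \<open>
  All the groups in question are automorphism groups of the same kind of structure: a countable
  set \<open>X\<close> with a chain of equivalence relations, indexed by a countable linear order, such that any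
  two distinct points are separated on a largest level, and such that the group acts transitively.
  For a metric space these are the relations \<open>d x y < a\<close> for the nonzero distances \<open>a\<close>; for a tree,
  a local family or a system of projections, \<open>X\<close> is the bottom level and points are compared by
  their images on the higher levels; for a wreath product, by their restrictions.
  Adding a least level (equality) and a greatest level (the total relation) does not change the
  group, which is why finite supports over an order without minimum give nothing new.

  Conversely, such a structure is coordinatized by the functions of finite support: enumerate \<open>X\<close>,
  let the leader of a class be its element of least index, and number the classes into which a
  class splits at level \<open>\<delta>\<close> so that the one containing the leader gets the number 0.  By homogeneity
  the number of these classes depends only on \<open>\<delta>\<close>.  A point has finite support, since each
  nonzero coordinate is a level at which the index of the leader of its class drops.
\<close>

section \<open>Permutation groups with the topology of pointwise convergence\<close>

text \<open>A permutation of the points that respects every level relation is an automorphism of the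
  structure or extends to a unique one, and each value of the extension depends on one value on the
  points. So the groups agree, and their topologies with them. Two obstacles shape the rest. The
  carrier types of the theorem are unrelated infinite types, so the conditions are not compared with
  one another but each with \<open>level_realizable\<close>, which speaks of \<open>nat\<close>
  only; each existential is then reached by copying a system along injections. Moreover
  \<open>level_system\<close> asks for a point, without which the branching numbers would vanish,
  while the empty ultrametric space and the empty domain satisfy their conditions. Both have the
  trivial group, which a single point without levels realizes as well. The restriction to supports
  without infinite increasing chains has one purpose here: it provides the largest level that
  separates two functions.\<close>

lemma topgroup_iso_trans:
  assumes "\<G> \<cong>\<^sub>t \<H>" "\<H> \<cong>\<^sub>t \<K>"
  shows "\<G> \<cong>\<^sub>t \<K>"
proof -
  obtain h k where "h \<in> iso (fst \<G>) (fst \<H>)" "homeomorphic_map (snd \<G>) (snd \<H>) h"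
    "k \<in> iso (fst \<H>) (fst \<K>)" "homeomorphic_map (snd \<H>) (snd \<K>) k"
    using assms unfolding topgroup_iso_def by auto
  then have "k \<circ> h \<in> iso (fst \<G>) (fst \<K>) \<and> homeomorphic_map (snd \<G>) (snd \<K>) (k \<circ> h)"
    by (simp add: iso_set_trans homeomorphic_map_compose)
  then show ?thesis unfolding topgroup_iso_def by (intro exI[of _ "k \<circ> h"])
qed

lemma Bij_apply: "f \<in> Bij X \<Longrightarrow> x \<in> X \<Longrightarrow> f x \<in> X"
  by (drule Bij_imp_funcset) (rule funcset_mem)

lemma Bij_eqI: "f \<in> Bij X \<Longrightarrow> g \<in> Bij X \<Longrightarrow> (\<And>x. x \<in> X \<Longrightarrow> f x = g x) \<Longrightarrow> f = g"
  by (blast intro: extensionalityI dest: Bij_imp_extensional)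

lemma BijI:
  "f \<in> extensional X \<Longrightarrow> inj_on f X \<Longrightarrow> (\<And>x. x \<in> X \<Longrightarrow> f x \<in> X) \<Longrightarrow>
   (\<And>y. y \<in> X \<Longrightarrow> \<exists>x\<in>X. f x = y) \<Longrightarrow> f \<in> Bij X"
  by (auto simp: Bij_def bij_betw_def)

lemma Bij_inj: "f \<in> Bij X \<Longrightarrow> x \<in> X \<Longrightarrow> y \<in> X \<Longrightarrow> f x = f y \<longleftrightarrow> x = y"
  by (auto simp: Bij_def bij_betw_def inj_on_def)

lemma Bij_surj: "f \<in> Bij X \<Longrightarrow> y \<in> X \<Longrightarrow> \<exists>x\<in>X. f x = y"
  by (metis Bij_def Int_iff bij_betw_imp_surj_on imageE mem_Collect_eq)

lemma carrier_perm_topgroup [simp]: "carrier (fst (perm_topgroup X K)) = K"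
  by (simp add: perm_topgroup_def)

lemma mult_perm_topgroup:
  "K \<subseteq> Bij (topspace X) \<Longrightarrow> f \<in> K \<Longrightarrow> g \<in> K \<Longrightarrow>
   f \<otimes>\<^bsub>fst (perm_topgroup X K)\<^esub> g = compose (topspace X) f g"
  by (auto simp: perm_topgroup_def BijGroup_def)

lemma topspace_perm_topgroup:
  "K \<subseteq> Bij (topspace X) \<Longrightarrow> topspace (snd (perm_topgroup X K)) = K"
  using Bij_imp_funcset Bij_imp_extensional by (fastforce simp: perm_topgroup_def PiE_def)

text \<open>By \<open>dep\<close> every coordinate \<open>h f y\<close> is locally constant in
  \<open>f\<close>: it does not change on the basic open set of those permutations in
  \<open>K\<close> that agree with \<open>f\<close> on \<open>F\<close>.\<close>

lemma continuous_map_perm_topgroup: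
  assumes K: "K \<subseteq> Bij X" and K': "K' \<subseteq> Bij Y"
    and h: "\<And>f. f \<in> K \<Longrightarrow> h f \<in> K'"
    and dep: "\<And>y. y \<in> Y \<Longrightarrow> \<exists>F. finite F \<and> F \<subseteq> X \<and>
           (\<forall>f\<in>K. \<forall>g\<in>K. (\<forall>x\<in>F. f x = g x) \<longrightarrow> h f y = h g y)"
  shows "continuous_map (snd (perm_topgroup (discrete_topology X) K))
           (snd (perm_topgroup (discrete_topology Y) K')) h"
proof -
  let ?P = "product_topology (\<lambda>_. discrete_topology X) X"
  have top: "topspace (subtopology ?P K) = K"
    using topspace_perm_topgroup[of K "discrete_topology X"] K by (simp add: perm_topgroup_def)
  have "continuous_map (subtopology ?P K) (discrete_topology Y) (\<lambda>f. h f y)" if y: "y \<in> Y" for y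
    unfolding continuous_map_def
  proof (intro conjI allI impI)
    show "(\<lambda>f. h f y) \<in> topspace (subtopology ?P K) \<rightarrow> topspace (discrete_topology Y)"
      unfolding top using Bij_apply[OF subsetD[OF K' h] y] by simp
  next
    fix U
    obtain F where F: "finite F" "F \<subseteq> X"
      and dF: "\<And>f g. f \<in> K \<Longrightarrow> g \<in> K \<Longrightarrow> (\<forall>x\<in>F. f x = g x) \<Longrightarrow> h f y = h g y"
      using dep[OF y] by blast
    show "openin (subtopology ?P K) {f \<in> topspace (subtopology ?P K). h f y \<in> U}"
      unfolding top
    proof (subst openin_subopen, intro ballI)
      fix f assume f: "f \<in> {f \<in> K. h f y \<in> U}"
      then have fB: "f \<in> Bij X" using K by auto
      have fX: "f x \<in> X" if "x \<in> X" for x using Bij_apply[OF fB that] .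
      let ?N = "K \<inter> PiE X (\<lambda>x. if x \<in> F then {f x} else X)"
      have "openin ?P (PiE X (\<lambda>x. if x \<in> F then {f x} else X))"
      proof (intro product_topology_basis)
        show "openin (discrete_topology X) (if x \<in> F then {f x} else X)" for x
          using fX F(2) by auto
        show "finite {x. (if x \<in> F then {f x} else X) \<noteq> topspace (discrete_topology X)}"
          by (rule finite_subset[OF _ F(1)]) auto
      qed
      then have "openin (subtopology ?P K) ?N"
        by (auto simp: openin_subtopology)
      moreover have "f \<in> ?N"
        using f fX Bij_imp_extensional[OF fB] by (auto simp: PiE_iff)
      moreover have "?N \<subseteq> {f \<in> K. h f y \<in> U}"
      proof
        fix g assume g: "g \<in> ?N"
        then have "\<forall>x\<in>F. g x = f x" using F(2) by (fastforce simp: PiE_iff)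
        then have "h g y = h f y" using g f dF by blast
        then show "g \<in> {f \<in> K. h f y \<in> U}" using g f by simp
      qed
      ultimately show "\<exists>T. openin (subtopology ?P K) T \<and> f \<in> T \<and> T \<subseteq> {f \<in> K. h f y \<in> U}"
        by blast
    qed
  qed
  moreover have "h ` K \<subseteq> extensional Y" using h K' using Bij_imp_extensional by blast
  ultimately show ?thesis
    using h top by (auto simp: perm_topgroup_def continuous_map_in_subtopology continuous_map_componentwise)
qed

text \<open>
  Pointwise convergence on a discrete set is governed by agreement on finite sets, so a map is a
  homeomorphism as soon as each value of \<open>h f\<close> depends on finitely many values of \<open>f\<close> and conversely.
\<close>

lemma perm_topgroup_isoI:
  assumes K: "K \<subseteq> Bij X" and K': "K' \<subseteq> Bij Y" and bij: "bij_betw h K K'"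
    and closed: "\<And>f g. f \<in> K \<Longrightarrow> g \<in> K \<Longrightarrow> compose X f g \<in> K"
    and mult: "\<And>f g. f \<in> K \<Longrightarrow> g \<in> K \<Longrightarrow> h (compose X f g) = compose Y (h f) (h g)"
    and dep: "\<And>y. y \<in> Y \<Longrightarrow> \<exists>F. finite F \<and> F \<subseteq> X \<and>
           (\<forall>f\<in>K. \<forall>g\<in>K. (\<forall>x\<in>F. f x = g x) \<longrightarrow> h f y = h g y)"
    and dep': "\<And>x. x \<in> X \<Longrightarrow> \<exists>F. finite F \<and> F \<subseteq> Y \<and>
           (\<forall>f\<in>K. \<forall>g\<in>K. (\<forall>y\<in>F. h f y = h g y) \<longrightarrow> f x = g x)"
  shows "perm_topgroup (discrete_topology X) K \<cong>\<^sub>t perm_topgroup (discrete_topology Y) K'"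
    and "perm_topgroup (discrete_topology Y) K' \<cong>\<^sub>t perm_topgroup (discrete_topology X) K"
proof -
  let ?A = "perm_topgroup (discrete_topology X) K"
  let ?B = "perm_topgroup (discrete_topology Y) K'"
  let ?k = "inv_into K h"
  have tA: "topspace (snd ?A) = K" and tB: "topspace (snd ?B) = K'"
    using K K' by (simp_all add: topspace_perm_topgroup)
  have hK: "h f \<in> K'" if "f \<in> K" for f using bij that by (auto simp: bij_betw_def)
  have kK: "?k f \<in> K" if "f \<in> K'" for f using bij that by (metis bij_betw_def inv_into_into)
  have kh: "?k (h f) = f" if "f \<in> K" for f using bij that by (simp add: bij_betw_inv_into_left)
  have hk: "h (?k f) = f" if "f \<in> K'" for f using bij that by (simp add: bij_betw_inv_into_right)
  have bij': "bij_betw ?k K' K" using bij by (rule bij_betw_inv_into)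
  have c1: "continuous_map (snd ?A) (snd ?B) h"
    using K K' hK dep by (rule continuous_map_perm_topgroup)
  have c2: "continuous_map (snd ?B) (snd ?A) ?k"
  proof (rule continuous_map_perm_topgroup[OF K' K kK])
    fix x assume "x \<in> X"
    then obtain F where F: "finite F" "F \<subseteq> Y"
      "\<And>f g. f \<in> K \<Longrightarrow> g \<in> K \<Longrightarrow> (\<forall>y\<in>F. h f y = h g y) \<Longrightarrow> f x = g x"
      using dep' by meson
    then have "\<forall>f\<in>K'. \<forall>g\<in>K'. (\<forall>y\<in>F. f y = g y) \<longrightarrow> ?k f x = ?k g x"
      using kK hk by metis
    then show "\<exists>F. finite F \<and> F \<subseteq> Y \<and>
           (\<forall>f\<in>K'. \<forall>g\<in>K'. (\<forall>y\<in>F. f y = g y) \<longrightarrow> ?k f x = ?k g x)" using F by blast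
  qed
  have hm: "homeomorphic_maps (snd ?A) (snd ?B) h ?k"
    unfolding homeomorphic_maps_def tA tB using c1 c2 kh hk by blast
  have mA: "f \<otimes>\<^bsub>fst ?A\<^esub> g = compose X f g" if "f \<in> K" "g \<in> K" for f g
    using that K by (simp add: mult_perm_topgroup)
  have mB: "f \<otimes>\<^bsub>fst ?B\<^esub> g = compose Y f g" if "f \<in> K'" "g \<in> K'" for f g
    using that K' by (simp add: mult_perm_topgroup)
  have i1: "h \<in> iso (fst ?A) (fst ?B)"
    using bij by (auto simp: iso_def hom_def hK mA mB mult)
  \<comment> \<open>\<open>closed\<close> puts the composition of two preimages into
    \<open>K\<close>, so \<open>mult\<close> transfers to \<open>?k\<close>. Both directions of the
    isomorphism thus come without appeal to the group axioms.\<close>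
  have "?k (compose Y f g) = compose X (?k f) (?k g)" if "f \<in> K'" "g \<in> K'" for f g
    using mult[of "?k f" "?k g"] closed[of "?k f" "?k g"] that by (metis hk kK kh)
  then have i2: "?k \<in> iso (fst ?B) (fst ?A)"
    using bij' by (auto simp: iso_def hom_def kK mA mB)
  show "?A \<cong>\<^sub>t ?B" unfolding topgroup_iso_def
    using i1 hm homeomorphic_map_maps by blast
  show "?B \<cong>\<^sub>t ?A" unfolding topgroup_iso_def
    using i2 hm homeomorphic_map_maps homeomorphic_maps_sym by blast
qed

section \<open>Systems of levels\<close>

text \<open>
  Only the kernel of \<open>q \<delta>\<close> matters: it is the equivalence relation of level \<open>\<delta>\<close>.
\<close>

definition level_perms :: "'d set \<Rightarrow> 'x set \<Rightarrow> ('d \<Rightarrow> 'x \<Rightarrow> 'c) \<Rightarrow> ('x \<Rightarrow> 'x) set" where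
  "level_perms \<Delta> X q =
     {g \<in> Bij X. \<forall>\<delta>\<in>\<Delta>. \<forall>x\<in>X. \<forall>y\<in>X. q \<delta> x = q \<delta> y \<longleftrightarrow> q \<delta> (g x) = q \<delta> (g y)}"

abbreviation level_group :: "'d set \<Rightarrow> 'x set \<Rightarrow> ('d \<Rightarrow> 'x \<Rightarrow> 'c) \<Rightarrow> ('x \<Rightarrow> 'x) topgroup" where
  "level_group \<Delta> X q \<equiv> perm_topgroup (discrete_topology X) (level_perms \<Delta> X q)"

text \<open>Relations grow with the level. \<open>max_split\<close> is the abstract form of the
  distance of two points, or of the topmost level of a tree on which their images differ. No single
  level is required to separate all points, as none need do so for finite supports over an order
  without minimum.\<close>

locale level_system =
  fixes \<Delta> :: "'d set" and r :: "'d rel" and X :: "'x set" and q :: "'d \<Rightarrow> 'x \<Rightarrow> 'c"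
  assumes lin: "linear_order_on \<Delta> r"
    and countable_levels: "countable \<Delta>"
    and countable_points: "countable X"
    and nonempty: "X \<noteq> {}"
    and coarser: "\<And>\<gamma> \<delta> x y. (\<delta>, \<gamma>) \<in> r \<Longrightarrow> x \<in> X \<Longrightarrow> y \<in> X \<Longrightarrow> q \<delta> x = q \<delta> y \<Longrightarrow> q \<gamma> x = q \<gamma> y"
    and max_split: "\<And>x y. x \<in> X \<Longrightarrow> y \<in> X \<Longrightarrow> x \<noteq> y \<Longrightarrow> has_maximum {\<delta> \<in> \<Delta>. q \<delta> x \<noteq> q \<delta> y} r"
    and transitive: "\<And>x y. x \<in> X \<Longrightarrow> y \<in> X \<Longrightarrow> \<exists>g\<in>level_perms \<Delta> X q. g x = y"

lemma level_perms_Bij: "level_perms \<Delta> X q \<subseteq> Bij X"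
  by (auto simp: level_perms_def)

lemma level_perms_iff:
  "g \<in> level_perms \<Delta> X q \<Longrightarrow> \<delta> \<in> \<Delta> \<Longrightarrow> x \<in> X \<Longrightarrow> y \<in> X \<Longrightarrow> q \<delta> (g x) = q \<delta> (g y) \<longleftrightarrow> q \<delta> x = q \<delta> y"
  by (auto simp: level_perms_def)

lemma compose_level_perms:
  "f \<in> level_perms \<Delta> X q \<Longrightarrow> g \<in> level_perms \<Delta> X q \<Longrightarrow> compose X f g \<in> level_perms \<Delta> X q"
  by (auto simp: level_perms_def compose_Bij compose_eq Bij_apply)

lemma level_perms_cong:
  assumes "\<And>\<delta> x y. \<delta> \<in> \<Delta> \<Longrightarrow> x \<in> X \<Longrightarrow> y \<in> X \<Longrightarrow> q \<delta> x = q \<delta> y \<longleftrightarrow> q' \<delta> x = q' \<delta> y"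
  shows "level_perms \<Delta> X q = level_perms \<Delta> X q'"
  unfolding level_perms_def using assms Bij_apply by (smt (verit, best) Collect_cong)

lemma linear_orderD:
  assumes "linear_order_on A r"
  shows "(a, b) \<in> r \<Longrightarrow> a \<in> A \<and> b \<in> A"
    and "a \<in> A \<Longrightarrow> (a, a) \<in> r"
    and "(a, b) \<in> r \<Longrightarrow> (b, c) \<in> r \<Longrightarrow> (a, c) \<in> r"
    and "(a, b) \<in> r \<Longrightarrow> (b, a) \<in> r \<Longrightarrow> a = b"
    and "a \<in> A \<Longrightarrow> b \<in> A \<Longrightarrow> (a, b) \<in> r \<or> (b, a) \<in> r"
proof -
  have r: "refl_on A r" and t: "trans r" and a: "antisym r" and o: "total_on A r" and s: "r \<subseteq> A \<times> A"
    using assms by (simp_all add: order_on_defs)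
  show "(a, b) \<in> r \<Longrightarrow> a \<in> A \<and> b \<in> A" using s by blast
  show "a \<in> A \<Longrightarrow> (a, a) \<in> r" using r by (rule refl_onD)
  show "(a, b) \<in> r \<Longrightarrow> (b, c) \<in> r \<Longrightarrow> (a, c) \<in> r" using t by (rule transD)
  show "(a, b) \<in> r \<Longrightarrow> (b, a) \<in> r \<Longrightarrow> a = b" using a by (rule antisymD)
  show "a \<in> A \<Longrightarrow> b \<in> A \<Longrightarrow> (a, b) \<in> r \<or> (b, a) \<in> r"
    using r o unfolding total_on_def by (metis refl_onD)
qed

text \<open>
  Trees, local families and systems of projections all have the shape of a ladder over their
  lowest level: the elements of level \<open>\<delta>\<close> are the images \<open>p \<delta> x\<close> of the elements \<open>x\<close> of the lowest level.
\<close>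

definition ladder_perms :: "'d set \<Rightarrow> 'x set \<Rightarrow> ('d \<Rightarrow> 'x \<Rightarrow> 't) \<Rightarrow> ('t \<Rightarrow> 't) set" where
  "ladder_perms \<Delta> X p = {f \<in> Bij (\<Union>\<delta>\<in>\<Delta>. p \<delta> ` X).
     \<exists>g\<in>level_perms \<Delta> X p. \<forall>\<delta>\<in>\<Delta>. \<forall>x\<in>X. f (p \<delta> x) = p \<delta> (g x)}"

text \<open>\<open>disj\<close> makes \<delta> recoverable from \<open>p \<delta> x\<close>, and
  \<open>g\<close> respects the kernel of \<open>p \<delta>\<close>. So sending
  \<open>p \<delta> x\<close> to \<open>p \<delta> (g x)\<close> does not depend on the choice of
  \<open>x\<close>, and it is injective for the same reasons.\<close>

lemma ladder_lift:
  assumes disj: "\<And>\<delta> \<gamma> x y. \<delta> \<in> \<Delta> \<Longrightarrow> \<gamma> \<in> \<Delta> \<Longrightarrow> x \<in> X \<Longrightarrow> y \<in> X \<Longrightarrow> p \<delta> x = p \<gamma> y \<Longrightarrow> \<delta> = \<gamma>"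
    and g: "g \<in> level_perms \<Delta> X p"
  shows "\<exists>f\<in>ladder_perms \<Delta> X p. \<forall>\<delta>\<in>\<Delta>. \<forall>x\<in>X. f (p \<delta> x) = p \<delta> (g x)"
proof -
  let ?T = "\<Union>\<delta>\<in>\<Delta>. p \<delta> ` X"
  define f where "f = (\<lambda>t\<in>?T. SOME s. \<exists>\<delta>\<in>\<Delta>. \<exists>x\<in>X. t = p \<delta> x \<and> s = p \<delta> (g x))"
  have gB: "g \<in> Bij X" using g level_perms_Bij by blast
  have gX: "g x \<in> X" if "x \<in> X" for x using Bij_apply[OF gB that] .
  have f: "f (p \<delta> x) = p \<delta> (g x)" if "\<delta> \<in> \<Delta>" "x \<in> X" for \<delta> x
  proof -
    have "\<exists>s. \<exists>\<delta>'\<in>\<Delta>. \<exists>x'\<in>X. p \<delta> x = p \<delta>' x' \<and> s = p \<delta>' (g x')" using that by blast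
    from someI_ex[OF this] have "\<exists>\<delta>'\<in>\<Delta>. \<exists>x'\<in>X. p \<delta> x = p \<delta>' x' \<and> f (p \<delta> x) = p \<delta>' (g x')"
      unfolding f_def using that by (subst restrict_apply') auto
    then obtain \<delta>' x' where *: "\<delta>' \<in> \<Delta>" "x' \<in> X" "p \<delta> x = p \<delta>' x'" "f (p \<delta> x) = p \<delta>' (g x')"
      by blast
    then have "\<delta>' = \<delta>" using disj that by metis
    with * show ?thesis using level_perms_iff[OF g that(1,2) *(2)] by simp
  qed
  have "f \<in> Bij ?T"
  proof (rule BijI)
    show "f \<in> extensional ?T" by (simp add: f_def)
    show "inj_on f ?T"
    proof (rule inj_onI)
      fix s t assume "s \<in> ?T" "t \<in> ?T" and eq: "f s = f t"
      then obtain \<delta> x \<gamma> y where *: "\<delta> \<in> \<Delta>" "x \<in> X" "s = p \<delta> x" "\<gamma> \<in> \<Delta>" "y \<in> X" "t = p \<gamma> y"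
        by blast
      then have e: "p \<delta> (g x) = p \<gamma> (g y)" using eq f by simp
      then have "\<delta> = \<gamma>" using disj * gX by metis
      then show "s = t" using e * level_perms_iff[OF g] by metis
    qed
    show "f t \<in> ?T" if "t \<in> ?T" for t using that f gX by fastforce
    show "\<exists>s\<in>?T. f s = t" if "t \<in> ?T" for t
    proof -
      obtain \<delta> y where t: "\<delta> \<in> \<Delta>" "y \<in> X" "t = p \<delta> y" using \<open>t \<in> ?T\<close> by blast
      obtain x where x: "x \<in> X" "g x = y" using Bij_surj[OF gB t(2)] by blast
      show ?thesis using t x f[OF t(1) x(1)] by (intro bexI[of _ "p \<delta> x"]) auto
    qed
  qed
  moreover have "\<forall>\<delta>\<in>\<Delta>. \<forall>x\<in>X. f (p \<delta> x) = p \<delta> (g x)" using f by blast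
  ultimately have "f \<in> ladder_perms \<Delta> X p"
    unfolding ladder_perms_def using g by blast
  then show ?thesis using f by (intro bexI[of _ f] ballI)
qed

text \<open>As \<open>p m\<close> is injective, level \<open>m\<close> is a copy of
  \<open>X\<close>, so \<open>g\<close> can be read off from its lift. The lift at
  \<open>p \<delta> x\<close> needs the value of \<open>g\<close> at \<open>x\<close> alone, and
  \<open>g x\<close> needs the lift at \<open>p m x\<close> alone; one-element sets therefore
  suffice for both continuity conditions.\<close>

lemma ladder_group_iso:
  assumes disj: "\<And>\<delta> \<gamma> x y. \<delta> \<in> \<Delta> \<Longrightarrow> \<gamma> \<in> \<Delta> \<Longrightarrow> x \<in> X \<Longrightarrow> y \<in> X \<Longrightarrow> p \<delta> x = p \<gamma> y \<Longrightarrow> \<delta> = \<gamma>"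
    and m: "m \<in> \<Delta>" "inj_on (p m) X" and T: "T = (\<Union>\<delta>\<in>\<Delta>. p \<delta> ` X)"
  shows "level_group \<Delta> X p \<cong>\<^sub>t perm_topgroup (discrete_topology T) (ladder_perms \<Delta> X p)"
    and "perm_topgroup (discrete_topology T) (ladder_perms \<Delta> X p) \<cong>\<^sub>t level_group \<Delta> X p"
proof -
  let ?K = "level_perms \<Delta> X p" and ?L = "ladder_perms \<Delta> X p"
  have "\<exists>f. f \<in> ?L \<and> (\<forall>\<delta>\<in>\<Delta>. \<forall>x\<in>X. f (p \<delta> x) = p \<delta> (g x))" if "g \<in> ?K" for g
    using ladder_lift[of \<Delta> X p g] disj that by (simp add: Bex_def)
  then have "\<forall>g\<in>?K. \<exists>f. f \<in> ?L \<and> (\<forall>\<delta>\<in>\<Delta>. \<forall>x\<in>X. f (p \<delta> x) = p \<delta> (g x))" by (rule ballI)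
  then obtain h where h0: "\<forall>g\<in>?K. h g \<in> ?L \<and> (\<forall>\<delta>\<in>\<Delta>. \<forall>x\<in>X. h g (p \<delta> x) = p \<delta> (g x))"
    by (rule bchoice[THEN exE])
  have hL: "h g \<in> ?L" if "g \<in> ?K" for g using bspec[OF h0 that] by simp
  have h: "h g (p \<delta> x) = p \<delta> (g x)" if "g \<in> ?K" "\<delta> \<in> \<Delta>" "x \<in> X" for g \<delta> x
    using bspec[OF h0 that(1)] that by simp
  have gX: "g x \<in> X" if "g \<in> ?K" "x \<in> X" for g x
    using Bij_apply[OF subsetD[OF level_perms_Bij that(1)] that(2)] .
  have LB: "?L \<subseteq> Bij T" by (auto simp: ladder_perms_def T)
  have eqL: "f = f'" if "f \<in> Bij T" "f' \<in> Bij T" "\<And>\<delta> x. \<delta> \<in> \<Delta> \<Longrightarrow> x \<in> X \<Longrightarrow> f (p \<delta> x) = f' (p \<delta> x)" for f f'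
    using that by (intro Bij_eqI[OF that(1,2)]) (auto simp: T)
  have bij: "bij_betw h ?K ?L"
  proof (rule bij_betw_imageI)
    show "inj_on h ?K"
    proof (rule inj_onI)
      fix g g' assume g: "g \<in> ?K" "g' \<in> ?K" and eq: "h g = h g'"
      show "g = g'"
      proof (rule Bij_eqI)
        show "g \<in> Bij X" "g' \<in> Bij X" using g level_perms_Bij by blast+
        fix x assume "x \<in> X"
        then have "p m (g x) = p m (g' x)" using h[OF g(1) m(1)] h[OF g(2) m(1)] eq by metis
        then show "g x = g' x" using m(2) gX g \<open>x \<in> X\<close> by (meson inj_onD)
      qed
    qed
    show "h ` ?K = ?L"
    proof
      show "h ` ?K \<subseteq> ?L" using hL by blast
      show "?L \<subseteq> h ` ?K"
      proof
        fix f assume "f \<in> ?L"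
        then obtain g where g: "g \<in> ?K" "\<And>\<delta> x. \<delta> \<in> \<Delta> \<Longrightarrow> x \<in> X \<Longrightarrow> f (p \<delta> x) = p \<delta> (g x)"
          by (auto simp: ladder_perms_def)
        have "f = h g" using \<open>f \<in> ?L\<close> LB hL[OF g(1)] g h by (intro eqL) auto
        then show "f \<in> h ` ?K" using g by blast
      qed
    qed
  qed
  have mult: "h (compose X f g) = compose T (h f) (h g)" if fg: "f \<in> ?K" "g \<in> ?K" for f g
  proof (rule eqL)
    show "h (compose X f g) \<in> Bij T" using hL compose_level_perms[OF fg] LB by blast
    show "compose T (h f) (h g) \<in> Bij T" using compose_Bij hL LB fg by (meson subsetD)
    fix \<delta> x assume "\<delta> \<in> \<Delta>" "x \<in> X"
    then show "h (compose X f g) (p \<delta> x) = compose T (h f) (h g) (p \<delta> x)"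
      using h[OF compose_level_perms[OF fg]] h[OF fg(1)] h[OF fg(2)] gX[OF fg(2)]
      by (auto simp: compose_def T)
  qed
  have dep: "\<exists>F. finite F \<and> F \<subseteq> X \<and> (\<forall>f\<in>?K. \<forall>g\<in>?K. (\<forall>x\<in>F. f x = g x) \<longrightarrow> h f t = h g t)"
    if "t \<in> T" for t
  proof -
    obtain \<delta> x where "\<delta> \<in> \<Delta>" "x \<in> X" "t = p \<delta> x" using \<open>t \<in> T\<close> T by blast
    then show ?thesis using h by (intro exI[of _ "{x}"]) simp
  qed
  have dep': "\<exists>F. finite F \<and> F \<subseteq> T \<and> (\<forall>f\<in>?K. \<forall>g\<in>?K. (\<forall>t\<in>F. h f t = h g t) \<longrightarrow> f x = g x)"
    if "x \<in> X" for x
  proof (intro exI[of _ "{p m x}"] conjI ballI impI)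
    show "{p m x} \<subseteq> T" using m that T by blast
    fix f g assume fg: "f \<in> ?K" "g \<in> ?K" "\<forall>t\<in>{p m x}. h f t = h g t"
    then have "p m (f x) = p m (g x)" using h m(1) that by simp
    then show "f x = g x" using m(2) gX fg that by (meson inj_onD)
  qed simp
  note iso = perm_topgroup_isoI[OF level_perms_Bij LB bij compose_level_perms mult dep dep']
  show "level_group \<Delta> X p \<cong>\<^sub>t perm_topgroup (discrete_topology T) ?L"
    by (rule iso(1))
  show "perm_topgroup (discrete_topology T) ?L \<cong>\<^sub>t level_group \<Delta> X p"
    by (rule iso(2))
qed

section \<open>Conjugation along an injection of the points\<close>

definition conj_perm :: "'x set \<Rightarrow> ('x \<Rightarrow> 'y) \<Rightarrow> ('x \<Rightarrow> 'x) \<Rightarrow> 'y \<Rightarrow> 'y" where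
  "conj_perm X \<phi> f = (\<lambda>y\<in>\<phi> ` X. \<phi> (f (inv_into X \<phi> y)))"

lemma conj_perm_apply: "inj_on \<phi> X \<Longrightarrow> x \<in> X \<Longrightarrow> conj_perm X \<phi> f (\<phi> x) = \<phi> (f x)"
  by (simp add: conj_perm_def)

lemma conj_perm_Bij:
  assumes inj: "inj_on \<phi> X" and f: "f \<in> Bij X"
  shows "conj_perm X \<phi> f \<in> Bij (\<phi> ` X)"
proof (rule BijI)
  show "conj_perm X \<phi> f \<in> extensional (\<phi> ` X)" by (simp add: conj_perm_def)
  show "inj_on (conj_perm X \<phi> f) (\<phi> ` X)"
    using inj_on_eq_iff[OF inj] Bij_apply[OF f] Bij_inj[OF f]
    by (auto simp: inj_on_def conj_perm_apply[OF inj])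
  show "conj_perm X \<phi> f y \<in> \<phi> ` X" if "y \<in> \<phi> ` X" for y
    using that Bij_apply[OF f] by (auto simp: conj_perm_apply[OF inj])
  show "\<exists>x\<in>\<phi> ` X. conj_perm X \<phi> f x = y" if "y \<in> \<phi> ` X" for y
    using that Bij_surj[OF f] by (auto simp: conj_perm_apply[OF inj])
qed

text \<open>Every bijection preserves equality and the total relation. This is why \<open>A'\<close>
  admits target levels without a counterpart, provided that \<open>q'\<close> is injective or
  constant on them.\<close>

lemma level_perms_conj:
  assumes inj: "inj_on \<phi> X" and f: "f \<in> Bij X"
    and A: "\<And>\<delta>. \<delta> \<in> \<Delta> \<Longrightarrow> \<exists>\<delta>'\<in>\<Delta>'. \<forall>x\<in>X. \<forall>y\<in>X. q \<delta> x = q \<delta> y \<longleftrightarrow> q' \<delta>' (\<phi> x) = q' \<delta>' (\<phi> y)"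
    and A': "\<And>\<delta>'. \<delta>' \<in> \<Delta>' \<Longrightarrow>
      (\<exists>\<delta>\<in>\<Delta>. \<forall>x\<in>X. \<forall>y\<in>X. q \<delta> x = q \<delta> y \<longleftrightarrow> q' \<delta>' (\<phi> x) = q' \<delta>' (\<phi> y)) \<or>
      inj_on (q' \<delta>') (\<phi> ` X) \<or> (\<forall>x\<in>X. \<forall>y\<in>X. q' \<delta>' (\<phi> x) = q' \<delta>' (\<phi> y))"
  shows "conj_perm X \<phi> f \<in> level_perms \<Delta>' (\<phi> ` X) q' \<longleftrightarrow> f \<in> level_perms \<Delta> X q"
proof
  assume L: "conj_perm X \<phi> f \<in> level_perms \<Delta>' (\<phi> ` X) q'"
  have "q \<delta> x = q \<delta> y \<longleftrightarrow> q \<delta> (f x) = q \<delta> (f y)" if *: "\<delta> \<in> \<Delta>" "x \<in> X" "y \<in> X" for \<delta> x y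
  proof -
    obtain \<delta>' where \<delta>': "\<delta>' \<in> \<Delta>'" "\<And>x y. x \<in> X \<Longrightarrow> y \<in> X \<Longrightarrow> q \<delta> x = q \<delta> y \<longleftrightarrow> q' \<delta>' (\<phi> x) = q' \<delta>' (\<phi> y)"
      using A[OF *(1)] by blast
    have "q' \<delta>' (\<phi> (f x)) = q' \<delta>' (\<phi> (f y)) \<longleftrightarrow> q' \<delta>' (\<phi> x) = q' \<delta>' (\<phi> y)"
      using level_perms_iff[OF L \<delta>'(1), of "\<phi> x" "\<phi> y"] * by (simp add: conj_perm_apply[OF inj])
    then show ?thesis using \<delta>'(2) Bij_apply[OF f] * by simp
  qed
  then show "f \<in> level_perms \<Delta> X q" using f by (simp add: level_perms_def)
next
  assume L: "f \<in> level_perms \<Delta> X q"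
  have "q' \<delta>' (\<phi> x) = q' \<delta>' (\<phi> y) \<longleftrightarrow> q' \<delta>' (\<phi> (f x)) = q' \<delta>' (\<phi> (f y))"
    if *: "\<delta>' \<in> \<Delta>'" "x \<in> X" "y \<in> X" for \<delta>' x y
    using A'[OF *(1)]
  proof (elim disjE)
    assume "\<exists>\<delta>\<in>\<Delta>. \<forall>x\<in>X. \<forall>y\<in>X. q \<delta> x = q \<delta> y \<longleftrightarrow> q' \<delta>' (\<phi> x) = q' \<delta>' (\<phi> y)"
    then show ?thesis using level_perms_iff[OF L] * Bij_apply[OF f] by metis
  next
    assume "inj_on (q' \<delta>') (\<phi> ` X)"
    then show ?thesis using * Bij_apply[OF f] Bij_inj[OF f] inj by (auto simp: inj_on_eq_iff)
  next
    assume "\<forall>x\<in>X. \<forall>y\<in>X. q' \<delta>' (\<phi> x) = q' \<delta>' (\<phi> y)"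
    then show ?thesis using * Bij_apply[OF f] by metis
  qed
  then show "conj_perm X \<phi> f \<in> level_perms \<Delta>' (\<phi> ` X) q'"
    using conj_perm_Bij[OF inj f] by (auto simp: level_perms_def conj_perm_apply[OF inj])
qed

lemma perm_topgroup_conj:
  assumes inj: "inj_on \<phi> X" and K: "K \<subseteq> Bij X" and K': "K' \<subseteq> Bij (\<phi> ` X)"
    and closed: "\<And>f g. f \<in> K \<Longrightarrow> g \<in> K \<Longrightarrow> compose X f g \<in> K"
    and KK': "\<And>f. f \<in> Bij X \<Longrightarrow> conj_perm X \<phi> f \<in> K' \<longleftrightarrow> f \<in> K"
  shows "perm_topgroup (discrete_topology X) K \<cong>\<^sub>t perm_topgroup (discrete_topology (\<phi> ` X)) K'"
proof -
  let ?h = "conj_perm X \<phi>"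
  have KX: "f x \<in> X" if "f \<in> K" "x \<in> X" for f x using Bij_apply[OF subsetD[OF K that(1)] that(2)] .
  have app: "?h f (\<phi> x) = \<phi> (f x)" if "x \<in> X" for f x using conj_perm_apply[OF inj that] .
  have eqI: "f = g" if "f \<in> Bij (\<phi> ` X)" "g \<in> Bij (\<phi> ` X)" "\<And>x. x \<in> X \<Longrightarrow> f (\<phi> x) = g (\<phi> x)" for f g
    using that by (intro Bij_eqI[OF that(1,2)]) auto
  have hB: "?h f \<in> Bij (\<phi> ` X)" if "f \<in> K" for f using conj_perm_Bij[OF inj] that K by blast
  show ?thesis
  proof (rule perm_topgroup_isoI(1)[OF K K'])
    show "bij_betw ?h K K'"
    proof (rule bij_betw_imageI)
      show "inj_on ?h K"
      proof (rule inj_onI)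
        fix f g assume fg: "f \<in> K" "g \<in> K" "?h f = ?h g"
        have "f x = g x" if "x \<in> X" for x
          using app[OF that, of f] app[OF that, of g] fg KX that inj by (metis inj_onD)
        then show "f = g" using fg K by (intro Bij_eqI[of f X g]) auto
      qed
      show "?h ` K = K'"
      proof
        show "?h ` K \<subseteq> K'" using KK' K by blast
        show "K' \<subseteq> ?h ` K"
        proof
          fix k assume k: "k \<in> K'"
          then have kB: "k \<in> Bij (\<phi> ` X)" using K' by blast
          define f where "f = (\<lambda>x\<in>X. inv_into X \<phi> (k (\<phi> x)))"
          have f: "f x \<in> X" "\<phi> (f x) = k (\<phi> x)" if "x \<in> X" for x
            using that Bij_apply[OF kB, of "\<phi> x"] by (auto simp: f_def inv_into_into f_inv_into_f)
          have fB: "f \<in> Bij X"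
          proof (rule BijI)
            show "f \<in> extensional X" by (simp add: f_def)
            show "inj_on f X"
              using f Bij_inj[OF kB] inj by (metis imageI inj_on_def)
            show "\<exists>x\<in>X. f x = y" if "y \<in> X" for y
            proof -
              obtain w where "w \<in> \<phi> ` X" "k w = \<phi> y"
                using Bij_surj[OF kB imageI[OF \<open>y \<in> X\<close>]] by blast
              then obtain x where "x \<in> X" "k (\<phi> x) = \<phi> y" by blast
              then show ?thesis using f inj that by (metis inj_onD)
            qed
          qed (use f in blast)
          have "?h f = k" using conj_perm_Bij[OF inj fB] kB f app by (intro eqI) auto
          then show "k \<in> ?h ` K" using KK'[OF fB] k by blast
        qed
      qed
    qed
    show "?h (compose X f g) = compose (\<phi> ` X) (?h f) (?h g)" if fg: "f \<in> K" "g \<in> K" for f g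
      using fg KX by (intro eqI hB closed compose_Bij) (auto simp: app compose_eq)
    show "\<exists>F. finite F \<and> F \<subseteq> X \<and> (\<forall>f\<in>K. \<forall>g\<in>K. (\<forall>x\<in>F. f x = g x) \<longrightarrow> ?h f y = ?h g y)"
      if "y \<in> \<phi> ` X" for y
    proof -
      obtain x where "x \<in> X" "y = \<phi> x" using \<open>y \<in> \<phi> ` X\<close> by blast
      then show ?thesis by (intro exI[of _ "{x}"]) (simp add: app)
    qed
    show "\<exists>F. finite F \<and> F \<subseteq> \<phi> ` X \<and> (\<forall>f\<in>K. \<forall>g\<in>K. (\<forall>y\<in>F. ?h f y = ?h g y) \<longrightarrow> f x = g x)"
      if "x \<in> X" for x
      using that KX inj by (intro exI[of _ "{\<phi> x}"]) (auto simp: app dest: inj_onD)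
  qed (use closed in blast)
qed

text \<open>
  The lowest level makes locally finite supports finite and the topologies discrete; the highest
  level provides the common upper bounds that a tree requires.
\<close>

locale bounded_level_system = level_system \<Delta> r X q
  for \<Delta> :: "'d set" and r :: "'d rel" and X :: "'x set" and q :: "'d \<Rightarrow> 'x \<Rightarrow> 'c" +
  fixes lowest highest :: 'd
  assumes lowest: "lowest \<in> \<Delta>" "\<And>\<delta>. \<delta> \<in> \<Delta> \<Longrightarrow> (lowest, \<delta>) \<in> r" "inj_on (q lowest) X"
    and highest: "highest \<in> \<Delta>" "\<And>\<delta>. \<delta> \<in> \<Delta> \<Longrightarrow> (\<delta>, highest) \<in> r" "\<And>x y. x \<in> X \<Longrightarrow> y \<in> X \<Longrightarrow> q highest x = q highest y"

section \<open>Adjoining a lowest and a highest level, and changing the types\<close>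

lemma ex_inj_on_infinite:
  assumes "countable A"
  shows "\<exists>f :: 'a \<Rightarrow> 'b::infinite. inj_on f A"
proof -
  obtain g :: "nat \<Rightarrow> 'b" where "inj g"
    using infinite_UNIV infinite_countable_subset by blast
  then have "inj_on (g \<circ> to_nat_on A) A"
    using assms by (intro comp_inj_on inj_on_to_nat_on) (auto intro: inj_on_subset)
  then show ?thesis by blast
qed

lemma linear_orderI:
  assumes "r \<subseteq> A \<times> A"
    and "\<And>a. a \<in> A \<Longrightarrow> (a, a) \<in> r"
    and "\<And>a b c. (a, b) \<in> r \<Longrightarrow> (b, c) \<in> r \<Longrightarrow> (a, c) \<in> r"
    and "\<And>a b. (a, b) \<in> r \<Longrightarrow> (b, a) \<in> r \<Longrightarrow> a = b"
    and "\<And>a b. a \<in> A \<Longrightarrow> b \<in> A \<Longrightarrow> (a, b) \<in> r \<or> (b, a) \<in> r"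
  shows "linear_order_on A r"
  unfolding order_on_defs
proof (intro conjI)
  show "r \<subseteq> A \<times> A" by fact
  show "refl_on A r" using assms(2) by (simp add: refl_on_def)
  show "trans r" by (rule transI) (rule assms(3))
  show "antisym r" by (rule antisymI) (rule assms(4))
  show "total_on A r" using assms(5) by (simp add: total_on_def)
qed

text \<open>Besides adjoining bounds this moves levels and points to arbitrary infinite types. The
  values of \<open>q\<close> are replaced by the classes themselves, so the type of values is fixed
  by the type of points. Fresh bounds are added even if the system already has some: repeating a
  trivial relation costs nothing.\<close>

lemma (in level_system) bounded:
  "\<exists>(\<Delta>' :: 'e::infinite set) r' (Y :: 'y::infinite set) (q' :: 'e \<Rightarrow> 'y \<Rightarrow> 'y set) lowest highest.
     bounded_level_system \<Delta>' r' Y q' lowest highest \<and> level_group \<Delta> X q \<cong>\<^sub>t level_group \<Delta>' Y q'"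
proof -
  obtain \<phi> :: "'x \<Rightarrow> 'y" where \<phi>: "inj_on \<phi> X" using ex_inj_on_infinite[OF countable_points] by blast
  \<comment> \<open>\<open>None\<close> and \<open>Some None\<close> stand for the new bounds; a
    single injection of this set names them apart from each other and from all old levels.\<close>
  have "countable (insert None (insert (Some None) ((\<lambda>x. Some (Some x)) ` \<Delta>)))"
    using countable_levels by simp
  from ex_inj_on_infinite[OF this] obtain e0 :: "'d option option \<Rightarrow> 'e"
    where e0: "inj_on e0 (insert None (insert (Some None) ((\<lambda>x. Some (Some x)) ` \<Delta>)))" by blast
  define lowest where "lowest = e0 None"
  define highest where "highest = e0 (Some None)"
  define e where "e = (\<lambda>x. e0 (Some (Some x)))"
  have ne: "lowest \<noteq> highest" and e: "\<And>x. x \<in> \<Delta> \<Longrightarrow> e x \<noteq> lowest" "\<And>x. x \<in> \<Delta> \<Longrightarrow> e x \<noteq> highest" and inj_e: "inj_on e \<Delta>"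
    using e0 by (auto simp: lowest_def highest_def e_def inj_on_def)
  define \<Delta>' where "\<Delta>' = insert lowest (insert highest (e ` \<Delta>))"
  define r' where "r' = {(a, b). a \<in> \<Delta>' \<and> b \<in> \<Delta>' \<and>
    (a = lowest \<or> b = highest \<or> (\<exists>c d. (c, d) \<in> r \<and> a = e c \<and> b = e d))}"
  define q' where "q' = (\<lambda>\<delta>' y. if \<delta>' = lowest then {y} else if \<delta>' = highest then {} else
    {z \<in> \<phi> ` X. q (inv_into \<Delta> e \<delta>') (inv_into X \<phi> z) = q (inv_into \<Delta> e \<delta>') (inv_into X \<phi> y)})"
  note lo = linear_orderD[OF lin]
  have q'_bot: "q' lowest y = {y}" and q'_top: "q' highest y = {}" for y
    using ne by (auto simp: q'_def)
  have q'_e: "q' (e \<delta>) (\<phi> x) = q' (e \<delta>) (\<phi> y) \<longleftrightarrow> q \<delta> x = q \<delta> y" if "\<delta> \<in> \<Delta>" "x \<in> X" "y \<in> X" for \<delta> x y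
  proof -
    have *: "q' (e \<delta>) (\<phi> x) = \<phi> ` {z \<in> X. q \<delta> z = q \<delta> x}" if "x \<in> X" for x
      using e \<open>\<delta> \<in> \<Delta>\<close> inj_e \<phi> that by (auto simp: q'_def)
    show ?thesis
    proof
      assume "q' (e \<delta>) (\<phi> x) = q' (e \<delta>) (\<phi> y)"
      then have "{z \<in> X. q \<delta> z = q \<delta> x} = {z \<in> X. q \<delta> z = q \<delta> y}"
        using * that inj_on_image_eq_iff[OF \<phi>, of "{z \<in> X. q \<delta> z = q \<delta> x}" "{z \<in> X. q \<delta> z = q \<delta> y}"] by auto
      then show "q \<delta> x = q \<delta> y" using \<open>x \<in> X\<close> by blast
    qed (use * that in simp)
  qed
  have lin': "linear_order_on \<Delta>' r'"
  proof (rule linear_orderI)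
    show "r' \<subseteq> \<Delta>' \<times> \<Delta>'" by (auto simp: r'_def)
    show "(a, a) \<in> r'" if "a \<in> \<Delta>'" for a using that lo(2) by (auto simp: r'_def \<Delta>'_def)
    show "(a, b) \<in> r' \<or> (b, a) \<in> r'" if "a \<in> \<Delta>'" "b \<in> \<Delta>'" for a b
      using that lo(5) unfolding r'_def \<Delta>'_def by blast
    have ee: "(e c, e d) \<in> r' \<longleftrightarrow> (c, d) \<in> r" if cd: "c \<in> \<Delta>" "d \<in> \<Delta>" for c d
    proof
      assume "(e c, e d) \<in> r'"
      then obtain c' d' where "(c', d') \<in> r" "e c = e c'" "e d = e d'"
        using e[OF cd(1)] e[OF cd(2)] by (auto simp: r'_def)
      then show "(c, d) \<in> r" using inj_e that lo(1) by (metis inj_onD)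
    qed (use that in \<open>auto simp: r'_def \<Delta>'_def\<close>)
    have b: "a = lowest" if "(a, lowest) \<in> r'" for a
    proof -
      have "\<not> (\<exists>c d. (c, d) \<in> r \<and> a = e c \<and> lowest = e d)" using e(1) lo(1) by metis
      then show ?thesis using that ne by (auto simp: r'_def)
    qed
    have t: "a = highest" if "(highest, a) \<in> r'" for a
    proof -
      have "\<not> (\<exists>c d. (c, d) \<in> r \<and> highest = e c \<and> a = e d)" using e(2) lo(1) by metis
      then show ?thesis using that ne by (auto simp: r'_def)
    qed
    show "a = b" if "(a, b) \<in> r'" "(b, a) \<in> r'" for a b
    proof -
      have "a \<in> \<Delta>'" "b \<in> \<Delta>'" using that by (auto simp: r'_def)
      then show ?thesis using that ee b t lo(4) unfolding \<Delta>'_def by blast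
    qed
    show "(a, c) \<in> r'" if "(a, b) \<in> r'" "(b, c) \<in> r'" for a b c
    proof -
      have ac: "a \<in> \<Delta>'" "b \<in> \<Delta>'" "c \<in> \<Delta>'" using that by (auto simp: r'_def)
      show ?thesis
      proof (cases "a = lowest \<or> c = highest")
        case True then show ?thesis using ac by (auto simp: r'_def)
      next
        case False
        then have "a \<noteq> highest" "b \<noteq> lowest" "b \<noteq> highest" "c \<noteq> lowest" using that b t by blast+
        then obtain x y z where xyz: "x \<in> \<Delta>" "y \<in> \<Delta>" "z \<in> \<Delta>" "a = e x" "b = e y" "c = e z"
          using ac False by (auto simp: \<Delta>'_def)
        then have "(x, y) \<in> r" "(y, z) \<in> r" using \<open>(a, b) \<in> r'\<close> \<open>(b, c) \<in> r'\<close> ee by auto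
        then show ?thesis using xyz ee lo(3) by simp
      qed
    qed
  qed
  have conj: "conj_perm X \<phi> f \<in> level_perms \<Delta>' (\<phi> ` X) q' \<longleftrightarrow> f \<in> level_perms \<Delta> X q" if "f \<in> Bij X" for f
  proof (rule level_perms_conj[OF \<phi> that])
    show "\<exists>\<delta>'\<in>\<Delta>'. \<forall>x\<in>X. \<forall>y\<in>X. q \<delta> x = q \<delta> y \<longleftrightarrow> q' \<delta>' (\<phi> x) = q' \<delta>' (\<phi> y)" if "\<delta> \<in> \<Delta>" for \<delta>
      using q'_e that by (intro bexI[of _ "e \<delta>"]) (auto simp: \<Delta>'_def)
    show "(\<exists>\<delta>\<in>\<Delta>. \<forall>x\<in>X. \<forall>y\<in>X. q \<delta> x = q \<delta> y \<longleftrightarrow> q' \<delta>' (\<phi> x) = q' \<delta>' (\<phi> y)) \<or>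
      inj_on (q' \<delta>') (\<phi> ` X) \<or> (\<forall>x\<in>X. \<forall>y\<in>X. q' \<delta>' (\<phi> x) = q' \<delta>' (\<phi> y))" if "\<delta>' \<in> \<Delta>'" for \<delta>'
    proof -
      consider "\<delta>' = lowest" | "\<delta>' = highest" | \<delta> where "\<delta> \<in> \<Delta>" "\<delta>' = e \<delta>" using \<open>\<delta>' \<in> \<Delta>'\<close> by (auto simp: \<Delta>'_def)
      then show ?thesis
      proof cases
        case 1 then show ?thesis by (auto simp: q'_bot inj_on_def)
      next
        case 2 then show ?thesis by (auto simp: q'_top)
      next
        case 3 then show ?thesis using q'_e by (intro disjI1 bexI[of _ \<delta>]) auto
      qed
    qed
  qed
  have "bounded_level_system \<Delta>' r' (\<phi> ` X) q' lowest highest"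
  proof
    show "linear_order_on \<Delta>' r'" by (rule lin')
    show "countable \<Delta>'" using countable_levels by (simp add: \<Delta>'_def)
    show "countable (\<phi> ` X)" using countable_points by simp
    show "\<phi> ` X \<noteq> {}" using nonempty by simp
    show "q' \<gamma> x = q' \<gamma> y" if "(\<delta>, \<gamma>) \<in> r'" "x \<in> \<phi> ` X" "y \<in> \<phi> ` X" "q' \<delta> x = q' \<delta> y" for \<gamma> \<delta> x y
    proof -
      obtain u where u: "x = \<phi> u" "u \<in> X" using \<open>x \<in> \<phi> ` X\<close> by blast
      obtain v where v: "y = \<phi> v" "v \<in> X" using \<open>y \<in> \<phi> ` X\<close> by blast
      note uv = u v
      have "x = y" if "\<delta> = lowest" using \<open>q' \<delta> x = q' \<delta> y\<close> that by (simp add: q'_bot)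
      moreover have ?thesis if "\<gamma> = highest" using that by (simp add: q'_top)
      moreover have ?thesis if "(c, d) \<in> r" "\<delta> = e c" "\<gamma> = e d" for c d
        using \<open>q' \<delta> x = q' \<delta> y\<close> that uv q'_e lo(1) coarser[OF that(1)] by blast
      ultimately show ?thesis using \<open>(\<delta>, \<gamma>) \<in> r'\<close> by (auto simp: r'_def)
    qed
    show "has_maximum {\<delta> \<in> \<Delta>'. q' \<delta> x \<noteq> q' \<delta> y} r'" if xy: "x \<in> \<phi> ` X" "y \<in> \<phi> ` X" "x \<noteq> y" for x y
    proof -
      obtain u v where uv: "x = \<phi> u" "u \<in> X" "y = \<phi> v" "v \<in> X" using xy(1,2) by blast
      then obtain D where D: "D \<in> \<Delta>" "q D u \<noteq> q D v" "\<And>\<delta>. \<delta> \<in> \<Delta> \<Longrightarrow> q \<delta> u \<noteq> q \<delta> v \<Longrightarrow> (\<delta>, D) \<in> r"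
        using max_split[of u v] xy(3) by (auto simp: has_maximum_def)
      \<comment> \<open>The top separating level survives: the new lowest level lies below
        \<open>e D\<close>, and the new highest level separates nothing.\<close>
      have "(\<delta>, e D) \<in> r'" if "\<delta> \<in> \<Delta>'" "q' \<delta> x \<noteq> q' \<delta> y" for \<delta>
      proof -
        have "e D \<in> \<Delta>'" using D(1) by (simp add: \<Delta>'_def)
        consider "\<delta> = lowest" | "\<delta> = highest" | d where "d \<in> \<Delta>" "\<delta> = e d"
          using \<open>\<delta> \<in> \<Delta>'\<close> by (auto simp: \<Delta>'_def)
        then show ?thesis
        proof cases
          case 1 then show ?thesis using that(1) \<open>e D \<in> \<Delta>'\<close> by (simp add: r'_def)
        next
          case 2 then show ?thesis using that(2) by (simp add: q'_top)
        next
          case 3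
          then have "(d, D) \<in> r" using D(3) that(2) uv q'_e by metis
          then show ?thesis using that(1) 3 \<open>e D \<in> \<Delta>'\<close> by (auto simp: r'_def)
        qed
      qed
      moreover have "e D \<in> \<Delta>'" "q' (e D) x \<noteq> q' (e D) y"
        using D uv q'_e \<Delta>'_def by simp_all
      ultimately show ?thesis unfolding has_maximum_def by blast
    qed
    show "\<exists>g\<in>level_perms \<Delta>' (\<phi> ` X) q'. g x = y" if xy: "x \<in> \<phi> ` X" "y \<in> \<phi> ` X" for x y
    proof -
      obtain u v where uv: "x = \<phi> u" "u \<in> X" "y = \<phi> v" "v \<in> X" using xy by blast
      then obtain g where g: "g \<in> level_perms \<Delta> X q" "g u = v" using transitive by blast
      then have "conj_perm X \<phi> g \<in> level_perms \<Delta>' (\<phi> ` X) q'"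
        using conj level_perms_Bij by blast
      then show ?thesis using uv g(2) conj_perm_apply[OF \<phi>] by (intro bexI[of _ "conj_perm X \<phi> g"]) auto
    qed
    show "lowest \<in> \<Delta>'" "highest \<in> \<Delta>'" by (auto simp: \<Delta>'_def)
    then show "(lowest, \<delta>) \<in> r'" "(\<delta>, highest) \<in> r'" if "\<delta> \<in> \<Delta>'" for \<delta> using that by (auto simp: r'_def)
    show "inj_on (q' lowest) (\<phi> ` X)" by (auto simp: q'_bot inj_on_def)
    show "q' highest x = q' highest y" for x y by (simp add: q'_top)
  qed
  moreover have "level_group \<Delta> X q \<cong>\<^sub>t level_group \<Delta>' (\<phi> ` X) q'"
    by (rule perm_topgroup_conj[OF \<phi> level_perms_Bij level_perms_Bij compose_level_perms conj])
  ultimately show ?thesis by blast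
qed

section \<open>Coordinatization by functions of finite support\<close>

definition ecard :: "'a set \<Rightarrow> enat" where
  "ecard A = (if finite A then enat (card A) else \<infinity>)"

text \<open>Whatever enumeration \<open>to_nat_on\<close> provides, the transposition moves
  \<open>a\<close> to 0, the one value that supports ignore.\<close>

definition enum_from :: "'a set \<Rightarrow> 'a \<Rightarrow> 'a \<Rightarrow> nat" where
  "enum_from A a = Transposition.transpose 0 (to_nat_on A a) \<circ> to_nat_on A"

lemma enum_from_self: "enum_from A a a = 0"
  by (simp add: enum_from_def)

lemma bij_betw_enum_from:
  assumes "countable A" "a \<in> A"
  shows "bij_betw (enum_from A a) A (below (ecard A))"
proof -
  have *: "bij_betw (to_nat_on A) A (below (ecard A))"
  proof (cases "finite A")
    case True
    then have "below (ecard A) = {..<card A}" by (auto simp: below_def ecard_def)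
    then show ?thesis using to_nat_on_finite[OF True] by simp
  next
    case False
    then have "below (ecard A) = UNIV" by (auto simp: below_def ecard_def)
    then show ?thesis using to_nat_on_infinite[OF assms(1) False] by simp
  qed
  have ta: "to_nat_on A a \<in> below (ecard A)" using * assms(2) by (auto simp: bij_betw_def)
  moreover have "0 \<in> below (ecard A)"
  proof (cases "finite A")
    case True
    then have "card A > 0" using assms(2) card_gt_0_iff by blast
    then show ?thesis using True by (simp add: below_def ecard_def)
  next
    case False then show ?thesis by (simp add: below_def ecard_def)
  qed
  ultimately have "bij_betw (Transposition.transpose 0 (to_nat_on A a)) (below (ecard A)) (below (ecard A))"
    by (intro bij_betw_transpose_iff) simp
  then show ?thesis unfolding enum_from_def using * by (rule bij_betw_trans[rotated])
qed

lemma ecard_image_eq: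
  assumes "\<And>x y. x \<in> A \<Longrightarrow> y \<in> A \<Longrightarrow> f x = f y \<longleftrightarrow> h x = h y"
  shows "ecard (f ` A) = ecard (h ` A)"
proof -
  have hinv: "h (inv_into A f (f x)) = h x" if "x \<in> A" for x
    using assms[of "inv_into A f (f x)" x] that by (simp add: inv_into_into f_inv_into_f)
  have "bij_betw (\<lambda>z. h (inv_into A f z)) (f ` A) (h ` A)"
  proof (rule bij_betw_imageI)
    show "inj_on (\<lambda>z. h (inv_into A f z)) (f ` A)"
      using hinv assms by (auto simp: inj_on_def)
    show "(\<lambda>z. h (inv_into A f z)) ` f ` A = h ` A"
      using hinv by (simp add: image_image)
  qed
  then show ?thesis unfolding ecard_def
    using bij_betw_finite bij_betw_same_card by metis
qed

lemma ecard_nonzero: "A \<noteq> {} \<Longrightarrow> ecard A \<noteq> 0"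
  by (auto simp: ecard_def zero_enat_def)

section \<open>Restrictions, supports and topologies over an order with a minimum\<close>

lemma upset_iff: "x \<in> upset A r a \<longleftrightarrow> x \<in> A \<and> (a, x) \<in> r"
  by (simp add: upset_def)

lemma restrict_eq_iff: "x |` A = y |` A \<longleftrightarrow> (\<forall>a\<in>A. x a = y a)"
  by (auto simp: fun_eq_iff restrict_map_def)

lemma wreath_eq_level_perms: "wreath \<Delta> r S = level_perms \<Delta> S (\<lambda>\<delta> x. x |` upset \<Delta> r \<delta>)"
  by (auto simp: wreath_def level_perms_def)

lemma LF_eq_Fin:
  assumes "lowest \<in> \<Delta>" "\<And>\<delta>. \<delta> \<in> \<Delta> \<Longrightarrow> (lowest, \<delta>) \<in> r"
  shows "LF \<Delta> r = Fin \<Delta> r"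
proof -
  have "upset \<Delta> r lowest = \<Delta>" using assms(2) by (auto simp: upset_def)
  then have "finite A" if "A \<subseteq> \<Delta>" "\<forall>\<delta>\<in>\<Delta>. finite (A \<inter> upset \<Delta> r \<delta>)" for A
    using that assms(1) by (metis inf.absorb1)
  then show ?thesis by (auto simp: LF_def Fin_def)
qed

text \<open>Restriction to the elements above \<open>lowest\<close> forgets nothing, so the
  generating set for \<open>x\<close> at \<open>lowest\<close> is the singleton of
  \<open>x\<close>.\<close>

lemma subtopology_tau_eq_discrete:
  assumes lowest: "lowest \<in> \<Delta>" "\<And>\<delta>. \<delta> \<in> \<Delta> \<Longrightarrow> (lowest, \<delta>) \<in> r" and S: "S \<subseteq> skel_prod N \<Delta>"
  shows "subtopology (tau \<Delta> r N) S = discrete_topology S"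
proof -
  have up: "upset \<Delta> r lowest = \<Delta>" using lowest(2) by (auto simp: upset_def)
  have open_single: "openin (tau \<Delta> r N) {x}" if "x \<in> skel_prod N \<Delta>" for x
  proof -
    have "y = x" if "y \<in> skel_prod N \<Delta>" "y |` \<Delta> = x |` \<Delta>" for y
    proof
      fix a
      have "dom y = \<Delta>" "dom x = \<Delta>" using that(1) \<open>x \<in> skel_prod N \<Delta>\<close> by (simp_all add: skel_prod_def)
      then show "y a = x a" using that(2) by (cases "a \<in> \<Delta>") (auto simp: restrict_eq_iff)
    qed
    then have "{x} = {y \<in> skel_prod N \<Delta>. y |` upset \<Delta> r lowest = x |` upset \<Delta> r lowest}"
      using that by (auto simp: up)
    then show ?thesis unfolding tau_def
      using that lowest(1) by (intro topology_generated_by_Basis) blast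
  qed
  have "openin (tau \<Delta> r N) A" if "A \<subseteq> S" for A
  proof -
    have "openin (tau \<Delta> r N) (\<Union>x\<in>A. {x})" using that S open_single by (intro openin_Union) auto
    then show ?thesis by simp
  qed
  moreover from this have "S \<subseteq> topspace (tau \<Delta> r N)" using openin_subset by blast
  ultimately show ?thesis
    by (intro discrete_topology_unique[THEN iffD2, symmetric]) (auto simp: openin_subtopology_alt)
qed

section \<open>Leaders, branching numbers and coordinates\<close>

context bounded_level_system
begin

abbreviation idx :: "'x \<Rightarrow> nat" where "idx \<equiv> to_nat_on X"

text \<open>The class that splits at level \<delta>. It is defined by agreement on all strictly
  higher levels together, because \<delta> may have no immediate successor whose relation alone
  would cut it out. At the highest level it is all of \<open>X\<close>.\<close>

definition above :: "'d \<Rightarrow> 'x \<Rightarrow> 'x set" where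
  "above \<delta> x = {y \<in> X. \<forall>\<gamma>. (\<delta>, \<gamma>) \<in> r \<and> \<gamma> \<noteq> \<delta> \<longrightarrow> q \<gamma> y = q \<gamma> x}"

definition lead :: "'x set \<Rightarrow> 'x" where
  "lead A = arg_min idx (\<lambda>y. y \<in> A)"

definition branching :: "'d \<Rightarrow> enat" where
  "branching \<delta> = ecard (q \<delta> ` above \<delta> (SOME x. x \<in> X))"

definition coord :: "'d \<Rightarrow> 'x \<Rightarrow> nat" where
  "coord \<delta> x = enum_from (q \<delta> ` above \<delta> x) (q \<delta> (lead (above \<delta> x))) (q \<delta> x)"

definition coords :: "'x \<Rightarrow> 'd \<rightharpoonup> nat" where
  "coords x = (\<lambda>\<delta>. if \<delta> \<in> \<Delta> then Some (coord \<delta> x) else None)"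

lemmas lo = linear_orderD[OF lin]

lemma lead_in: "A \<noteq> {} \<Longrightarrow> lead A \<in> A"
  unfolding lead_def using arg_min_natI[of "\<lambda>y. y \<in> A"] by blast

lemma lead_le: "y \<in> A \<Longrightarrow> idx (lead A) \<le> idx y"
  unfolding lead_def using arg_min_nat_lemma[of "\<lambda>y. y \<in> A" y idx] by blast

lemma idx_inj: "x \<in> X \<Longrightarrow> y \<in> X \<Longrightarrow> idx x = idx y \<longleftrightarrow> x = y"
  using countable_points by simp

lemma lead_eqI: "A \<subseteq> X \<Longrightarrow> x \<in> A \<Longrightarrow> (\<And>y. y \<in> A \<Longrightarrow> idx x \<le> idx y) \<Longrightarrow> lead A = x"
  using lead_in[of A] lead_le[of x A] idx_inj[of "lead A" x] by (metis empty_iff le_antisym subsetD)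

lemma above_subset: "above \<delta> x \<subseteq> X"
  by (auto simp: above_def)

lemma above_self: "x \<in> X \<Longrightarrow> x \<in> above \<delta> x"
  by (simp add: above_def)

lemma above_eq: "y \<in> above \<delta> x \<Longrightarrow> above \<delta> y = above \<delta> x"
  by (auto simp: above_def)

lemma aboveI: "x \<in> X \<Longrightarrow> y \<in> X \<Longrightarrow> q \<delta> y = q \<delta> x \<Longrightarrow> y \<in> above \<delta> x"
  using coarser by (auto simp: above_def)

lemma aboveD: "y \<in> above \<delta> x \<Longrightarrow> (\<delta>, \<gamma>) \<in> r \<Longrightarrow> \<gamma> \<noteq> \<delta> \<Longrightarrow> q \<gamma> y = q \<gamma> x"
  by (simp add: above_def)

text \<open>An element of the group that takes the base point of \<open>branching\<close> to
  \<open>x\<close> carries the one class onto the other and respects the relation of level \<delta>,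
  by which both are split.\<close>

lemma ecard_above:
  assumes \<delta>: "\<delta> \<in> \<Delta>" and x: "x \<in> X"
  shows "ecard (q \<delta> ` above \<delta> x) = branching \<delta>"
proof -
  define x0 where "x0 = (SOME x. x \<in> X)"
  have x0: "x0 \<in> X" unfolding x0_def using nonempty some_in_eq by blast
  obtain g where g: "g \<in> level_perms \<Delta> X q" and gx: "g x0 = x" using transitive[OF x0 x] by blast
  have gB: "g \<in> Bij X" using g level_perms_Bij by blast
  have "above \<delta> x = g ` above \<delta> x0"
  proof
    show "g ` above \<delta> x0 \<subseteq> above \<delta> x"
      using Bij_apply[OF gB] level_perms_iff[OF g] x0 gx lo(1) unfolding above_def by auto
    show "above \<delta> x \<subseteq> g ` above \<delta> x0"
    proof
      fix y assume y: "y \<in> above \<delta> x"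
      then obtain z where z: "z \<in> X" "g z = y" using Bij_surj[OF gB] above_subset by blast
      have "q \<gamma> z = q \<gamma> x0" if "(\<delta>, \<gamma>) \<in> r" "\<gamma> \<noteq> \<delta>" for \<gamma>
        using level_perms_iff[OF g _ z(1) x0, of \<gamma>] aboveD[OF y that] lo(1)[OF that(1)] z gx by simp
      then have "z \<in> above \<delta> x0" using z(1) by (simp add: above_def)
      then show "y \<in> g ` above \<delta> x0" using z(2) by blast
    qed
  qed
  then have "q \<delta> ` above \<delta> x = (\<lambda>y. q \<delta> (g y)) ` above \<delta> x0" by (simp add: image_image)
  also have "ecard \<dots> = ecard (q \<delta> ` above \<delta> x0)"
    using level_perms_iff[OF g \<delta>] above_subset by (intro ecard_image_eq) blast
  finally show ?thesis by (simp add: branching_def x0_def)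
qed

lemma bij_enum_above:
  assumes "\<delta> \<in> \<Delta>" "x \<in> X"
  shows "bij_betw (enum_from (q \<delta> ` above \<delta> x) (q \<delta> (lead (above \<delta> x))))
           (q \<delta> ` above \<delta> x) (below (branching \<delta>))"
proof -
  have "countable (above \<delta> x)" using countable_points above_subset countable_subset by blast
  moreover have "lead (above \<delta> x) \<in> above \<delta> x" using above_self[OF assms(2)] lead_in by blast
  ultimately show ?thesis
    using bij_betw_enum_from[of "q \<delta> ` above \<delta> x" "q \<delta> (lead (above \<delta> x))"] ecard_above[OF assms] by simp
qed

lemma coord_below: "\<delta> \<in> \<Delta> \<Longrightarrow> x \<in> X \<Longrightarrow> coord \<delta> x \<in> below (branching \<delta>)"
  unfolding coord_def using bij_betwE[OF bij_enum_above] above_self by blast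

lemma coord_eq_iff:
  assumes "\<delta> \<in> \<Delta>" "x \<in> X" "y \<in> above \<delta> x"
  shows "coord \<delta> y = coord \<delta> x \<longleftrightarrow> q \<delta> y = q \<delta> x"
  unfolding coord_def above_eq[OF assms(3)]
  using bij_betw_imp_inj_on[OF bij_enum_above[OF assms(1,2)]] assms above_self
  by (auto simp: inj_on_eq_iff)

lemma coord_eq_0_iff:
  assumes "\<delta> \<in> \<Delta>" "x \<in> X"
  shows "coord \<delta> x = 0 \<longleftrightarrow> q \<delta> x = q \<delta> (lead (above \<delta> x))"
proof -
  have x: "x \<in> above \<delta> x" using above_self[OF assms(2)] .
  then have l: "lead (above \<delta> x) \<in> above \<delta> x" using lead_in by blast
  then have "lead (above \<delta> x) \<in> X" using above_subset by blast
  then have "coord \<delta> (lead (above \<delta> x)) = 0"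
    by (simp add: coord_def above_eq[OF l] enum_from_self)
  then show ?thesis using coord_eq_iff[OF assms l] by auto
qed

text \<open>A coordinate is a number relative to a class, so coordinates of two points can be
  compared only if both lie in the same class. That is the case at the top level \<open>D\<close>
  separating them: above \<open>D\<close> they agree, and at \<open>D\<close> their numbers
  differ.\<close>

lemma coords_restrict_iff:
  assumes "\<delta> \<in> \<Delta>" "x \<in> X" "y \<in> X"
  shows "coords x |` upset \<Delta> r \<delta> = coords y |` upset \<Delta> r \<delta> \<longleftrightarrow> q \<delta> x = q \<delta> y"
proof
  assume q: "q \<delta> x = q \<delta> y"
  have "coord \<gamma> x = coord \<gamma> y" if \<gamma>: "\<gamma> \<in> \<Delta>" "(\<delta>, \<gamma>) \<in> r" for \<gamma>
  proof -
    have *: "q \<gamma> x = q \<gamma> y" using coarser[OF \<gamma>(2) assms(2,3) q] .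
    show ?thesis using coord_eq_iff[OF \<gamma>(1) assms(3) aboveI[OF assms(3,2) *]] * by simp
  qed
  then show "coords x |` upset \<Delta> r \<delta> = coords y |` upset \<Delta> r \<delta>"
    by (auto simp: restrict_eq_iff upset_iff coords_def)
next
  assume c: "coords x |` upset \<Delta> r \<delta> = coords y |` upset \<Delta> r \<delta>"
  show "q \<delta> x = q \<delta> y"
  proof (rule ccontr)
    assume neq: "q \<delta> x \<noteq> q \<delta> y"
    then obtain D where D: "D \<in> \<Delta>" "q D x \<noteq> q D y" "\<And>\<gamma>. \<gamma> \<in> \<Delta> \<Longrightarrow> q \<gamma> x \<noteq> q \<gamma> y \<Longrightarrow> (\<gamma>, D) \<in> r"
      using max_split[of x y] assms by (auto simp: has_maximum_def)
    have "x \<in> above D y"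
      unfolding above_def using assms D lo(1,4) by blast
    then have "coord D x \<noteq> coord D y" using coord_eq_iff[OF D(1) assms(3)] D(2) by blast
    moreover have "(\<delta>, D) \<in> r" using D(3) assms(1) neq by blast
    ultimately show False using c D(1) by (auto simp: restrict_eq_iff upset_iff coords_def)
  qed
qed

lemma inj_coords: "inj_on coords X"
  using coords_restrict_iff[OF lowest(1)] lowest(3) by (metis inj_onD inj_onI)

lemma coords_skel: "x \<in> X \<Longrightarrow> coords x \<in> skel_prod branching \<Delta>"
  using coord_below by (auto simp: skel_prod_def coords_def split: if_splits)

text \<open>
  Along the support of \<open>x\<close>, the index of the leader of the class of \<open>x\<close> strictly decreases as the
  levels increase.
\<close>

lemma finite_supp_coords:
  assumes x: "x \<in> X"
  shows "finite (supp (coords x))"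
proof -
  let ?S = "supp (coords x)" and ?f = "\<lambda>\<delta>. idx (lead (above \<delta> x))"
  have S: "?S = {\<delta> \<in> \<Delta>. q \<delta> x \<noteq> q \<delta> (lead (above \<delta> x))}"
  proof -
    have "?S = {\<delta> \<in> \<Delta>. coord \<delta> x \<noteq> 0}" by (auto simp: supp_def coords_def split: if_splits)
    also have "\<dots> = {\<delta> \<in> \<Delta>. q \<delta> x \<noteq> q \<delta> (lead (above \<delta> x))}"
      by (rule Collect_cong) (meson coord_eq_0_iff x)
    finally show ?thesis .
  qed
  have dec: "?f \<gamma> < ?f \<delta>" if "\<delta> \<in> ?S" "\<gamma> \<in> ?S" "(\<delta>, \<gamma>) \<in> r" "\<delta> \<noteq> \<gamma>" for \<delta> \<gamma>
  proof -
    have l: "lead (above \<delta> x) \<in> above \<delta> x" using above_self[OF x] lead_in by blast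
    then have q: "q \<gamma> (lead (above \<delta> x)) = q \<gamma> x" using aboveD that by blast
    have lX: "lead (above \<delta> x) \<in> X" using l above_subset by blast
    \<comment> \<open>The leader at \<delta> agrees with \<open>x\<close> on the higher level
      \<gamma>, so it competes for the lead there. It is not the leader at \<gamma>, since the
      coordinate of \<open>x\<close> at \<gamma> is nonzero; hence the index drops strictly.\<close>
    have "lead (above \<delta> x) \<in> above \<gamma> x" using aboveI[OF x lX q] .
    then have "?f \<gamma> \<le> ?f \<delta>" using lead_le by blast
    moreover have "lead (above \<gamma> x) \<noteq> lead (above \<delta> x)" using q that(2) S by force
    moreover have "lead (above \<gamma> x) \<in> X" using above_self[OF x] lead_in above_subset by blast
    ultimately show ?thesis using idx_inj[OF _ lX] by fastforce
  qed
  have "inj_on ?f ?S"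
  proof (rule inj_onI, rule ccontr)
    fix \<delta> \<gamma> assume *: "\<delta> \<in> ?S" "\<gamma> \<in> ?S" "?f \<delta> = ?f \<gamma>" "\<delta> \<noteq> \<gamma>"
    have "\<delta> \<in> \<Delta>" "\<gamma> \<in> \<Delta>" using *(1,2) unfolding S by simp_all
    then have "(\<delta>, \<gamma>) \<in> r \<or> (\<gamma>, \<delta>) \<in> r" by (rule lo(5))
    then show False
    proof
      assume "(\<delta>, \<gamma>) \<in> r"
      from dec[OF *(1,2) this *(4)] show False using *(3) by simp
    next
      assume "(\<gamma>, \<delta>) \<in> r"
      from dec[OF *(2,1) this] show False using *(3,4) by simp
    qed
  qed
  moreover have "?f ` ?S \<subseteq> {..idx x}" using lead_le above_self[OF x] by auto
  ultimately show ?thesis using finite_imageD finite_subset by blast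
qed

text \<open>Induction on the size of the support, erasing its lowest element \<delta>. Coordinates
  above \<delta> are inherited from the point found for the erased function; the coordinate at
  \<delta> is then corrected by moving inside the class that splits there.\<close>

lemma ex_coords:
  assumes "w \<in> skel_prod branching \<Delta>" "finite (supp w)"
  shows "\<exists>x\<in>X. coords x = w"
  using assms
proof (induction "card (supp w)" arbitrary: w)
  case 0
  then have zero: "w \<delta> = Some 0" if "\<delta> \<in> \<Delta>" for \<delta>
    using that by (auto simp: supp_def skel_prod_def)
  \<comment> \<open>The point of least index leads every class to which it belongs, so all its
    coordinates are 0.\<close>
  define x where "x = lead X"
  have x: "x \<in> X" unfolding x_def using nonempty lead_in by blast
  have "coord \<delta> x = 0" if "\<delta> \<in> \<Delta>" for \<delta>
  proof -
    have "lead (above \<delta> x) = x"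
    proof (rule lead_eqI[OF above_subset above_self[OF x]])
      show "idx x \<le> idx y" if "y \<in> above \<delta> x" for y
        unfolding x_def using that above_subset by (intro lead_le) blast
    qed
    then show ?thesis using coord_eq_0_iff[OF that x] by simp
  qed
  then have "coords x = w" using zero 0(2) by (auto simp: coords_def fun_eq_iff skel_prod_def)
  then show ?case using x by blast
next
  case (Suc n)
  then have "supp w \<noteq> {}" and fin: "finite (supp w)" by auto
  have sub: "supp w \<subseteq> \<Delta>" using Suc.prems(1) by (auto simp: supp_def skel_prod_def)
  have "\<exists>\<delta>\<in>supp w. \<forall>\<gamma>\<in>supp w. (\<delta>, \<gamma>) \<in> r"
    using fin \<open>supp w \<noteq> {}\<close> sub
  proof (induction rule: finite_ne_induct)
    case (insert a F)
    then obtain \<delta> where \<delta>: "\<delta> \<in> F" "\<And>\<gamma>. \<gamma> \<in> F \<Longrightarrow> (\<delta>, \<gamma>) \<in> r" by auto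
    have a: "a \<in> \<Delta>" "\<delta> \<in> \<Delta>" using insert.prems \<delta>(1) by auto
    show ?case
    proof (cases "(\<delta>, a) \<in> r")
      case True
      then show ?thesis using \<delta> by (intro bexI[of _ \<delta>]) auto
    next
      case False
      then have "(a, \<delta>) \<in> r" using lo(5)[OF a] by simp
      then have "(a, \<gamma>) \<in> r" if "\<gamma> \<in> F" for \<gamma> using lo(3) \<delta>(2)[OF that] by blast
      then show ?thesis using lo(2)[OF a(1)] by (intro bexI[of _ a]) auto
    qed
  qed (use lo(2) in auto)
  then obtain \<delta> where \<delta>: "\<delta> \<in> supp w" and min: "\<And>\<gamma>. \<gamma> \<in> supp w \<Longrightarrow> (\<delta>, \<gamma>) \<in> r" by blast
  have \<delta>\<Delta>: "\<delta> \<in> \<Delta>" using \<delta> sub by blast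
  define w' where "w' = w(\<delta> \<mapsto> 0)"
  have supp': "supp w' = supp w - {\<delta>}" using \<delta> by (auto simp: w'_def supp_def split: if_splits)
  have "0 \<in> below (branching \<delta>)"
  proof -
    obtain x where "x \<in> X" using nonempty by blast
    then have "enat (coord \<delta> x) < branching \<delta>" using coord_below[OF \<delta>\<Delta>] by (simp add: below_def)
    moreover have "enat 0 \<le> enat (coord \<delta> x)" by simp
    ultimately have "enat 0 < branching \<delta>" by (rule order.strict_trans1[rotated])
    then show ?thesis by (simp only: below_def mem_Collect_eq)
  qed
  then have w': "w' \<in> skel_prod branching \<Delta>" using Suc.prems(1) \<delta>\<Delta> by (auto simp: w'_def skel_prod_def)
  have "n = card (supp w')" using Suc.hyps(2) \<delta> fin by (simp add: supp')
  moreover have "finite (supp w')" using fin by (simp add: supp')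
  ultimately obtain x' where x': "x' \<in> X" "coords x' = w'"
    using Suc.hyps(1) w' by blast
  have "the (w \<delta>) \<in> below (branching \<delta>)" using Suc.prems(1) \<delta>\<Delta> by (simp add: skel_prod_def)
  then have "the (w \<delta>) \<in> enum_from (q \<delta> ` above \<delta> x') (q \<delta> (lead (above \<delta> x'))) ` q \<delta> ` above \<delta> x'"
    using bij_betw_imp_surj_on[OF bij_enum_above[OF \<delta>\<Delta> x'(1)]] by simp
  then obtain y where y: "y \<in> above \<delta> x'"
    and ye: "enum_from (q \<delta> ` above \<delta> x') (q \<delta> (lead (above \<delta> x'))) (q \<delta> y) = the (w \<delta>)"
    by auto
  have yX: "y \<in> X" using y above_subset by blast
  \<comment> \<open>\<open>y\<close> has the right coordinates from \<delta> upwards, but arbitrary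
    ones below. The leader of its class at \<delta> keeps the former, and it leads all the smaller
    classes around it, so its coordinates below \<delta> vanish as those of \<open>w\<close>
    do.\<close>
  define x where "x = lead {z \<in> X. q \<delta> z = q \<delta> y}"
  have x: "x \<in> X" "q \<delta> x = q \<delta> y" using lead_in[of "{z \<in> X. q \<delta> z = q \<delta> y}"] yX by (auto simp: x_def)
  have x_least: "idx x \<le> idx z" if "z \<in> X" "q \<delta> z = q \<delta> y" for z
    unfolding x_def using that by (intro lead_le) simp
  have xa: "x \<in> above \<delta> x'" using aboveI[OF yX x] above_eq[OF y] by simp
  have "coords x \<gamma> = w \<gamma>" for \<gamma>
  proof (cases "\<gamma> \<in> \<Delta>")
    case False
    then show ?thesis using Suc.prems(1) by (auto simp: coords_def skel_prod_def)
  next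
    case True
    have w\<gamma>: "w \<gamma> = Some (the (w \<gamma>))" using True Suc.prems(1) by (auto simp: skel_prod_def)
    consider "\<gamma> = \<delta>" | "(\<delta>, \<gamma>) \<in> r" "\<gamma> \<noteq> \<delta>" | "(\<gamma>, \<delta>) \<in> r" "\<gamma> \<noteq> \<delta>"
      using lo(5)[OF True \<delta>\<Delta>] by blast
    then show ?thesis
    proof cases
      case 1
      then show ?thesis using ye x(2) w\<gamma> True by (simp add: coords_def coord_def above_eq[OF xa])
    next
      case 2
      have "q \<gamma> x = q \<gamma> x'" using aboveD[OF xa] 2 by blast
      then have "coords x \<gamma> = coords x' \<gamma>"
        using coords_restrict_iff[OF True x(1) x'(1)] lo(2)[OF True] True
        by (simp add: restrict_eq_iff upset_iff)
      then show ?thesis using 2(2) by (simp add: x'(2) w'_def)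
    next
      case 3
      have "\<gamma> \<notin> supp w" using min 3 lo(4) by blast
      then have "w \<gamma> = Some 0" using w\<gamma> by (auto simp: supp_def)
      moreover have "lead (above \<gamma> x) = x"
      proof (rule lead_eqI[OF above_subset above_self[OF x(1)]])
        fix z assume z: "z \<in> above \<gamma> x"
        then show "idx x \<le> idx z"
          using x_least[of z] aboveD[OF z 3(1)] 3(2) x(2) above_subset by fastforce
      qed
      then have "coord \<gamma> x = 0" using coord_eq_0_iff[OF True x(1)] by simp
      ultimately show ?thesis using True by (simp add: coords_def)
    qed
  qed
  then show ?case using x(1) by blast
qed

lemma image_coords: "coords ` X = supp_domain \<Delta> branching (Fin \<Delta> r)"
proof
  show "coords ` X \<subseteq> supp_domain \<Delta> branching (Fin \<Delta> r)"
    using coords_skel finite_supp_coords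
    by (auto simp: supp_domain_def Fin_def) (auto simp: supp_def coords_def split: if_splits)
  show "supp_domain \<Delta> branching (Fin \<Delta> r) \<subseteq> coords ` X"
    using ex_coords by (fastforce simp: supp_domain_def Fin_def)
qed

lemma countable_skeleton_branching: "countable_linear_skeleton \<Delta> r branching"
proof -
  obtain x where x: "x \<in> X" using nonempty by blast
  have "branching \<delta> \<noteq> 0" if "\<delta> \<in> \<Delta>" for \<delta>
    using ecard_above[OF that x] above_self[OF x] ecard_nonzero[of "q \<delta> ` above \<delta> x"] by auto
  then show ?thesis using lin countable_levels lowest(1)
    by (auto simp: countable_linear_skeleton_def countable_skeleton_def linear_order_on_def)
qed

text \<open>Under \<open>coords\<close> the relation of each level becomes equality of restrictions,
  and the lowest level makes the supports finite and the topology discrete. What remains is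
  conjugation with \<open>coords\<close>.\<close>

lemma level_group_iso_Wr_LF: "level_group \<Delta> X q \<cong>\<^sub>t Wr_LF \<Delta> r branching"
proof -
  let ?S = "supp_domain \<Delta> branching (Fin \<Delta> r)"
  have Wr: "Wr_LF \<Delta> r branching = perm_topgroup (discrete_topology (coords ` X))
      (level_perms \<Delta> (coords ` X) (\<lambda>\<delta> x. x |` upset \<Delta> r \<delta>))"
    using subtopology_tau_eq_discrete[OF lowest(1,2), of ?S branching]
    by (simp add: Wr_LF_def Wr_def LF_eq_Fin[OF lowest(1,2)] wreath_eq_level_perms image_coords supp_domain_def)
  show ?thesis unfolding Wr
  proof (rule perm_topgroup_conj[OF inj_coords level_perms_Bij level_perms_Bij compose_level_perms])
    fix f assume "f \<in> Bij X"
    then show "conj_perm X coords f \<in> level_perms \<Delta> (coords ` X) (\<lambda>\<delta> x. x |` upset \<Delta> r \<delta>) \<longleftrightarrow>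
      f \<in> level_perms \<Delta> X q"
    proof (rule level_perms_conj[OF inj_coords])
      show "\<exists>\<delta>'\<in>\<Delta>. \<forall>x\<in>X. \<forall>y\<in>X. q \<delta> x = q \<delta> y \<longleftrightarrow>
          coords x |` upset \<Delta> r \<delta>' = coords y |` upset \<Delta> r \<delta>'" if "\<delta> \<in> \<Delta>" for \<delta>
        using coords_restrict_iff that by (intro bexI[of _ \<delta>]) auto
      show "(\<exists>\<delta>'\<in>\<Delta>. \<forall>x\<in>X. \<forall>y\<in>X. q \<delta>' x = q \<delta>' y \<longleftrightarrow>
          coords x |` upset \<Delta> r \<delta> = coords y |` upset \<Delta> r \<delta>) \<or>
          inj_on (\<lambda>x. x |` upset \<Delta> r \<delta>) (coords ` X) \<or>
          (\<forall>x\<in>X. \<forall>y\<in>X. coords x |` upset \<Delta> r \<delta> = coords y |` upset \<Delta> r \<delta>)" if "\<delta> \<in> \<Delta>" for \<delta>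
        using coords_restrict_iff that by (intro disjI1 bexI[of _ \<delta>]) auto
    qed
  qed
qed

end

section \<open>Wreath products over domains\<close>

text \<open>With all types fixed to \<open>nat\<close> the predicate mentions no type variable but
  that of the group, so it can mediate between conditions over unrelated types.\<close>

definition level_realizable :: "'g topgroup \<Rightarrow> bool" where
  "level_realizable \<G> \<longleftrightarrow>
     (\<exists>(\<Delta> :: nat set) r (X :: nat set) (q :: nat \<Rightarrow> nat \<Rightarrow> nat set) lowest highest.
       bounded_level_system \<Delta> r X q lowest highest \<and> \<G> \<cong>\<^sub>t level_group \<Delta> X q)"

lemma level_realizableI:
  assumes "level_system \<Delta> r X q" "\<G> \<cong>\<^sub>t level_group \<Delta> X q"
  shows "level_realizable \<G>"
proof -
  interpret level_system \<Delta> r X q by fact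
  obtain \<Delta>' :: "nat set" and r' and Y :: "nat set" and q' :: "nat \<Rightarrow> nat \<Rightarrow> nat set" and l h
    where "bounded_level_system \<Delta>' r' Y q' l h" and i: "level_group \<Delta> X q \<cong>\<^sub>t level_group \<Delta>' Y q'"
    using bounded by blast
  then show ?thesis
    unfolding level_realizable_def using topgroup_iso_trans[OF assms(2) i] by blast
qed

text \<open>\<open>bounded\<close> is applied a second time for the sake of the types; the further
  pair of bounds that it adds leaves the group alone up to isomorphism.\<close>

lemma level_realizableE:
  assumes "level_realizable \<G>"
  obtains \<Delta> :: "'e::infinite set" and r and X :: "'y::infinite set" and q :: "'e \<Rightarrow> 'y \<Rightarrow> 'y set" and l h
  where "bounded_level_system \<Delta> r X q l h" "\<G> \<cong>\<^sub>t level_group \<Delta> X q"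
proof -
  obtain \<Delta> :: "nat set" and r and X :: "nat set" and q :: "nat \<Rightarrow> nat \<Rightarrow> nat set" and l h
    where B: "bounded_level_system \<Delta> r X q l h" and i: "\<G> \<cong>\<^sub>t level_group \<Delta> X q"
    using assms unfolding level_realizable_def by blast
  interpret bounded_level_system \<Delta> r X q l h by fact
  obtain \<Delta>' :: "'e set" and r' and Y :: "'y set" and q' :: "'e \<Rightarrow> 'y \<Rightarrow> 'y set" and l' h'
    where "bounded_level_system \<Delta>' r' Y q' l' h'" and j: "level_group \<Delta> X q \<cong>\<^sub>t level_group \<Delta>' Y q'"
    using bounded by blast
  then show thesis using that topgroup_iso_trans[OF i j] by blast
qed

text \<open>For the empty space and the empty domain, which have no point to start from. The only
  extensional permutation of the empty set is the function that is \<open>undefined\<close>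
  everywhere, and it is matched with the identity of a single point.\<close>

lemma level_realizable_trivial:
  fixes \<G> :: "'g topgroup"
  assumes "\<G> \<cong>\<^sub>t perm_topgroup (discrete_topology {}) K" "K = Bij {}"
  shows "level_realizable \<G>"
proof -
  let ?q = "\<lambda>(_::nat) (x::nat). x" and ?id = "\<lambda>x\<in>{0::nat}. x"
  have K: "K = {\<lambda>_. undefined}"
    by (auto simp: assms(2) Bij_def extensional_def bij_betw_def)
  have L: "level_perms {} {0} ?q = {?id}"
  proof
    show "level_perms {} {0} ?q \<subseteq> {?id}"
    proof
      fix g assume "g \<in> level_perms {} {0} ?q"
      then have "g \<in> Bij {0}" using level_perms_Bij by blast
      then have "g = ?id" using Bij_apply[of g "{0}" 0] by (intro Bij_eqI[OF _ id_Bij]) auto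
      then show "g \<in> {?id}" by simp
    qed
  qed (use id_Bij[of "{0}"] in \<open>auto simp: level_perms_def\<close>)
  have "level_system {} {} {0} ?q"
  proof
    show "linear_order_on {} {}" by (auto intro: linear_orderI)
    show "\<exists>g\<in>level_perms {} {0} ?q. g x = y" if "x \<in> {0}" "y \<in> {0}" for x y
      unfolding L using that by simp
  qed auto
  moreover have "perm_topgroup (discrete_topology {}) K \<cong>\<^sub>t level_group {} {0} ?q"
  proof (rule perm_topgroup_isoI(1)[where h = "\<lambda>_. ?id"])
    show "K \<subseteq> Bij {}" using assms by simp
    show "level_perms {} {0} ?q \<subseteq> Bij {0}" by (rule level_perms_Bij)
    show "bij_betw (\<lambda>_. ?id) K (level_perms {} {0} ?q)" by (simp add: K L bij_betw_def)
    show "compose {} f g \<in> K" for f g by (simp add: K compose_def fun_eq_iff)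
  qed (auto simp: compose_def fun_eq_iff)
  ultimately show ?thesis using level_realizableI topgroup_iso_trans[OF assms(1)] by blast
qed

text \<open>Without a maximum every element of \<open>B\<close> has a strictly larger one in
  \<open>B\<close>, by linearity. Iterating a choice of such elements yields the forbidden
  chain.\<close>

lemma Max_sets_has_maximum:
  assumes lin: "linear_order_on \<Delta> r" and A: "A \<in> Max_sets \<Delta> r" and B: "B \<subseteq> A" "B \<noteq> {}"
  shows "has_maximum B r"
proof (rule ccontr)
  note lo = linear_orderD[OF lin]
  assume no_max: "\<not> has_maximum B r"
  have "\<exists>c. c \<in> B \<and> (b, c) \<in> r \<and> b \<noteq> c" if "b \<in> B" for b
  proof -
    obtain c where c: "c \<in> B" "(c, b) \<notin> r" using no_max \<open>b \<in> B\<close> unfolding has_maximum_def by blast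
    have "c \<in> \<Delta>" "b \<in> \<Delta>" using A B(1) c(1) \<open>b \<in> B\<close> by (auto simp: Max_sets_def)
    then show ?thesis using lo(2)[of b] lo(5)[of b c] c by blast
  qed
  then have "\<exists>s. \<forall>b\<in>B. s b \<in> B \<and> (b, s b) \<in> r \<and> b \<noteq> s b" by (intro bchoice) blast
  then obtain s where s: "\<And>b. b \<in> B \<Longrightarrow> s b \<in> B \<and> (b, s b) \<in> r \<and> b \<noteq> s b" by blast
  obtain b where b: "b \<in> B" using B(2) by blast
  have in_B: "(s ^^ n) b \<in> B" for n by (induction n) (use b s in auto)
  have "\<forall>n. (s ^^ n) b \<in> A \<and> ((s ^^ n) b, (s ^^ Suc n) b) \<in> r \<and> (s ^^ n) b \<noteq> (s ^^ Suc n) b"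
    using s[OF in_B] in_B B(1) by auto
  then have "\<exists>c. \<forall>n. c n \<in> A \<and> (c n, c (Suc n)) \<in> r \<and> c n \<noteq> c (Suc n)"
    by (intro exI[of _ "\<lambda>n. (s ^^ n) b"])
  then show False using A unfolding Max_sets_def by blast
qed

lemma Fin_subset_Max_sets:
  assumes lin: "linear_order_on \<Delta> r"
  shows "Fin \<Delta> r \<subseteq> Max_sets \<Delta> r"
proof
  note lo = linear_orderD[OF lin]
  fix A assume A: "A \<in> Fin \<Delta> r"
  have False if c: "\<forall>n. c n \<in> A \<and> (c n, c (Suc n)) \<in> r \<and> c n \<noteq> c (Suc n)" for c :: "nat \<Rightarrow> 'a"
  proof -
    have "(c i, c j) \<in> r \<and> c i \<noteq> c j" if "i < j" for i j
      using that
    proof (induction j)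
      case (Suc j)
      then show ?case
        using c lo(3)[of "c i" "c j" "c (Suc j)"] lo(4)[of "c j" "c (Suc j)"] by (cases "i = j") auto
    qed simp
    then have "inj c" by (metis injI linorder_neqE_nat)
    moreover have "finite (range c)" using c A by (intro finite_subset[of "range c" A]) (auto simp: Fin_def)
    ultimately show False using finite_imageD by blast
  qed
  then show "A \<in> Max_sets \<Delta> r" using A unfolding Max_sets_def Fin_def by blast
qed

lemma supp_domain_mono: "\<A> \<subseteq> \<B> \<Longrightarrow> supp_domain \<Delta> N \<A> \<subseteq> supp_domain \<Delta> N \<B>"
  by (auto simp: supp_domain_def)

text \<open>Where both functions are 0 they agree, so the places of disagreement are covered by the
  two supports. Each nonempty part has a maximum; the larger one is the top place of disagreement,
  and at no level above it do the restrictions differ.\<close>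

lemma has_maximum_restrict_neq:
  assumes lin: "linear_order_on \<Delta> r"
    and x: "x \<in> supp_domain \<Delta> N (Max_sets \<Delta> r)" and y: "y \<in> supp_domain \<Delta> N (Max_sets \<Delta> r)"
    and "x \<noteq> y"
  shows "has_maximum {\<delta> \<in> \<Delta>. x |` upset \<Delta> r \<delta> \<noteq> y |` upset \<Delta> r \<delta>} r"
proof -
  note lo = linear_orderD[OF lin]
  have dom: "dom x = \<Delta>" "dom y = \<Delta>" using x y by (auto simp: supp_domain_def skel_prod_def)
  have M: "supp x \<in> Max_sets \<Delta> r" "supp y \<in> Max_sets \<Delta> r" using x y by (auto simp: supp_domain_def)
  define D where "D = {\<gamma> \<in> \<Delta>. x \<gamma> \<noteq> y \<gamma>}"
  have "D \<noteq> {}"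
  proof -
    obtain \<gamma> where "x \<gamma> \<noteq> y \<gamma>" using \<open>x \<noteq> y\<close> by blast
    then have "\<gamma> \<in> \<Delta>" using dom by (metis domIff)
    then show ?thesis using \<open>x \<gamma> \<noteq> y \<gamma>\<close> by (auto simp: D_def)
  qed
  have D_sub: "D = (D \<inter> supp x) \<union> (D \<inter> supp y)"
  proof -
    have "\<gamma> \<in> supp x \<or> \<gamma> \<in> supp y" if "\<gamma> \<in> D" for \<gamma>
    proof -
      have *: "\<gamma> \<in> dom x" "\<gamma> \<in> dom y" "x \<gamma> \<noteq> y \<gamma>" using that dom by (simp_all add: D_def)
      then have "the (x \<gamma>) \<noteq> the (y \<gamma>)" by auto
      then show ?thesis using * by (simp add: supp_def) linarith
    qed
    then show ?thesis by blast
  qed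
  have "has_maximum D r"
  proof (cases "D \<inter> supp x = {} \<or> D \<inter> supp y = {}")
    case True
    then have "D \<subseteq> supp x \<or> D \<subseteq> supp y" using D_sub by blast
    then show ?thesis using Max_sets_has_maximum[OF lin] M \<open>D \<noteq> {}\<close> by blast
  next
    case False
    obtain a where a: "a \<in> D" "\<And>\<gamma>. \<gamma> \<in> D \<inter> supp x \<Longrightarrow> (\<gamma>, a) \<in> r"
      using Max_sets_has_maximum[OF lin M(1), of "D \<inter> supp x"] False unfolding has_maximum_def by blast
    obtain b where b: "b \<in> D" "\<And>\<gamma>. \<gamma> \<in> D \<inter> supp y \<Longrightarrow> (\<gamma>, b) \<in> r"
      using Max_sets_has_maximum[OF lin M(2), of "D \<inter> supp y"] False unfolding has_maximum_def by blast
    have "a \<in> \<Delta>" "b \<in> \<Delta>" using a b by (auto simp: D_def)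
    then consider "(a, b) \<in> r" | "(b, a) \<in> r" using lo(5) by blast
    then show ?thesis
    proof cases
      case 1
      then have "(\<gamma>, b) \<in> r" if "\<gamma> \<in> D" for \<gamma> using that D_sub a(2) b(2) lo(3) by blast
      then show ?thesis using b(1) unfolding has_maximum_def by blast
    next
      case 2
      then have "(\<gamma>, a) \<in> r" if "\<gamma> \<in> D" for \<gamma> using that D_sub a(2) b(2) lo(3) by blast
      then show ?thesis using a(1) unfolding has_maximum_def by blast
    qed
  qed
  then obtain m where m: "m \<in> D" "\<And>\<gamma>. \<gamma> \<in> D \<Longrightarrow> (\<gamma>, m) \<in> r" unfolding has_maximum_def by blast
  have "m \<in> \<Delta>" "x \<noteq> y" "x m \<noteq> y m" using m(1) by (auto simp: D_def)
  show ?thesis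
    unfolding has_maximum_def
  proof (intro bexI[of _ m] ballI)
    show "m \<in> {\<delta> \<in> \<Delta>. x |` upset \<Delta> r \<delta> \<noteq> y |` upset \<Delta> r \<delta>}"
      using \<open>m \<in> \<Delta>\<close> \<open>x m \<noteq> y m\<close> lo(2) by (auto simp: restrict_eq_iff upset_iff)
    fix \<delta> assume "\<delta> \<in> {\<delta> \<in> \<Delta>. x |` upset \<Delta> r \<delta> \<noteq> y |` upset \<Delta> r \<delta>}"
    then obtain \<gamma> where "\<gamma> \<in> \<Delta>" "(\<delta>, \<gamma>) \<in> r" "x \<gamma> \<noteq> y \<gamma>" by (auto simp: restrict_eq_iff upset_iff)
    then have "(\<gamma>, m) \<in> r" using m(2) by (simp add: D_def)
    then show "(\<delta>, m) \<in> r" using lo(3) \<open>(\<delta>, \<gamma>) \<in> r\<close> by blast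
  qed
qed

lemma level_system_restrict:
  assumes lin: "linear_order_on \<Delta> r" and "countable \<Delta>" "countable S" "S \<noteq> {}"
    and S: "S \<subseteq> supp_domain \<Delta> N (Max_sets \<Delta> r)"
    and trans: "\<And>x y. x \<in> S \<Longrightarrow> y \<in> S \<Longrightarrow> \<exists>g\<in>level_perms \<Delta> S (\<lambda>\<delta> x. x |` upset \<Delta> r \<delta>). g x = y"
  shows "level_system \<Delta> r S (\<lambda>\<delta> x. x |` upset \<Delta> r \<delta>)"
proof
  show "x |` upset \<Delta> r \<gamma> = y |` upset \<Delta> r \<gamma>"
    if "(\<delta>, \<gamma>) \<in> r" "x |` upset \<Delta> r \<delta> = y |` upset \<Delta> r \<delta>" for \<gamma> \<delta> x y
  proof -
    have "upset \<Delta> r \<gamma> \<subseteq> upset \<Delta> r \<delta>"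
      using that(1) linear_orderD(3)[OF lin] by (auto simp: upset_def)
    then show ?thesis using that(2) unfolding restrict_eq_iff by blast
  qed
  show "has_maximum {\<delta> \<in> \<Delta>. x |` upset \<Delta> r \<delta> \<noteq> y |` upset \<Delta> r \<delta>} r"
    if "x \<in> S" "y \<in> S" "x \<noteq> y" for x y
    using has_maximum_restrict_neq[OF lin subsetD[OF S that(1)] subsetD[OF S that(2)] that(3)] .
qed (use assms in auto)

text \<open>Transposing \<open>x \<delta>\<close> and \<open>y \<delta>\<close> in every coordinate \<open>\<delta>\<close> preserves finiteness of supports.\<close>

lemma wreath_Fin_transitive:
  assumes x: "x \<in> supp_domain \<Delta> N (Fin \<Delta> r)" and y: "y \<in> supp_domain \<Delta> N (Fin \<Delta> r)"
  shows "\<exists>g\<in>level_perms \<Delta> (supp_domain \<Delta> N (Fin \<Delta> r)) (\<lambda>\<delta> x. x |` upset \<Delta> r \<delta>). g x = y"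
proof -
  let ?S = "supp_domain \<Delta> N (Fin \<Delta> r)"
  have S: "z \<in> ?S \<longleftrightarrow> dom z = \<Delta> \<and> (\<forall>\<delta>\<in>\<Delta>. the (z \<delta>) \<in> below (N \<delta>)) \<and> finite (supp z)" for z
    by (auto simp: supp_domain_def skel_prod_def Fin_def supp_def)
  define t where "t = (\<lambda>z \<delta>. map_option (Transposition.transpose (the (x \<delta>)) (the (y \<delta>))) (z \<delta>))"
  \<comment> \<open>As an involution \<open>t\<close> is bijective once it maps the domain into
    itself, and preserving equality of restrictions in one direction gives the other.\<close>
  have tt: "t (t z) = z" for z by (auto simp: t_def fun_eq_iff option.map_comp o_def option.map_ident)
  have tS: "t z \<in> ?S" if "z \<in> ?S" for z
  proof -
    have "the (t z \<delta>) \<in> below (N \<delta>)" if "\<delta> \<in> \<Delta>" for \<delta>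
    proof -
      have "dom z = \<Delta>" "the (z \<delta>) \<in> below (N \<delta>)" using \<open>z \<in> ?S\<close> \<open>\<delta> \<in> \<Delta>\<close> unfolding S by simp_all
      moreover from this obtain a where "z \<delta> = Some a" using \<open>\<delta> \<in> \<Delta>\<close> by (metis domD)
      moreover have "the (x \<delta>) \<in> below (N \<delta>)" "the (y \<delta>) \<in> below (N \<delta>)"
        using x y \<open>\<delta> \<in> \<Delta>\<close> unfolding S by simp_all
      ultimately show ?thesis unfolding t_def by (simp add: Transposition.transpose_def)
    qed
    moreover have "dom (t z) = \<Delta>" using that unfolding S t_def by (auto simp: dom_def)
    \<comment> \<open>Where \<open>x\<close> and \<open>y\<close> are both 0 the transposition is
      the identity, so a nonzero value there was nonzero in \<open>z\<close>.\<close>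
    moreover have "supp (t z) \<subseteq> supp x \<union> supp y \<union> supp z"
    proof
      fix \<delta> assume "\<delta> \<in> supp (t z)"
      then obtain a where a: "z \<delta> = Some a" "Transposition.transpose (the (x \<delta>)) (the (y \<delta>)) a \<noteq> 0"
        by (auto simp: supp_def t_def)
      then have "\<delta> \<in> \<Delta>" using that unfolding S by auto
      moreover have "dom x = \<Delta>" "dom y = \<Delta>" using x y unfolding S by simp_all
      ultimately obtain b c where "x \<delta> = Some b" "y \<delta> = Some c" by (metis domD)
      then show "\<delta> \<in> supp x \<union> supp y \<union> supp z" using a
        by (auto simp: supp_def Transposition.transpose_def split: if_splits)
    qed
    ultimately show ?thesis using x y that unfolding S by (meson finite_UnI finite_subset)
  qed
  have tr: "t z |` A = t w |` A \<longleftrightarrow> z |` A = w |` A" for z w A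
  proof -
    have "t z |` A = t w |` A" if "z |` A = w |` A" for z w
      using that by (simp add: restrict_eq_iff t_def)
    from this[of z w] this[of "t z" "t w"] show ?thesis unfolding tt by blast
  qed
  let ?g = "restrict t ?S"
  have "?g \<in> Bij ?S"
  proof (rule BijI)
    show "inj_on ?g ?S" using tt by (metis (no_types, lifting) inj_onI restrict_apply')
    show "\<exists>w\<in>?S. ?g w = z" if "z \<in> ?S" for z
      using tt tS[OF that] by (intro bexI[of _ "t z"]) auto
  qed (use tS in auto)
  then have "?g \<in> level_perms \<Delta> ?S (\<lambda>\<delta> x. x |` upset \<Delta> r \<delta>)" by (simp add: level_perms_def tr)
  moreover have "t x = y"
  proof
    fix \<delta>
    have dom: "dom x = \<Delta>" "dom y = \<Delta>" using x y unfolding S by simp_all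
    show "t x \<delta> = y \<delta>"
    proof (cases "\<delta> \<in> \<Delta>")
      case True
      then obtain b c where "x \<delta> = Some b" "y \<delta> = Some c" using dom by (metis domD)
      then show ?thesis by (simp add: t_def)
    next
      case False
      then have "x \<delta> = None" "y \<delta> = None" using dom by (metis domIff)+
      then show ?thesis by (simp add: t_def)
    qed
  qed
  ultimately show ?thesis using x by (intro bexI[of _ ?g]) auto
qed

text \<open>A function is recovered from its graph over the support, which is a finite subset of a
  countable set.\<close>

lemma countable_supp_domain_Fin:
  assumes "countable \<Delta>"
  shows "countable (supp_domain \<Delta> N (Fin \<Delta> r))"
proof -
  let ?S = "supp_domain \<Delta> N (Fin \<Delta> r)" and ?f = "\<lambda>x. (\<lambda>\<delta>. (\<delta>, the (x \<delta>))) ` supp x"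
  have "?f ` ?S \<subseteq> {A. finite A \<and> A \<subseteq> \<Delta> \<times> UNIV}"
    by (auto simp: supp_domain_def Fin_def)
  moreover have "countable {A :: ('a \<times> nat) set. finite A \<and> A \<subseteq> \<Delta> \<times> UNIV}"
    using assms by (intro countable_Collect_finite_subset) auto
  ultimately have "countable (?f ` ?S)" by (rule countable_subset)
  moreover have "inj_on ?f ?S"
  proof (rule inj_onI, rule ext)
    fix x y \<delta> assume x: "x \<in> ?S" and y: "y \<in> ?S" and eq: "?f x = ?f y"
    show "x \<delta> = y \<delta>"
    proof (cases "\<delta> \<in> \<Delta>")
      case False
      then show ?thesis using x y by (auto simp: supp_domain_def skel_prod_def)
    next
      case True
      then obtain b c where bc: "x \<delta> = Some b" "y \<delta> = Some c"
        using x y by (fastforce simp: supp_domain_def skel_prod_def)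
      have fx: "(\<delta>, n) \<in> ?f x \<longleftrightarrow> n \<noteq> 0 \<and> n = b" and fy: "(\<delta>, n) \<in> ?f y \<longleftrightarrow> n \<noteq> 0 \<and> n = c" for n
        using bc by (auto simp: supp_def)
      have "n \<noteq> 0 \<and> n = b \<longleftrightarrow> n \<noteq> 0 \<and> n = c" for n
        using fx[of n] fy[of n] unfolding eq by (rule trans[OF sym])
      from this[of b] this[of c] show ?thesis using bc by auto
    qed
  qed
  ultimately show ?thesis by (rule countable_image_inj_on)
qed

lemma supp_domain_Fin_nonempty:
  assumes "\<And>\<delta>. \<delta> \<in> \<Delta> \<Longrightarrow> N \<delta> \<noteq> 0"
  shows "supp_domain \<Delta> N (Fin \<Delta> r) \<noteq> {}"
proof -
  let ?z = "\<lambda>\<delta>. if \<delta> \<in> \<Delta> then Some 0 else None"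
  have "enat 0 < N \<delta>" if "\<delta> \<in> \<Delta>" for \<delta> using assms[OF that] by (simp add: zero_enat_def[symmetric])
  moreover have "supp ?z = {}" "dom ?z = \<Delta>" by (auto simp: supp_def split: if_splits)
  ultimately have "?z \<in> supp_domain \<Delta> N (Fin \<Delta> r)"
    by (simp add: supp_domain_def skel_prod_def Fin_def below_def)
  then show ?thesis by blast
qed

text \<open>No minimum is assumed, so this covers the topology \<open>\<tau>\<^sup>*\<close> over
  every countable linear skeleton. Separating levels exist because a finite support contains no
  infinite increasing chain.\<close>

lemma level_system_Fin:
  assumes "countable_linear_skeleton \<Delta> r N"
  shows "level_system \<Delta> r (supp_domain \<Delta> N (Fin \<Delta> r)) (\<lambda>\<delta> x. x |` upset \<Delta> r \<delta>)"
proof (rule level_system_restrict)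
  show lin: "linear_order_on \<Delta> r" and c: "countable \<Delta>"
    using assms by (auto simp: countable_linear_skeleton_def countable_skeleton_def)
  show "countable (supp_domain \<Delta> N (Fin \<Delta> r))" by (rule countable_supp_domain_Fin[OF c])
  show "supp_domain \<Delta> N (Fin \<Delta> r) \<noteq> {}"
    using assms by (intro supp_domain_Fin_nonempty) (auto simp: countable_linear_skeleton_def countable_skeleton_def)
  show "supp_domain \<Delta> N (Fin \<Delta> r) \<subseteq> supp_domain \<Delta> N (Max_sets \<Delta> r)"
    by (rule supp_domain_mono[OF Fin_subset_Max_sets[OF lin]])
qed (rule wreath_Fin_transitive)

lemma Wr_Fin_star_eq_level_group:
  "Wr_Fin_star \<Delta> r N = level_group \<Delta> (supp_domain \<Delta> N (Fin \<Delta> r)) (\<lambda>\<delta> x. x |` upset \<Delta> r \<delta>)"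
  by (simp add: Wr_Fin_star_def wreath_eq_level_perms)

lemma Wr_eq_level_group:
  assumes "lowest \<in> \<Delta>" "\<And>\<delta>. \<delta> \<in> \<Delta> \<Longrightarrow> (lowest, \<delta>) \<in> r" "S \<subseteq> skel_prod N \<Delta>"
  shows "Wr \<Delta> r N S = level_group \<Delta> S (\<lambda>\<delta> x. x |` upset \<Delta> r \<delta>)"
  using subtopology_tau_eq_discrete[OF assms] by (simp add: Wr_def wreath_eq_level_perms)

text \<open>Below a common minimum locally finite means finite and the topology is discrete, so the
  two groups coincide on the nose and not just up to isomorphism.\<close>

lemma Wr_LF_eq_Wr_Fin_star:
  assumes "has_minimum \<Delta> r"
  shows "Wr_LF \<Delta> r N = Wr_Fin_star \<Delta> r N"
proof -
  obtain l where l: "l \<in> \<Delta>" "\<And>\<delta>. \<delta> \<in> \<Delta> \<Longrightarrow> (l, \<delta>) \<in> r" using assms by (auto simp: has_minimum_def)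
  have "supp_domain \<Delta> N (LF \<Delta> r) \<subseteq> skel_prod N \<Delta>" by (auto simp: supp_domain_def)
  from Wr_eq_level_group[OF l this] show ?thesis
    using LF_eq_Fin[OF l] by (simp add: Wr_LF_def Wr_Fin_star_eq_level_group)
qed

lemma level_realizable_Wr_Fin_star:
  assumes "countable_linear_skeleton \<Delta> r N" "\<G> \<cong>\<^sub>t Wr_Fin_star \<Delta> r N"
  shows "level_realizable \<G>"
  using level_realizableI[OF level_system_Fin[OF assms(1)]] assms(2)
  by (simp add: Wr_Fin_star_eq_level_group)

text \<open>At the minimum, approximate homogeneity is transitivity, because restriction forgets
  nothing there; and separability of a discrete space is countability.\<close>

lemma level_realizable_Wr:
  assumes sk: "countable_linear_skeleton \<Delta> r N" and min: "has_minimum \<Delta> r"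
    and S: "S \<subseteq> supp_domain \<Delta> N (Max_sets \<Delta> r)" and hom: "approx_homogeneous \<Delta> r S"
    and sep: "separable_space (subtopology (tau \<Delta> r N) S)" and iso: "\<G> \<cong>\<^sub>t Wr \<Delta> r N S"
  shows "level_realizable \<G>"
proof -
  let ?q = "\<lambda>\<delta> x. x |` upset \<Delta> r \<delta>"
  obtain l where l: "l \<in> \<Delta>" "\<And>\<delta>. \<delta> \<in> \<Delta> \<Longrightarrow> (l, \<delta>) \<in> r" using min by (auto simp: has_minimum_def)
  have up: "upset \<Delta> r l = \<Delta>" using l(2) by (auto simp: upset_def)
  have Ssk: "S \<subseteq> skel_prod N \<Delta>" using S by (auto simp: supp_domain_def)
  have G: "\<G> \<cong>\<^sub>t level_group \<Delta> S ?q" using iso Wr_eq_level_group[OF l Ssk] by simp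
  show ?thesis
  proof (cases "S = {}")
    case True
    then have "level_perms \<Delta> S ?q = Bij {}" by (auto simp: level_perms_def)
    then show ?thesis using level_realizable_trivial[of \<G> "Bij {}"] G True by simp
  next
    case False
    have "level_system \<Delta> r S ?q"
    proof (rule level_system_restrict[OF _ _ _ False S])
      show "linear_order_on \<Delta> r" "countable \<Delta>"
        using sk by (auto simp: countable_linear_skeleton_def countable_skeleton_def)
      show "countable S"
        using sep subtopology_tau_eq_discrete[OF l Ssk] by (simp add: separable_space_discrete_topology)
      show "\<exists>g\<in>level_perms \<Delta> S ?q. g x = y" if xy: "x \<in> S" "y \<in> S" for x y
      proof -
        obtain g where g: "g \<in> level_perms \<Delta> S ?q" "g x |` upset \<Delta> r l = y |` upset \<Delta> r l"
          using hom xy l(1) unfolding approx_homogeneous_def wreath_eq_level_perms by meson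
        have "g x \<in> S" using Bij_apply[OF subsetD[OF level_perms_Bij g(1)] that(1)] .
        then have "dom (g x) = \<Delta>" "dom y = \<Delta>" using Ssk \<open>y \<in> S\<close> by (auto simp: skel_prod_def)
        then have "g x \<delta> = y \<delta>" for \<delta>
          using g(2) unfolding up restrict_eq_iff by (cases "\<delta> \<in> \<Delta>") (auto simp: domIff)
        then have "g x = y" by (rule ext)
        then show ?thesis using g(1) by blast
      qed
    qed
    then show ?thesis using G by (rule level_realizableI)
  qed
qed

section \<open>Ultrametric spaces\<close>

lemma discrete_if_uniformly_discrete:
  assumes "uniformly_discrete_metric_space U"
  shows "discrete_metric_space U"
proof -
  interpret Metric_space "mspace U" "mdist U" by (rule Metric_space_mspace_mdist)
  obtain e where e: "e > 0" "\<And>x y. x \<in> mspace U \<Longrightarrow> y \<in> mspace U \<Longrightarrow> x \<noteq> y \<Longrightarrow> e \<le> mdist U x y"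
    using assms by (auto simp: uniformly_discrete_metric_space_def)
  have "openin mtopology A" if "A \<subseteq> mspace U" for A
    unfolding openin_mtopology
  proof (intro conjI allI impI)
    fix x assume "x \<in> A"
    have "mball x e \<subseteq> {x}" using e(2) by (auto simp: in_mball) (metis not_less)
    then show "\<exists>r>0. mball x r \<subseteq> A" using e(1) \<open>x \<in> A\<close> by (intro exI[of _ e]) auto
  qed fact
  then show ?thesis
    unfolding discrete_metric_space_def mtopology_of_def
    by (intro discrete_topology_unique[THEN iffD2, symmetric]) auto
qed

lemma mcomplete_if_uniformly_discrete:
  assumes "uniformly_discrete_metric_space U"
  shows "mcomplete_of U"
proof -
  interpret Metric_space "mspace U" "mdist U" by (rule Metric_space_mspace_mdist)
  obtain e where e: "e > 0" "\<And>x y. x \<in> mspace U \<Longrightarrow> y \<in> mspace U \<Longrightarrow> x \<noteq> y \<Longrightarrow> e \<le> mdist U x y"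
    using assms by (auto simp: uniformly_discrete_metric_space_def)
  have "\<exists>x. limitin mtopology \<sigma> x sequentially" if cauchy: "MCauchy \<sigma>" for \<sigma>
  proof -
    have \<sigma>: "\<sigma> n \<in> mspace U" for n using cauchy by (auto simp: MCauchy_def)
    obtain M where "\<And>n n'. M \<le> n \<Longrightarrow> M \<le> n' \<Longrightarrow> mdist U (\<sigma> n) (\<sigma> n') < e"
      using cauchy e(1) unfolding MCauchy_def by meson
    then have "\<sigma> n = \<sigma> M" if "M \<le> n" for n
      using e(2)[OF \<sigma>[of n] \<sigma>[of M]] that by (meson not_less order_refl)
    then have ev: "\<forall>\<^sub>F n in sequentially. \<sigma> n = \<sigma> M" by (rule eventually_sequentiallyI)
    have "\<forall>\<^sub>F n in sequentially. \<sigma> n \<in> A" if "\<sigma> M \<in> A" for A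
      using ev by (rule eventually_mono) (simp add: that)
    then have "limitin mtopology \<sigma> (\<sigma> M) sequentially" using \<sigma> by (simp add: limitin_def)
    then show ?thesis by blast
  qed
  then show ?thesis by (simp add: mcomplete_of_def mcomplete_def)
qed

text \<open>The inequality in \<open>q\<close> is strict so that \<open>x\<close> and
  \<open>y\<close> are separated exactly at the levels up to their distance, a set whose maximum is
  that distance. The ultrametric inequality makes open balls of one radius equal or disjoint, hence
  the kernel of \<open>q a\<close> is the relation intended.\<close>

lemma level_realizable_Iso:
  assumes P: "polish_ultrametric U" and H: "homogeneous_metric U" and D: "discrete_metric_space U"
    and iso: "\<G> \<cong>\<^sub>t Iso U"
  shows "level_realizable \<G>"
proof -
  interpret Metric_space "mspace U" "mdist U" by (rule Metric_space_mspace_mdist)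
  let ?X = "mspace U" and ?d = "mdist U"
  define \<Delta> where "\<Delta> = {?d x y | x y. x \<in> ?X \<and> y \<in> ?X \<and> x \<noteq> y}"
  define r where "r = {(a, b). a \<in> \<Delta> \<and> b \<in> \<Delta> \<and> a \<le> b}"
  define q where "q = (\<lambda>a x. {y \<in> ?X. ?d x y < a})"
  have Iso: "Iso U = perm_topgroup (discrete_topology ?X) (isometries U)"
    using D by (simp add: Iso_def discrete_metric_space_def)
  have countable: "countable ?X"
    using P D by (simp add: polish_ultrametric_def discrete_metric_space_def separable_space_discrete_topology)
  have ultra: "?d x z \<le> max (?d x y) (?d y z)" if "x \<in> ?X" "y \<in> ?X" "z \<in> ?X" for x y z
    using P that by (simp add: polish_ultrametric_def)
  have pos: "0 < a" if "a \<in> \<Delta>" for a using that by (auto simp: \<Delta>_def)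
  have q: "q a x = q a y \<longleftrightarrow> ?d x y < a" if "a \<in> \<Delta>" "x \<in> ?X" "y \<in> ?X" for a x y
  proof
    assume "q a x = q a y"
    moreover have "y \<in> q a y" using that pos by (simp add: q_def)
    ultimately show "?d x y < a" by (auto simp: q_def)
  next
    assume xy: "?d x y < a"
    have "?d x z < a \<longleftrightarrow> ?d y z < a" if "z \<in> ?X" for z
      using ultra[of x y z] ultra[of y x z] commute[of x y] xy that \<open>x \<in> ?X\<close> \<open>y \<in> ?X\<close> by linarith
    then show "q a x = q a y" by (auto simp: q_def)
  qed
  have isometries: "isometries U = level_perms \<Delta> ?X q"
  proof
    show "isometries U \<subseteq> level_perms \<Delta> ?X q"
    proof
      fix g assume g: "g \<in> isometries U"
      then have gB: "g \<in> Bij ?X" by (simp add: isometries_def)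
      have "q a x = q a y \<longleftrightarrow> q a (g x) = q a (g y)" if "a \<in> \<Delta>" "x \<in> ?X" "y \<in> ?X" for a x y
        using q[OF that] q[OF that(1) Bij_apply[OF gB that(2)] Bij_apply[OF gB that(3)]] g that
        by (simp add: isometries_def)
      then show "g \<in> level_perms \<Delta> ?X q" using gB by (simp add: level_perms_def)
    qed
    show "level_perms \<Delta> ?X q \<subseteq> isometries U"
    proof
      fix g assume g: "g \<in> level_perms \<Delta> ?X q"
      then have gB: "g \<in> Bij ?X" using level_perms_Bij by blast
      have "?d (g x) (g y) = ?d x y" if xy: "x \<in> ?X" "y \<in> ?X" for x y
      proof (cases "x = y")
        case True then show ?thesis using xy Bij_apply[OF gB] by simp
      next
        case False
        have gX: "g x \<in> ?X" "g y \<in> ?X" using Bij_apply[OF gB] xy by blast+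
        have "g x \<noteq> g y" using False Bij_inj[OF gB] xy by simp
        then have "?d x y \<in> \<Delta>" "?d (g x) (g y) \<in> \<Delta>" using False xy gX by (auto simp: \<Delta>_def)
        \<comment> \<open>Both distances are themselves levels; inserting each of them for
          \<open>a\<close> shows that neither is smaller than the other.\<close>
        have "?d (g x) (g y) < a \<longleftrightarrow> ?d x y < a" if "a \<in> \<Delta>" for a
          using level_perms_iff[OF g that xy] q[OF that xy] q[OF that gX] by simp
        from this[OF \<open>?d x y \<in> \<Delta>\<close>] this[OF \<open>?d (g x) (g y) \<in> \<Delta>\<close>] show ?thesis by simp
      qed
      then show "g \<in> isometries U" using gB by (simp add: isometries_def)
    qed
  qed
  show ?thesis
  proof (cases "?X = {}")
    case True
    then have "isometries U = Bij {}" by (simp add: isometries_def)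
    then show ?thesis using level_realizable_trivial[of \<G> "Bij {}"] iso Iso True by simp
  next
    case False
    have "level_system \<Delta> r ?X q"
    proof
      show "linear_order_on \<Delta> r" by (rule linear_orderI) (auto simp: r_def)
      have "\<Delta> \<subseteq> (\<lambda>(x, y). ?d x y) ` (?X \<times> ?X)" by (auto simp: \<Delta>_def)
      then show "countable \<Delta>" using countable by (meson countable_SIGMA countable_image countable_subset)
      show "q \<gamma> x = q \<gamma> y" if "(\<delta>, \<gamma>) \<in> r" "x \<in> ?X" "y \<in> ?X" "q \<delta> x = q \<delta> y" for \<gamma> \<delta> x y
        using that q by (auto simp: r_def)
      show "has_maximum {\<delta> \<in> \<Delta>. q \<delta> x \<noteq> q \<delta> y} r" if xy: "x \<in> ?X" "y \<in> ?X" "x \<noteq> y" for x y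
      proof -
        have m: "?d x y \<in> \<Delta>" using xy by (auto simp: \<Delta>_def)
        have "{\<delta> \<in> \<Delta>. q \<delta> x \<noteq> q \<delta> y} = {\<delta> \<in> \<Delta>. \<delta> \<le> ?d x y}"
          by (rule Collect_cong) (use q[OF _ xy(1,2)] in \<open>meson not_less\<close>)
        then show ?thesis using m unfolding has_maximum_def by (intro bexI[of _ "?d x y"]) (auto simp: r_def)
      qed
      show "\<exists>g\<in>level_perms \<Delta> ?X q. g x = y" if "x \<in> ?X" "y \<in> ?X" for x y
        using H that unfolding homogeneous_metric_def isometries by blast
    qed (use countable False in auto)
    then show ?thesis using iso unfolding Iso isometries by (rule level_realizableI)
  qed
qed

text \<open>The element with number \<open>n\<close> gets weight \<open>(1/2) ^ n\<close>, and
  \<open>f \<delta>\<close> adds up the weights of the elements up to \<delta>; passing to a larger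
  element adds at least its own weight. The summand 1 keeps the values away from 0, so that a metric
  with these distances is uniformly discrete.\<close>

lemma ex_strict_mono_real:
  assumes lin: "linear_order_on \<Delta> r" and c: "countable \<Delta>"
  shows "\<exists>f :: 'a \<Rightarrow> real. (\<forall>\<delta>. 1 \<le> f \<delta>) \<and> (\<forall>\<delta> \<gamma>. (\<delta>, \<gamma>) \<in> r \<and> \<delta> \<noteq> \<gamma> \<longrightarrow> f \<delta> < f \<gamma>)"
proof -
  note lo = linear_orderD[OF lin]
  define t where "t = (\<lambda>\<delta> n. if n \<in> to_nat_on \<Delta> ` {\<gamma> \<in> \<Delta>. (\<gamma>, \<delta>) \<in> r} then (1/2::real) ^ n else 0)"
  define f where "f = (\<lambda>\<delta>. 1 + suminf (t \<delta>))"
  have geo: "summable (\<lambda>n. (1/2::real) ^ n)" by (rule summable_geometric) simp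
  have sum: "summable (t \<delta>)" for \<delta>
    by (rule summable_comparison_test'[OF geo, of 0]) (simp add: t_def)
  have nonneg: "0 \<le> t \<delta> n" for \<delta> n by (simp add: t_def)
  have "f \<delta> < f \<gamma>" if "(\<delta>, \<gamma>) \<in> r" "\<delta> \<noteq> \<gamma>" for \<delta> \<gamma>
  proof -
    have \<Delta>: "\<delta> \<in> \<Delta>" "\<gamma> \<in> \<Delta>" using lo(1) that by blast+
    have le: "t \<delta> n \<le> t \<gamma> n" for n
    proof -
      have "{\<beta> \<in> \<Delta>. (\<beta>, \<delta>) \<in> r} \<subseteq> {\<beta> \<in> \<Delta>. (\<beta>, \<gamma>) \<in> r}" using lo(3) that(1) by blast
      then show ?thesis unfolding t_def by (auto simp: image_iff) 
    qed
    let ?n = "to_nat_on \<Delta> \<gamma>"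
    have "?n \<notin> to_nat_on \<Delta> ` {\<beta> \<in> \<Delta>. (\<beta>, \<delta>) \<in> r}"
      using to_nat_on_inj[OF c] \<Delta> lo(4) that by auto
    moreover have "?n \<in> to_nat_on \<Delta> ` {\<beta> \<in> \<Delta>. (\<beta>, \<gamma>) \<in> r}" using \<Delta> lo(2) by blast
    ultimately have "t \<gamma> ?n - t \<delta> ?n > 0" by (simp add: t_def)
    then have "0 < suminf (\<lambda>n. t \<gamma> n - t \<delta> n)"
      using le summable_diff[OF sum[of \<gamma>] sum[of \<delta>]] by (intro suminf_pos2) auto
    then show ?thesis using suminf_diff[OF sum[of \<gamma>] sum[of \<delta>]] by (simp add: f_def)
  qed
  moreover have "1 \<le> f \<delta>" for \<delta> using suminf_nonneg[OF sum nonneg] by (simp add: f_def)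
  ultimately show ?thesis by blast
qed

text \<open>The distance of two points is the value of \<open>f\<close> at the top level that
  separates them. At the level belonging to \<open>x\<close> and \<open>z\<close> a third point
  \<open>y\<close> differs from one of them, whence the ultrametric inequality. As \<open>f\<close>
  is injective on levels, an isometry preserves the separating levels and not only their
  values.\<close>

lemma (in level_system) ex_ultrametric:
  "\<exists>U. polish_ultrametric U \<and> homogeneous_metric U \<and> uniformly_discrete_metric_space U \<and>
       Iso U = level_group \<Delta> X q"
proof -
  note lo = linear_orderD[OF lin]
  obtain f :: "'d \<Rightarrow> real" where f1: "\<And>\<delta>. 1 \<le> f \<delta>"
    and f: "\<And>\<delta> \<gamma>. (\<delta>, \<gamma>) \<in> r \<Longrightarrow> \<delta> \<noteq> \<gamma> \<Longrightarrow> f \<delta> < f \<gamma>"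
    using ex_strict_mono_real[OF lin countable_levels] by blast
  have fle: "f \<delta> \<le> f \<gamma>" if "(\<delta>, \<gamma>) \<in> r" for \<delta> \<gamma> using f[OF that] by (cases "\<delta> = \<gamma>") auto
  have f_inj: "\<delta> = \<gamma>" if "f \<delta> = f \<gamma>" "\<delta> \<in> \<Delta>" "\<gamma> \<in> \<Delta>" for \<delta> \<gamma>
    using lo(5)[OF that(2,3)] f[of \<delta> \<gamma>] f[of \<gamma> \<delta>] that(1) by fastforce
  define D where "D x y = (SOME m. m \<in> \<Delta> \<and> q m x \<noteq> q m y \<and> (\<forall>\<delta>\<in>\<Delta>. q \<delta> x \<noteq> q \<delta> y \<longrightarrow> (\<delta>, m) \<in> r))" for x y
  define d where "d x y = (if x = y then 0 else f (D x y))" for x y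
  have D: "D x y \<in> \<Delta>" "q (D x y) x \<noteq> q (D x y) y" "\<And>\<delta>. \<delta> \<in> \<Delta> \<Longrightarrow> q \<delta> x \<noteq> q \<delta> y \<Longrightarrow> (\<delta>, D x y) \<in> r"
    if "x \<in> X" "y \<in> X" "x \<noteq> y" for x y
  proof -
    have "\<exists>m. m \<in> \<Delta> \<and> q m x \<noteq> q m y \<and> (\<forall>\<delta>\<in>\<Delta>. q \<delta> x \<noteq> q \<delta> y \<longrightarrow> (\<delta>, m) \<in> r)"
      using max_split[OF that] by (auto simp: has_maximum_def)
    from someI_ex[OF this, folded D_def]
    show "D x y \<in> \<Delta>" "q (D x y) x \<noteq> q (D x y) y" "\<And>\<delta>. \<delta> \<in> \<Delta> \<Longrightarrow> q \<delta> x \<noteq> q \<delta> y \<Longrightarrow> (\<delta>, D x y) \<in> r"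
      by auto
  qed
  \<comment> \<open>By \<open>coarser\<close> the separating levels form an initial segment, so the
    top one determines all of them.\<close>
  have D_iff: "q \<delta> x \<noteq> q \<delta> y \<longleftrightarrow> (\<delta>, D x y) \<in> r" if "x \<in> X" "y \<in> X" "x \<noteq> y" "\<delta> \<in> \<Delta>" for x y \<delta>
    using D[OF that(1-3)] that coarser[of \<delta> "D x y" x y] by blast
  have D_commute: "D x y = D y x" for x y unfolding D_def by metis
  have ge1: "1 \<le> d x y" if "x \<noteq> y" for x y using that f1 by (simp add: d_def)
  have nonneg: "0 \<le> d x y" for x y using f1[of "D x y"] by (simp add: d_def)
  have ultra: "d x z \<le> max (d x y) (d y z)" if "x \<in> X" "y \<in> X" "z \<in> X" for x y z
  proof (cases "x = z \<or> x = y \<or> y = z")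
    case True
    have "d x x = 0" for x by (simp add: d_def)
    then show ?thesis using True nonneg by (auto simp: le_max_iff_disj)
  next
    case False
    then have "q (D x z) x \<noteq> q (D x z) y \<or> q (D x z) y \<noteq> q (D x z) z" "D x z \<in> \<Delta>"
      using D(1,2)[of x z] that by auto
    then have "(D x z, D x y) \<in> r \<or> (D x z, D y z) \<in> r"
      using D(3)[of x y "D x z"] D(3)[of y z "D x z"] that False by blast
    then show ?thesis using fle False by (auto simp: d_def le_max_iff_disj)
  qed
  interpret M: Metric_space X d
  proof
    show "0 \<le> d x y" for x y by (rule nonneg)
    show "d x y = d y x" for x y by (simp add: d_def D_commute)
    show "d x y = 0 \<longleftrightarrow> x = y" for x y using ge1[of x y] by (cases "x = y") (auto simp: d_def)
    show "d x z \<le> d x y + d y z" if "x \<in> X" "y \<in> X" "z \<in> X" for x y z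
      using ultra[OF that] nonneg[of x y] nonneg[of y z] by linarith
  qed
  let ?U = "metric (X, d)"
  have ms: "mspace ?U = X" and md: "mdist ?U = d" by simp_all
  have ud: "uniformly_discrete_metric_space ?U"
    unfolding uniformly_discrete_metric_space_def ms md using ge1 by (intro exI[of _ 1]) simp
  then have disc: "mtopology_of ?U = discrete_topology X"
    using discrete_if_uniformly_discrete[of ?U] by (simp only: discrete_metric_space_def ms)
  have pres: "d (g x) (g y) = d x y" if g: "g \<in> level_perms \<Delta> X q" and xy: "x \<in> X" "y \<in> X" for g x y
  proof (cases "x = y")
    case False
    have gB: "g \<in> Bij X" using g level_perms_Bij by blast
    have gX: "g x \<in> X" "g y \<in> X" "g x \<noteq> g y" using Bij_apply[OF gB] xy Bij_inj[OF gB] False by auto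
    have "(\<delta>, D (g x) (g y)) \<in> r \<longleftrightarrow> (\<delta>, D x y) \<in> r" if "\<delta> \<in> \<Delta>" for \<delta>
      using D_iff[OF gX that] D_iff[OF xy False that] level_perms_iff[OF g that xy] by simp
    then have "D (g x) (g y) = D x y"
      using lo(2,4) D(1)[OF gX] D(1)[OF xy False] by blast
    then show ?thesis using gX(3) False by (simp add: d_def)
  qed (simp add: d_def)
  have isom: "isometries ?U = level_perms \<Delta> X q"
  proof
    show "level_perms \<Delta> X q \<subseteq> isometries ?U"
      unfolding isometries_def ms md using pres level_perms_Bij by blast
    show "isometries ?U \<subseteq> level_perms \<Delta> X q"
    proof
      fix g assume "g \<in> isometries ?U"
      then have gB: "g \<in> Bij X" and gd: "\<And>x y. x \<in> X \<Longrightarrow> y \<in> X \<Longrightarrow> d (g x) (g y) = d x y"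
        unfolding isometries_def ms md by auto
      have "q \<delta> x = q \<delta> y \<longleftrightarrow> q \<delta> (g x) = q \<delta> (g y)" if \<delta>: "\<delta> \<in> \<Delta>" and xy: "x \<in> X" "y \<in> X" for \<delta> x y
      proof (cases "x = y")
        case False
        have gX: "g x \<in> X" "g y \<in> X" "g x \<noteq> g y" using Bij_apply[OF gB] xy Bij_inj[OF gB] False by auto
        have "f (D (g x) (g y)) = f (D x y)" using gd[OF xy] False gX(3) by (simp add: d_def)
        then have "D (g x) (g y) = D x y" using f_inj D(1)[OF gX] D(1)[OF xy False] by blast
        then show ?thesis using D_iff[OF gX \<delta>] D_iff[OF xy False \<delta>] by auto
      qed simp
      then show "g \<in> level_perms \<Delta> X q" using gB by (simp add: level_perms_def)
    qed
  qed
  have "polish_ultrametric ?U"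
    unfolding polish_ultrametric_def ms md disc
    using countable_points ultra mcomplete_if_uniformly_discrete[OF ud]
    by (simp add: separable_space_discrete_topology)
  moreover have "homogeneous_metric ?U"
    unfolding homogeneous_metric_def isom ms using transitive by blast
  moreover have "Iso ?U = level_group \<Delta> X q" by (simp only: Iso_def disc isom)
  ultimately show ?thesis using ud by blast
qed

section \<open>Trees\<close>

text \<open>As \<open>p m\<close> is injective, \<open>p \<delta> x\<close> is the only node of
  level \<delta> above \<open>p m x\<close>. So an automorphism follows its action on the lowest
  level, and being injective it makes that action respect the kernel of each
  \<open>p \<delta>\<close>. Conversely, order between nodes is witnessed by a common point below
  them, which a lifted permutation carries along.\<close>

lemma tree_automorphisms_eq_ladder_perms:
  assumes m: "m \<in> \<Delta>" "\<And>\<delta>. \<delta> \<in> \<Delta> \<Longrightarrow> (m, \<delta>) \<in> r" "inj_on (p m) X" and r: "r \<subseteq> \<Delta> \<times> \<Delta>"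
    and T: "T = (\<Union>\<delta>\<in>\<Delta>. p \<delta> ` X)"
    and rT: "rT = {(p \<delta> x, p \<gamma> x) | \<delta> \<gamma> x. (\<delta>, \<gamma>) \<in> r \<and> x \<in> X}"
    and lev: "\<And>\<delta> x. \<delta> \<in> \<Delta> \<Longrightarrow> x \<in> X \<Longrightarrow> lev (p \<delta> x) = \<delta>"
  shows "tree_automorphisms T rT lev = ladder_perms \<Delta> X p"
proof
  have disj: "\<delta> = \<gamma>" if "p \<delta> x = p \<gamma> y" "\<delta> \<in> \<Delta>" "\<gamma> \<in> \<Delta>" "x \<in> X" "y \<in> X" for \<delta> \<gamma> x y
    using lev[OF that(2,4)] lev[OF that(3,5)] that(1) by simp
  have TE: "\<exists>\<delta> x. \<delta> \<in> \<Delta> \<and> x \<in> X \<and> t = p \<delta> x" if "t \<in> T" for t using that T by auto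
  have pT: "p \<delta> x \<in> T" if "\<delta> \<in> \<Delta>" "x \<in> X" for \<delta> x using that T by auto
  have rTE: "\<exists>z\<in>X. p \<delta> x = p \<delta> z \<and> p \<gamma> y = p \<gamma> z \<and> (\<delta>, \<gamma>) \<in> r"
    if "(p \<delta> x, p \<gamma> y) \<in> rT" "\<delta> \<in> \<Delta>" "\<gamma> \<in> \<Delta>" "x \<in> X" "y \<in> X" for \<delta> \<gamma> x y
  proof -
    obtain \<delta>' \<gamma>' z where *: "(\<delta>', \<gamma>') \<in> r" "z \<in> X" "p \<delta> x = p \<delta>' z" "p \<gamma> y = p \<gamma>' z"
      using \<open>(p \<delta> x, p \<gamma> y) \<in> rT\<close> unfolding rT by auto
    have "\<delta>' \<in> \<Delta>" "\<gamma>' \<in> \<Delta>" using *(1) r by auto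
    then have "\<delta> = \<delta>'" "\<gamma> = \<gamma>'" using disj[OF *(3)] disj[OF *(4)] *(2) that(2-5) by blast+
    then show ?thesis using * by auto
  qed
  show "tree_automorphisms T rT lev \<subseteq> ladder_perms \<Delta> X p"
  proof
    fix f assume "f \<in> tree_automorphisms T rT lev"
    then have fB: "f \<in> Bij T" and flev: "\<And>t. t \<in> T \<Longrightarrow> lev (f t) = lev t"
      and ford: "\<And>t t'. t \<in> T \<Longrightarrow> t' \<in> T \<Longrightarrow> (f t, f t') \<in> rT \<longleftrightarrow> (t, t') \<in> rT"
      unfolding tree_automorphisms_def by auto
    define g where "g = (\<lambda>x\<in>X. inv_into X (p m) (f (p m x)))"
    have g: "g x \<in> X \<and> p m (g x) = f (p m x)" if x: "x \<in> X" for x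
    proof -
      obtain \<delta> y where *: "\<delta> \<in> \<Delta>" "y \<in> X" "f (p m x) = p \<delta> y"
        using TE[OF Bij_apply[OF fB pT[OF m(1) x]]] by auto
      have "\<delta> = m" using flev[OF pT[OF m(1) x]] lev[OF *(1,2)] lev[OF m(1) x] *(3) by simp
      then have "f (p m x) \<in> p m ` X" using * by simp
      then show ?thesis using x by (simp add: g_def inv_into_into f_inv_into_f)
    qed
    have fp: "f (p \<delta> x) = p \<delta> (g x)" if \<delta>: "\<delta> \<in> \<Delta>" and x: "x \<in> X" for \<delta> x
    proof -
      obtain \<gamma> y where *: "\<gamma> \<in> \<Delta>" "y \<in> X" "f (p \<delta> x) = p \<gamma> y"
        using TE[OF Bij_apply[OF fB pT[OF \<delta> x]]] by auto
      have \<gamma>: "\<gamma> = \<delta>" using flev[OF pT[OF \<delta> x]] lev[OF *(1,2)] lev[OF \<delta> x] *(3) by simp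
      have "(p m x, p \<delta> x) \<in> rT" unfolding rT using m(2)[OF \<delta>] x by auto
      then have "(p m (g x), p \<delta> y) \<in> rT"
        using ford[OF pT[OF m(1) x] pT[OF \<delta> x]] g[OF x] *(3) \<gamma> by simp
      then obtain z where z: "z \<in> X" "p m (g x) = p m z" "p \<delta> y = p \<delta> z"
        using rTE[OF _ m(1) \<delta> conjunct1[OF g[OF x]] *(2)] by auto
      then have "z = g x" using inj_onD[OF m(3) z(2)] g[OF x] by simp
      then show ?thesis using z *(3) \<gamma> by simp
    qed
    have gB: "g \<in> Bij X"
    proof (rule BijI)
      show "g \<in> extensional X" by (simp add: g_def)
      show "inj_on g X"
      proof (rule inj_onI)
        fix x y assume xy: "x \<in> X" "y \<in> X" "g x = g y"
        then have "f (p m x) = f (p m y)" using g by metis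
        then have "p m x = p m y" using Bij_inj[OF fB pT[OF m(1) xy(1)] pT[OF m(1) xy(2)]] by simp
        then show "x = y" using inj_onD[OF m(3) _ xy(1,2)] by simp
      qed
      show "g x \<in> X" if "x \<in> X" for x using g[OF that] by simp
      show "\<exists>x\<in>X. g x = y" if y: "y \<in> X" for y
      proof -
        obtain t where t: "t \<in> T" "f t = p m y" using Bij_surj[OF fB pT[OF m(1) y]] by auto
        obtain \<delta> x where *: "\<delta> \<in> \<Delta>" "x \<in> X" "t = p \<delta> x" using TE[OF t(1)] by auto
        have eq: "p \<delta> (g x) = p m y" using fp[OF *(1,2)] * t(2) by simp
        have gx: "g x \<in> X" using g[OF *(2)] by simp
        have "\<delta> = m" using disj[OF eq *(1) m(1) gx y] .
        then have "g x = y" using inj_onD[OF m(3) _ gx y] eq by simp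
        then show ?thesis using *(2) by auto
      qed
    qed
    have "p \<delta> x = p \<delta> y \<longleftrightarrow> p \<delta> (g x) = p \<delta> (g y)" if "\<delta> \<in> \<Delta>" "x \<in> X" "y \<in> X" for \<delta> x y
      using fp[OF that(1,2)] fp[OF that(1,3)] Bij_inj[OF fB pT[OF that(1,2)] pT[OF that(1,3)]] by simp
    then have "g \<in> level_perms \<Delta> X p" using gB by (simp add: level_perms_def)
    then show "f \<in> ladder_perms \<Delta> X p"
      unfolding ladder_perms_def T[symmetric] using fB fp by (intro CollectI conjI bexI[of _ g]) auto
  qed
  show "ladder_perms \<Delta> X p \<subseteq> tree_automorphisms T rT lev"
  proof
    fix f assume "f \<in> ladder_perms \<Delta> X p"
    then obtain g where fB: "f \<in> Bij T" and g: "g \<in> level_perms \<Delta> X p"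
      and fp: "\<And>\<delta> x. \<delta> \<in> \<Delta> \<Longrightarrow> x \<in> X \<Longrightarrow> f (p \<delta> x) = p \<delta> (g x)"
      unfolding ladder_perms_def T[symmetric] by auto
    have gB: "g \<in> Bij X" using g level_perms_Bij by blast
    have "lev (f t) = lev t" if "t \<in> T" for t
    proof -
      obtain \<delta> x where *: "\<delta> \<in> \<Delta>" "x \<in> X" "t = p \<delta> x" using TE[OF \<open>t \<in> T\<close>] by auto
      then show ?thesis using fp[OF *(1,2)] lev[OF *(1,2)] lev[OF *(1) Bij_apply[OF gB *(2)]] by simp
    qed
    moreover have "(f t, f t') \<in> rT \<longleftrightarrow> (t, t') \<in> rT" if tt: "t \<in> T" "t' \<in> T" for t t'
    proof
      assume "(t, t') \<in> rT"
      then obtain \<delta> \<gamma> x where *: "(\<delta>, \<gamma>) \<in> r" "x \<in> X" "t = p \<delta> x" "t' = p \<gamma> x" unfolding rT by auto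
      have "\<delta> \<in> \<Delta>" "\<gamma> \<in> \<Delta>" using *(1) r by auto
      then show "(f t, f t') \<in> rT" unfolding rT using * fp[of \<delta> x] fp[of \<gamma> x] Bij_apply[OF gB *(2)] by auto
    next
      assume ft: "(f t, f t') \<in> rT"
      obtain \<delta> x where *: "\<delta> \<in> \<Delta>" "x \<in> X" "t = p \<delta> x" using TE[OF tt(1)] by auto
      obtain \<gamma> y where **: "\<gamma> \<in> \<Delta>" "y \<in> X" "t' = p \<gamma> y" using TE[OF tt(2)] by auto
      have "(p \<delta> (g x), p \<gamma> (g y)) \<in> rT" using ft * ** fp by simp
      then obtain z where z: "z \<in> X" "p \<delta> (g x) = p \<delta> z" "p \<gamma> (g y) = p \<gamma> z" "(\<delta>, \<gamma>) \<in> r"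
        using rTE[OF _ *(1) **(1) Bij_apply[OF gB *(2)] Bij_apply[OF gB **(2)]] by auto
      \<comment> \<open>The point witnessing the order of the images is pulled back along
        \<open>g\<close>; since \<open>g\<close> reflects the kernels, it witnesses the order of
        \<open>t\<close> and \<open>t'\<close>.\<close>
      obtain w where w: "w \<in> X" "g w = z" using Bij_surj[OF gB z(1)] by auto
      have "p \<delta> x = p \<delta> w" using level_perms_iff[OF g *(1,2) w(1)] z(2) w(2) by simp
      moreover have "p \<gamma> y = p \<gamma> w" using level_perms_iff[OF g **(1,2) w(1)] z(3) w(2) by simp
      ultimately show "(t, t') \<in> rT" unfolding rT using *(3) **(3) z(4) w(1) by auto
    qed
    ultimately show "f \<in> tree_automorphisms T rT lev" using fB by (simp add: tree_automorphisms_def)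
  qed
qed

text \<open>The points are the nodes of the lowest level. Prunedness puts one of them below every
  node, so all nodes arise by projecting upwards. Distinct points share a level and are therefore
  incomparable, and the condition on incomparable nodes becomes \<open>max_split\<close>.\<close>

lemma level_realizable_Aut:
  assumes min: "has_minimum L rL" and tree: "L_tree L rL T rT lev" and "countable T"
    and hom: "homogeneous_tree T rT lev" and pruned: "pruned_tree L rL T rT lev"
    and iso: "\<G> \<cong>\<^sub>t Aut T rT lev"
  shows "level_realizable \<G>"
proof -
  have lin: "linear_order_on L rL" and po: "partial_order_on T rT" and levT: "lev ` T = L"
    and strict: "\<And>t t'. t \<in> T \<Longrightarrow> t' \<in> T \<Longrightarrow> (t, t') \<in> rT \<Longrightarrow> t \<noteq> t' \<Longrightarrow> (lev t, lev t') \<in> rL \<and> lev t \<noteq> lev t'"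
    and uniq: "\<And>t l. t \<in> T \<Longrightarrow> l \<in> upset L rL (lev t) \<Longrightarrow> \<exists>!s. s \<in> T \<and> (t, s) \<in> rT \<and> lev s = l"
    and inc: "\<And>t t'. t \<in> T \<Longrightarrow> t' \<in> T \<Longrightarrow> (t, t') \<notin> rT \<and> (t', t) \<notin> rT \<Longrightarrow>
        has_maximum {l \<in> upset L rL (lev t) \<inter> upset L rL (lev t').
          node_above T rT lev t l \<noteq> node_above T rT lev t' l} rL"
    using tree unfolding L_tree_def by auto
  note lo = linear_orderD[OF lin]
  have rTT: "rT \<subseteq> T \<times> T" and refl: "\<And>t. t \<in> T \<Longrightarrow> (t, t) \<in> rT"
    and trans: "\<And>s t u. (s, t) \<in> rT \<Longrightarrow> (t, u) \<in> rT \<Longrightarrow> (s, u) \<in> rT"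
    using po unfolding order_on_defs refl_on_def by (auto dest: transD)
  obtain m where m: "m \<in> L" "\<And>l. l \<in> L \<Longrightarrow> (m, l) \<in> rL" using min by (auto simp: has_minimum_def)
  have levL: "lev t \<in> L" if "t \<in> T" for t using levT that by auto
  define X where "X = {t \<in> T. lev t = m}"
  define p where "p l x = node_above T rT lev x l" for l x
  have XT: "x \<in> T" "lev x = m" if "x \<in> X" for x using that by (auto simp: X_def)
  have upX: "upset L rL (lev x) = L" if "x \<in> X" for x using XT[OF that] m(2) by (auto simp: upset_def)
  have p: "p l x \<in> T" "(x, p l x) \<in> rT" "lev (p l x) = l" if "l \<in> L" "x \<in> X" for l x
  proof -
    have "\<exists>!s. s \<in> T \<and> (x, s) \<in> rT \<and> lev s = l" using uniq[OF XT(1)[OF that(2)]] upX[OF that(2)] that(1) by simp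
    from theI'[OF this] show "p l x \<in> T" "(x, p l x) \<in> rT" "lev (p l x) = l"
      unfolding p_def node_above_def by auto
  qed
  have p_eq: "s = p (lev s) x" if "x \<in> X" "(x, s) \<in> rT" for s x
  proof -
    have s: "s \<in> T" using that rTT by auto
    then have "\<exists>!u. u \<in> T \<and> (x, u) \<in> rT \<and> lev u = lev s"
      using uniq[OF XT(1)[OF that(1)]] upX[OF that(1)] levL by simp
    then show ?thesis using p[OF levL[OF s] that(1)] s that(2) by auto
  qed
  have cover: "\<exists>x\<in>X. (x, t) \<in> rT" if "t \<in> T" for t
  proof -
    obtain b where b: "branch L rL T rT lev b" "b (lev t) = t" using pruned \<open>t \<in> T\<close> by (auto simp: pruned_tree_def)
    then have "b m \<in> X" using m(1) by (auto simp: branch_def X_def)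
    moreover have "(b m, t) \<in> rT" using b m levL[OF \<open>t \<in> T\<close>] unfolding branch_def by metis
    ultimately show ?thesis by auto
  qed
  have T: "T = (\<Union>l\<in>L. p l ` X)"
  proof
    show "(\<Union>l\<in>L. p l ` X) \<subseteq> T" using p(1) by auto
    show "T \<subseteq> (\<Union>l\<in>L. p l ` X)"
    proof
      fix t assume t: "t \<in> T"
      then obtain x where "x \<in> X" "(x, t) \<in> rT" using cover by auto
      then show "t \<in> (\<Union>l\<in>L. p l ` X)" using p_eq levL[OF t] by auto
    qed
  qed
  have rTp: "(p l x, p k x) \<in> rT" if lk: "(l, k) \<in> rL" and x: "x \<in> X" for l k x
  proof -
    have L: "l \<in> L" "k \<in> L" using lo(1) lk by auto
    then obtain s where s: "s \<in> T" "(p l x, s) \<in> rT" "lev s = k"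
      using uniq[OF p(1)[OF L(1) x], of k] p(3)[OF L(1) x] lk by (auto simp: upset_def)
    then show ?thesis using p_eq[OF x trans[OF p(2)[OF L(1) x] s(2)]] by simp
  qed
  have rT: "rT = {(p l x, p k x) | l k x. (l, k) \<in> rL \<and> x \<in> X}"
  proof
    show "{(p l x, p k x) | l k x. (l, k) \<in> rL \<and> x \<in> X} \<subseteq> rT" using rTp by auto
    show "rT \<subseteq> {(p l x, p k x) | l k x. (l, k) \<in> rL \<and> x \<in> X}"
    proof (rule subrelI)
      fix t t' assume tt: "(t, t') \<in> rT"
      then have t: "t \<in> T" "t' \<in> T" using rTT by auto
      obtain x where x: "x \<in> X" "(x, t) \<in> rT" using cover[OF t(1)] by auto
      have "(lev t, lev t') \<in> rL" using strict[OF t tt] lo(2)[OF levL[OF t(1)]] by (cases "t = t'") auto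
      moreover have "t = p (lev t) x" "t' = p (lev t') x"
        using p_eq[OF x] p_eq[OF x(1) trans[OF x(2) tt]] by auto
      ultimately show "(t, t') \<in> {(p l x, p k x) | l k x. (l, k) \<in> rL \<and> x \<in> X}" using x(1) by blast
    qed
  qed
  have pm: "p m x = x" if "x \<in> X" for x using p_eq[OF that refl[OF XT(1)[OF that]]] XT(2)[OF that] by simp
  have inj: "inj_on (p m) X" using pm by (metis inj_onI)
  have aut: "tree_automorphisms T rT lev = ladder_perms L X p"
    using p(3) lo(1) by (intro tree_automorphisms_eq_ladder_perms[OF m inj _ T rT]) auto
  have "level_system L rL X p"
  proof
    show "linear_order_on L rL" by fact
    show "countable L" using levT \<open>countable T\<close> by auto
    show "countable X" using \<open>countable T\<close> by (auto simp: X_def intro: countable_subset)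
    obtain t where "t \<in> T" "lev t = m" using levT m(1) by auto
    then show "X \<noteq> {}" by (auto simp: X_def)
    show "p k x = p k y" if lk: "(l, k) \<in> rL" and xy: "x \<in> X" "y \<in> X" "p l x = p l y" for k l x y
    proof -
      have k: "k \<in> L" "l \<in> L" using lo(1) lk by auto
      have "(x, p k y) \<in> rT" using trans[OF p(2)[OF k(2) xy(1)]] rTp[OF lk xy(2)] xy(3) by simp
      from p_eq[OF xy(1) this] show ?thesis using p(3)[OF k(1) xy(2)] by simp
    qed
    show "has_maximum {l \<in> L. p l x \<noteq> p l y} rL" if xy: "x \<in> X" "y \<in> X" "x \<noteq> y" for x y
    proof -
      have "(x, y) \<notin> rT \<and> (y, x) \<notin> rT" using strict XT xy by metis
      then show ?thesis
        using inc[OF XT(1)[OF xy(1)] XT(1)[OF xy(2)]] upX xy(1,2) by (simp add: p_def)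
    qed
    show "\<exists>g\<in>level_perms L X p. g x = y" if xy: "x \<in> X" "y \<in> X" for x y
    proof -
      obtain f where "f \<in> tree_automorphisms T rT lev" "f x = y"
        using hom XT[OF xy(1)] XT[OF xy(2)] unfolding homogeneous_tree_def by metis
      then obtain g where g: "g \<in> level_perms L X p" "f (p m x) = p m (g x)"
        unfolding aut ladder_perms_def using m(1) xy(1) by auto
      have "g x \<in> X" using Bij_apply[OF subsetD[OF level_perms_Bij g(1)] xy(1)] .
      then have "g x = y" using pm g(2) xy(1) \<open>f x = y\<close> by simp
      then show ?thesis using g(1) by auto
    qed
  qed
  moreover have "Aut T rT lev \<cong>\<^sub>t level_group L X p"
    unfolding Aut_def aut
  proof (rule ladder_group_iso(2)[OF _ m(1) inj T])
    show "\<delta> = \<gamma>" if "\<delta> \<in> L" "\<gamma> \<in> L" "x \<in> X" "y \<in> X" "p \<delta> x = p \<gamma> y" for \<delta> \<gamma> x y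
      using p(3)[OF that(1,3)] p(3)[OF that(2,4)] that(5) by simp
  qed
  ultimately show ?thesis by (blast intro: level_realizableI topgroup_iso_trans[OF iso])
qed

text \<open>A node is a class together with its level; the level is part of the node because
  \<open>q\<close> may take the same value on different levels. \<open>k\<close> serves to name
  these pairs in the prescribed type.\<close>

lemma (in bounded_level_system) ex_tree:
  "\<exists>(T :: 't::infinite set) rT lev. L_tree \<Delta> r T rT lev \<and> countable T \<and> homogeneous_tree T rT lev \<and>
     pruned_tree \<Delta> r T rT lev \<and> level_group \<Delta> X q \<cong>\<^sub>t Aut T rT lev"
proof -
  note lo = linear_orderD[OF lin]
  let ?N = "(\<lambda>(\<delta>, x). (\<delta>, q \<delta> x)) ` (\<Delta> \<times> X)"
  have cN: "countable ?N" using countable_levels countable_points by auto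
  obtain k :: "'d \<times> 'c \<Rightarrow> 't" where k: "inj_on k ?N" using ex_inj_on_infinite[OF cN] by auto
  define p where "p \<delta> x = k (\<delta>, q \<delta> x)" for \<delta> x
  have p_eq: "p \<delta> x = p \<gamma> y \<longleftrightarrow> \<delta> = \<gamma> \<and> q \<delta> x = q \<gamma> y" if "\<delta> \<in> \<Delta>" "\<gamma> \<in> \<Delta>" "x \<in> X" "y \<in> X" for \<delta> \<gamma> x y
  proof -
    have "(\<delta>, q \<delta> x) \<in> ?N" "(\<gamma>, q \<gamma> y) \<in> ?N" using that by auto
    then show ?thesis using k unfolding p_def by (simp add: inj_on_eq_iff)
  qed
  define T where "T = (\<Union>\<delta>\<in>\<Delta>. p \<delta> ` X)"
  define rT where "rT = {(p \<delta> x, p \<gamma> x) | \<delta> \<gamma> x. (\<delta>, \<gamma>) \<in> r \<and> x \<in> X}"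
  define lev where "lev t = (SOME \<delta>. \<delta> \<in> \<Delta> \<and> t \<in> p \<delta> ` X)" for t
  have lev: "lev (p \<delta> x) = \<delta>" if "\<delta> \<in> \<Delta>" "x \<in> X" for \<delta> x
    unfolding lev_def using that p_eq by (intro some_equality) auto
  have TE: "\<exists>\<delta> x. \<delta> \<in> \<Delta> \<and> x \<in> X \<and> t = p \<delta> x" if "t \<in> T" for t using that T_def by auto
  have pT: "p \<delta> x \<in> T" if "\<delta> \<in> \<Delta>" "x \<in> X" for \<delta> x using that T_def by auto
  have rT: "(p \<delta> x, p \<gamma> y) \<in> rT \<longleftrightarrow> (\<delta>, \<gamma>) \<in> r \<and> q \<gamma> x = q \<gamma> y"
    if "\<delta> \<in> \<Delta>" "\<gamma> \<in> \<Delta>" "x \<in> X" "y \<in> X" for \<delta> \<gamma> x y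
  proof
    assume "(p \<delta> x, p \<gamma> y) \<in> rT"
    then obtain \<delta>' \<gamma>' z where *: "(\<delta>', \<gamma>') \<in> r" "z \<in> X" "p \<delta> x = p \<delta>' z" "p \<gamma> y = p \<gamma>' z"
      unfolding rT_def by auto
    have "\<delta>' \<in> \<Delta>" "\<gamma>' \<in> \<Delta>" using lo(1)[OF *(1)] by auto
    then have "\<delta>' = \<delta>" "q \<delta> x = q \<delta> z" "\<gamma>' = \<gamma>" "q \<gamma> y = q \<gamma> z"
      using p_eq[of \<delta> \<delta>' x z] p_eq[of \<gamma> \<gamma>' y z] * that by auto
    then show "(\<delta>, \<gamma>) \<in> r \<and> q \<gamma> x = q \<gamma> y"
      using *(1,2) coarser[of \<delta> \<gamma> x z] that by simp
  next
    assume *: "(\<delta>, \<gamma>) \<in> r \<and> q \<gamma> x = q \<gamma> y"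
    then have "p \<gamma> y = p \<gamma> x" using p_eq that by simp
    then show "(p \<delta> x, p \<gamma> y) \<in> rT" unfolding rT_def using * that by auto
  qed
  have ex1: "\<exists>!s. s \<in> T \<and> (p \<delta> x, s) \<in> rT \<and> lev s = \<gamma>" and above: "node_above T rT lev (p \<delta> x) \<gamma> = p \<gamma> x"
    if x: "x \<in> X" and \<delta>\<gamma>: "(\<delta>, \<gamma>) \<in> r" for \<delta> \<gamma> x
  proof -
    have \<Delta>: "\<delta> \<in> \<Delta>" "\<gamma> \<in> \<Delta>" using lo(1)[OF \<delta>\<gamma>] by auto
    have 1: "p \<gamma> x \<in> T \<and> (p \<delta> x, p \<gamma> x) \<in> rT \<and> lev (p \<gamma> x) = \<gamma>"
      using pT lev rT \<Delta> x \<delta>\<gamma> by simp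
    have 2: "s = p \<gamma> x" if s: "s \<in> T \<and> (p \<delta> x, s) \<in> rT \<and> lev s = \<gamma>" for s
    proof -
      obtain \<beta> y where y: "\<beta> \<in> \<Delta>" "y \<in> X" "s = p \<beta> y" using TE[OF conjunct1[OF s]] by auto
      then have "\<beta> = \<gamma>" using lev s by simp
      then show ?thesis using s rT[OF \<Delta> x y(2)] y p_eq[OF \<Delta>(2,2) x y(2)] by simp
    qed
    show "\<exists>!s. s \<in> T \<and> (p \<delta> x, s) \<in> rT \<and> lev s = \<gamma>" using 1 2 by (rule ex1I)
    show "node_above T rT lev (p \<delta> x) \<gamma> = p \<gamma> x"
      unfolding node_above_def using 1 2 by (rule the_equality)
  qed
  have po: "partial_order_on T rT"
    unfolding partial_order_on_def preorder_on_def
  proof (intro conjI)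
    show "rT \<subseteq> T \<times> T" unfolding rT_def using pT lo(1) by auto
    show "refl_on T rT"
    proof (rule refl_onI)
      fix t assume "t \<in> T"
      from TE[OF this] obtain \<delta> x where "\<delta> \<in> \<Delta>" "x \<in> X" "t = p \<delta> x" by auto
      then show "(t, t) \<in> rT" using rT lo(2) by simp
    qed
    show "trans rT"
    proof (rule transI)
      fix s t u assume "(s, t) \<in> rT" and tu: "(t, u) \<in> rT"
      then obtain \<delta> \<gamma> x where x: "(\<delta>, \<gamma>) \<in> r" "x \<in> X" "s = p \<delta> x" "t = p \<gamma> x" unfolding rT_def by auto
      obtain \<gamma>' \<beta> y where y: "(\<gamma>', \<beta>) \<in> r" "y \<in> X" "t = p \<gamma>' y" "u = p \<beta> y" using tu unfolding rT_def by auto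
      have \<Delta>: "\<delta> \<in> \<Delta>" "\<gamma> \<in> \<Delta>" "\<gamma>' \<in> \<Delta>" "\<beta> \<in> \<Delta>" using lo(1) x(1) y(1) by auto
      have *: "\<gamma>' = \<gamma>" "q \<gamma> x = q \<gamma> y" using p_eq[OF \<Delta>(2,3) x(2) y(2)] x(4) y(3) by auto
      have "(\<delta>, \<beta>) \<in> r" using lo(3)[OF x(1)] y(1) *(1) by simp
      moreover have "q \<beta> x = q \<beta> y" using coarser[OF y(1) x(2) y(2)] * by simp
      ultimately show "(s, u) \<in> rT" using rT[OF \<Delta>(1,4) x(2) y(2)] x(3) y(4) by simp
    qed
    show "antisym rT"
    proof (rule antisymI)
      fix s t assume "(s, t) \<in> rT" and ts: "(t, s) \<in> rT"
      then obtain \<delta> \<gamma> x where x: "(\<delta>, \<gamma>) \<in> r" "x \<in> X" "s = p \<delta> x" "t = p \<gamma> x" unfolding rT_def by auto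
      have \<Delta>: "\<delta> \<in> \<Delta>" "\<gamma> \<in> \<Delta>" using lo(1) x(1) by auto
      have "(\<gamma>, \<delta>) \<in> r" using ts x(3,4) rT[OF \<Delta>(2,1) x(2,2)] by simp
      then show "s = t" using lo(4)[OF x(1)] x(3,4) by simp
    qed
  qed
  have tree: "L_tree \<Delta> r T rT lev"
    unfolding L_tree_def
  proof (intro conjI ballI impI)
    show "linear_order_on \<Delta> r" by (rule lin)
    show "partial_order_on T rT" by (rule po)
    show "lev ` T = \<Delta>"
    proof
      show "lev ` T \<subseteq> \<Delta>" using TE lev by fastforce
      obtain x where x: "x \<in> X" using nonempty by auto
      show "\<Delta> \<subseteq> lev ` T"
      proof
        fix \<delta> assume "\<delta> \<in> \<Delta>"
        then show "\<delta> \<in> lev ` T" using lev[OF _ x] pT[OF _ x] by (intro image_eqI[of _ _ "p \<delta> x"]) auto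
      qed
    qed
  next
    fix t t' assume "t \<in> T" "t' \<in> T" and tt: "(t, t') \<in> rT \<and> t \<noteq> t'"
    then obtain \<delta> \<gamma> x where x: "(\<delta>, \<gamma>) \<in> r" "x \<in> X" "t = p \<delta> x" "t' = p \<gamma> x" unfolding rT_def by auto
    have \<Delta>: "\<delta> \<in> \<Delta>" "\<gamma> \<in> \<Delta>" using lo(1) x(1) by auto
    show "(lev t, lev t') \<in> r" "lev t \<noteq> lev t'" using lev[OF \<Delta>(1) x(2)] lev[OF \<Delta>(2) x(2)] x tt by auto
  next
    fix t l assume t: "t \<in> T" and l: "l \<in> upset \<Delta> r (lev t)"
    obtain \<delta> x where x: "\<delta> \<in> \<Delta>" "x \<in> X" "t = p \<delta> x" using TE[OF t] by auto
    then show "\<exists>!s. s \<in> T \<and> (t, s) \<in> rT \<and> lev s = l" using ex1[OF x(2), of \<delta> l] l lev by (simp add: upset_iff)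
  next
    fix t t' assume t: "t \<in> T" and t': "t' \<in> T"
    obtain \<delta> x where x: "\<delta> \<in> \<Delta>" "x \<in> X" "t = p \<delta> x" using TE[OF t] by auto
    obtain \<gamma> y where y: "\<gamma> \<in> \<Delta>" "y \<in> X" "t' = p \<gamma> y" using TE[OF t'] by auto
    show "\<exists>l\<in>upset \<Delta> r (lev t) \<inter> upset \<Delta> r (lev t'). node_above T rT lev t l = node_above T rT lev t' l"
    proof (intro bexI[of _ highest])
      have "node_above T rT lev t highest = p highest x" "node_above T rT lev t' highest = p highest y"
        using above[OF x(2) highest(2)[OF x(1)]] above[OF y(2) highest(2)[OF y(1)]] x(3) y(3) by simp_all
      moreover have "p highest x = p highest y"
        using p_eq[OF highest(1,1) x(2) y(2)] highest(3)[OF x(2) y(2)] by simp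
      ultimately show "node_above T rT lev t highest = node_above T rT lev t' highest" by simp
      show "highest \<in> upset \<Delta> r (lev t) \<inter> upset \<Delta> r (lev t')"
        using highest(1) highest(2)[OF x(1)] highest(2)[OF y(1)] lev[OF x(1,2)] lev[OF y(1,2)] x(3) y(3)
        by (simp add: upset_iff)
    qed
  next
    fix t t' assume t: "t \<in> T" and t': "t' \<in> T" and inc: "(t, t') \<notin> rT \<and> (t', t) \<notin> rT"
    obtain \<delta> x where x: "\<delta> \<in> \<Delta>" "x \<in> X" "t = p \<delta> x" using TE[OF t] by auto
    obtain \<gamma> y where y: "\<gamma> \<in> \<Delta>" "y \<in> X" "t' = p \<gamma> y" using TE[OF t'] by auto
    have 1: "\<not> ((\<delta>, \<gamma>) \<in> r \<and> q \<gamma> x = q \<gamma> y)" and 2: "\<not> ((\<gamma>, \<delta>) \<in> r \<and> q \<delta> y = q \<delta> x)"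
      using inc rT x y by auto
    then have "x \<noteq> y" using lo(5)[OF x(1) y(1)] by auto
    then obtain D where D: "D \<in> \<Delta>" "q D x \<noteq> q D y" "\<And>l. l \<in> \<Delta> \<Longrightarrow> q l x \<noteq> q l y \<Longrightarrow> (l, D) \<in> r"
      using max_split[OF x(2) y(2)] by (auto simp: has_maximum_def)
    \<comment> \<open>Since the nodes are incomparable, \<open>x\<close> and \<open>y\<close> still
      differ on the higher of the levels \<delta> and \<gamma>. So their top separating level
      \<open>D\<close> lies above both nodes and is a candidate for the maximum required of a
      tree.\<close>
    have D': "(\<delta>, D) \<in> r \<and> (\<gamma>, D) \<in> r"
    proof (cases "(\<delta>, \<gamma>) \<in> r")
      case True
      then have "(\<gamma>, D) \<in> r" using 1 D(3) y(1) by simp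
      then show ?thesis using lo(3)[OF True] by simp
    next
      case False
      then have *: "(\<gamma>, \<delta>) \<in> r" using lo(5)[OF x(1) y(1)] by simp
      then have "(\<delta>, D) \<in> r" using 2 D(3)[OF x(1)] by auto
      then show ?thesis using lo(3)[OF *] by simp
    qed
    let ?A = "{l \<in> upset \<Delta> r (lev t) \<inter> upset \<Delta> r (lev t'). node_above T rT lev t l \<noteq> node_above T rT lev t' l}"
    have A: "l \<in> ?A \<longleftrightarrow> l \<in> \<Delta> \<and> (\<delta>, l) \<in> r \<and> (\<gamma>, l) \<in> r \<and> q l x \<noteq> q l y" for l
      using lev[OF x(1,2)] lev[OF y(1,2)] above[OF x(2), of \<delta> l] above[OF y(2), of \<gamma> l]
        p_eq[of l l x y] x y by (auto simp: upset_iff)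
    have DA: "D \<in> ?A" using A[of D] D(1,2) D' by simp
    have "(l, D) \<in> r" if "l \<in> ?A" for l using A[of l] that D(3)[of l] by simp
    then have "\<forall>l\<in>?A. (l, D) \<in> r" by (rule ballI)
    then show "has_maximum ?A r" unfolding has_maximum_def using DA by (rule bexI)
  qed
  have pruned: "pruned_tree \<Delta> r T rT lev"
    unfolding pruned_tree_def
  proof
    fix t assume "t \<in> T"
    from TE[OF this] obtain \<delta> x where x: "\<delta> \<in> \<Delta>" "x \<in> X" "t = p \<delta> x" by auto
    have "branch \<Delta> r T rT lev (\<lambda>l. p l x)"
      unfolding branch_def using pT[OF _ x(2)] lev[OF _ x(2)] rT[OF _ _ x(2,2)] by simp
    then show "\<exists>b. branch \<Delta> r T rT lev b \<and> b (lev t) = t"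
      using x lev by (intro exI[of _ "\<lambda>l. p l x"]) simp
  qed
  have inj: "inj_on (p lowest) X"
  proof (rule inj_onI)
    fix x y assume xy: "x \<in> X" "y \<in> X" "p lowest x = p lowest y"
    then have "q lowest x = q lowest y" using p_eq[OF lowest(1,1) xy(1,2)] by simp
    then show "x = y" using inj_onD[OF lowest(3) _ xy(1,2)] by simp
  qed
  have disj: "\<delta> = \<gamma>" if "\<delta> \<in> \<Delta>" "\<gamma> \<in> \<Delta>" "x \<in> X" "y \<in> X" "p \<delta> x = p \<gamma> y" for \<delta> \<gamma> x y
    using p_eq that by simp
  have aut: "tree_automorphisms T rT lev = ladder_perms \<Delta> X p"
    using lev lo(1) by (intro tree_automorphisms_eq_ladder_perms[OF lowest(1,2) inj _ T_def rT_def]) auto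
  have perms: "level_perms \<Delta> X q = level_perms \<Delta> X p"
    by (rule level_perms_cong) (simp add: p_eq)
  have hom: "homogeneous_tree T rT lev"
    unfolding homogeneous_tree_def
  proof (intro ballI impI)
    fix t t' assume t: "t \<in> T" and t': "t' \<in> T" and eq: "lev t = lev t'"
    obtain \<delta> x where x: "\<delta> \<in> \<Delta>" "x \<in> X" "t = p \<delta> x" using TE[OF t] by auto
    obtain \<gamma> y where y: "\<gamma> \<in> \<Delta>" "y \<in> X" "t' = p \<gamma> y" using TE[OF t'] by auto
    have "\<gamma> = \<delta>" using eq lev x y by simp
    obtain g where g: "g \<in> level_perms \<Delta> X p" "g x = y" using transitive[OF x(2) y(2)] perms by auto
    obtain f where "f \<in> ladder_perms \<Delta> X p" "f (p \<delta> x) = p \<delta> (g x)"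
      using ladder_lift[of \<Delta> X p g] disj g(1) x(1,2) by auto
    then show "\<exists>f\<in>tree_automorphisms T rT lev. f t = t'"
      using x y g(2) \<open>\<gamma> = \<delta>\<close> aut by (intro bexI[of _ f]) auto
  qed
  have "countable T" unfolding T_def using countable_levels countable_points by auto
  moreover have "level_group \<Delta> X q \<cong>\<^sub>t Aut T rT lev"
    unfolding Aut_def aut perms by (rule ladder_group_iso(1)[OF disj lowest(1) inj T_def])
  ultimately show ?thesis using tree pruned hom by auto
qed

section \<open>Local domains and systems of projections\<close>

lemma upset_minimum: "(\<And>\<delta>. \<delta> \<in> \<Delta> \<Longrightarrow> (m, \<delta>) \<in> r) \<Longrightarrow> upset \<Delta> r m = \<Delta>"
  by (auto simp: upset_def)

lemma upset_inj:
  assumes "linear_order_on \<Delta> r" "\<delta> \<in> \<Delta>" "\<gamma> \<in> \<Delta>" "upset \<Delta> r \<delta> = upset \<Delta> r \<gamma>"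
  shows "\<delta> = \<gamma>"
proof -
  note lo = linear_orderD[OF assms(1)]
  have "\<delta> \<in> upset \<Delta> r \<delta>" "\<gamma> \<in> upset \<Delta> r \<gamma>" using lo(2) assms by (auto simp: upset_iff)
  then have "(\<gamma>, \<delta>) \<in> r" "(\<delta>, \<gamma>) \<in> r" using assms(4) by (auto simp: upset_iff)
  then show ?thesis using lo(4) by blast
qed

lemma local_part_subset: "z \<in> local_part \<Delta> r N SS \<delta> \<Longrightarrow> z \<in> SS"
  by (simp add: local_part_def)

lemma dom_local_part: "z \<in> local_part \<Delta> r N SS \<delta> \<Longrightarrow> dom z = upset \<Delta> r \<delta>"
  by (simp add: local_part_def skel_prod_def)

lemma local_part_disjoint:
  assumes "linear_order_on \<Delta> r" "\<delta> \<in> \<Delta>" "\<gamma> \<in> \<Delta>" "z \<in> local_part \<Delta> r N SS \<delta>" "z \<in> local_part \<Delta> r N SS \<gamma>"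
  shows "\<delta> = \<gamma>"
  using upset_inj[OF assms(1-3)] dom_local_part[OF assms(4)] dom_local_part[OF assms(5)] by simp

text \<open>The parts of different levels are disjoint because their elements have different
  domains. Projections from the lowest part are onto and compose, so the system is a ladder over
  that part; and \<open>pr m m\<close>, being idempotent and onto, is the identity there.\<close>

lemma wreath_proj_eq_ladder_perms:
  assumes lin: "linear_order_on \<Delta> r" and m: "m \<in> \<Delta>" "\<forall>\<delta>\<in>\<Delta>. (m, \<delta>) \<in> r"
    and ps: "projection_system \<Delta> r N SS pr"
  defines "X \<equiv> local_part \<Delta> r N SS m"
  shows "wreath_proj \<Delta> r N SS pr = ladder_perms \<Delta> X (pr m)"
    and "SS = (\<Union>\<delta>\<in>\<Delta>. pr m \<delta> ` X)"
    and "\<And>x. x \<in> X \<Longrightarrow> pr m m x = x"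
    and "\<And>\<delta> \<gamma> x y. \<delta> \<in> \<Delta> \<Longrightarrow> \<gamma> \<in> \<Delta> \<Longrightarrow> x \<in> X \<Longrightarrow> y \<in> X \<Longrightarrow> pr m \<delta> x = pr m \<gamma> y \<Longrightarrow> \<delta> = \<gamma>"
    and "\<And>\<delta> x y. \<delta> \<in> \<Delta> \<Longrightarrow> x \<in> X \<Longrightarrow> y \<in> X \<Longrightarrow>
           pr m \<delta> x = pr m \<delta> y \<longleftrightarrow> x |` upset \<Delta> r \<delta> = y |` upset \<Delta> r \<delta>"
proof -
  note lo = linear_orderD[OF lin]
  let ?S = "local_part \<Delta> r N SS"
  have up: "upset \<Delta> r m = \<Delta>" using m(2) by (intro upset_minimum) blast
  have SS0: "SS \<subseteq> (\<Union>\<delta>\<in>\<Delta>. skel_prod N (upset \<Delta> r \<delta>))"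
    and im: "\<And>\<delta> \<gamma>. \<delta> \<in> \<Delta> \<Longrightarrow> \<gamma> \<in> upset \<Delta> r \<delta> \<Longrightarrow> pr \<delta> \<gamma> ` ?S \<delta> = ?S \<gamma>"
    and eq: "\<And>\<delta> \<gamma> z z'. \<delta> \<in> \<Delta> \<Longrightarrow> \<gamma> \<in> upset \<Delta> r \<delta> \<Longrightarrow> z \<in> ?S \<delta> \<Longrightarrow> z' \<in> ?S \<delta> \<Longrightarrow>
        pr \<delta> \<gamma> z = pr \<delta> \<gamma> z' \<longleftrightarrow> z |` upset \<Delta> r \<gamma> = z' |` upset \<Delta> r \<gamma>"
    and comp: "\<And>\<delta> \<gamma> \<beta> z. \<delta> \<in> \<Delta> \<Longrightarrow> \<gamma> \<in> upset \<Delta> r \<delta> \<Longrightarrow> \<beta> \<in> upset \<Delta> r \<gamma> \<Longrightarrow> z \<in> ?S \<delta> \<Longrightarrow>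
        pr \<gamma> \<beta> (pr \<delta> \<gamma> z) = pr \<delta> \<beta> z"
    using ps unfolding projection_system_def local_family_def by simp_all
  have imX: "pr m \<delta> ` X = ?S \<delta>" if "\<delta> \<in> \<Delta>" for \<delta> using im[OF m(1)] that up by (simp add: X_def)
  have SS_cover: "\<exists>\<delta>\<in>\<Delta>. z \<in> ?S \<delta>" if "z \<in> SS" for z
    using SS0 that unfolding local_part_def by blast
  show SS: "SS = (\<Union>\<delta>\<in>\<Delta>. pr m \<delta> ` X)"
  proof
    show "SS \<subseteq> (\<Union>\<delta>\<in>\<Delta>. pr m \<delta> ` X)"
    proof
      fix z assume "z \<in> SS"
      then obtain \<delta> where \<delta>: "\<delta> \<in> \<Delta>" "z \<in> ?S \<delta>" using SS_cover by meson
      then have "z \<in> pr m \<delta> ` X" by (subst imX)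
      then show "z \<in> (\<Union>\<delta>\<in>\<Delta>. pr m \<delta> ` X)" using \<delta>(1) by (rule UN_I[rotated])
    qed
    show "(\<Union>\<delta>\<in>\<Delta>. pr m \<delta> ` X) \<subseteq> SS"
      by (intro UN_least) (simp add: imX local_part_def)
  qed
  show id: "pr m m x = x" if "x \<in> X" for x
  proof -
    have "x \<in> pr m m ` X" using imX[OF m(1)] \<open>x \<in> X\<close> unfolding X_def by simp
    then obtain y where y: "y \<in> X" "pr m m y = x" by auto
    then show ?thesis using comp[OF m(1), of m m y] m(1) up by (simp add: X_def)
  qed
  have prS: "pr m \<delta> x \<in> ?S \<delta>" if "\<delta> \<in> \<Delta>" "x \<in> X" for \<delta> x using imX[OF that(1)] that(2) by auto
  show disj: "\<delta> = \<gamma>" if "\<delta> \<in> \<Delta>" "\<gamma> \<in> \<Delta>" "x \<in> X" "y \<in> X" "pr m \<delta> x = pr m \<gamma> y" for \<delta> \<gamma> x y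
    using local_part_disjoint[OF lin that(1,2) prS[OF that(1,3)]] prS[OF that(2,4)] that(5) by simp
  show "pr m \<delta> x = pr m \<delta> y \<longleftrightarrow> x |` upset \<Delta> r \<delta> = y |` upset \<Delta> r \<delta>"
    if "\<delta> \<in> \<Delta>" "x \<in> X" "y \<in> X" for \<delta> x y
    using eq[OF m(1)] that up by (simp add: X_def)
  have SSpr: "pr m \<delta> x \<in> SS" if "\<delta> \<in> \<Delta>" "x \<in> X" for \<delta> x using local_part_subset[OF prS[OF that]] .
  show "wreath_proj \<Delta> r N SS pr = ladder_perms \<Delta> X (pr m)"
  proof
    show "wreath_proj \<Delta> r N SS pr \<subseteq> ladder_perms \<Delta> X (pr m)"
    proof
      fix f assume "f \<in> wreath_proj \<Delta> r N SS pr"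
      then have fB: "f \<in> Bij SS" and fS: "\<And>\<delta>. \<delta> \<in> \<Delta> \<Longrightarrow> f ` ?S \<delta> = ?S \<delta>"
        and fpr: "\<And>\<delta> \<gamma> z. \<delta> \<in> \<Delta> \<Longrightarrow> \<gamma> \<in> upset \<Delta> r \<delta> \<Longrightarrow> z \<in> ?S \<delta> \<Longrightarrow> f (pr \<delta> \<gamma> z) = pr \<delta> \<gamma> (f z)"
        unfolding wreath_proj_def by simp_all
      define g where "g = restrict f X"
      have fX: "f ` X = X" using fS[OF m(1)] by (simp add: X_def)
      have XSS: "x \<in> SS" if "x \<in> X" for x using that by (simp add: X_def local_part_def)
      have gB: "g \<in> Bij X"
      proof (rule BijI)
        show "inj_on g X" using Bij_inj[OF fB] XSS by (auto simp: g_def inj_on_def)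
        show "\<exists>x\<in>X. g x = y" if "y \<in> X" for y
        proof -
          have "y \<in> f ` X" using fX that by simp
          then show ?thesis by (auto simp: g_def)
        qed
      qed (use fX in \<open>auto simp: g_def\<close>)
      have fp: "f (pr m \<delta> x) = pr m \<delta> (g x)" if "\<delta> \<in> \<Delta>" "x \<in> X" for \<delta> x
        using fpr[OF m(1), of \<delta> x] that up by (simp add: g_def X_def)
      have "pr m \<delta> x = pr m \<delta> y \<longleftrightarrow> pr m \<delta> (g x) = pr m \<delta> (g y)" if "\<delta> \<in> \<Delta>" "x \<in> X" "y \<in> X" for \<delta> x y
        using fp[OF that(1,2)] fp[OF that(1,3)] Bij_inj[OF fB SSpr[OF that(1,2)] SSpr[OF that(1,3)]] by simp
      then have "g \<in> level_perms \<Delta> X (pr m)" using gB by (simp add: level_perms_def)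
      then show "f \<in> ladder_perms \<Delta> X (pr m)"
        unfolding ladder_perms_def SS[symmetric] using fB fp by (intro CollectI conjI bexI[of _ g]) auto
    qed
    show "ladder_perms \<Delta> X (pr m) \<subseteq> wreath_proj \<Delta> r N SS pr"
    proof
      fix f assume "f \<in> ladder_perms \<Delta> X (pr m)"
      then obtain g where fB: "f \<in> Bij SS" and g: "g \<in> level_perms \<Delta> X (pr m)"
        and fp: "\<And>\<delta> x. \<delta> \<in> \<Delta> \<Longrightarrow> x \<in> X \<Longrightarrow> f (pr m \<delta> x) = pr m \<delta> (g x)"
        unfolding ladder_perms_def SS[symmetric] by auto
      have gB: "g \<in> Bij X" using g level_perms_Bij by blast
      have gX: "g ` X = X" using gB by (simp add: Bij_def bij_betw_def)
      have "f ` ?S \<delta> = ?S \<delta>" if "\<delta> \<in> \<Delta>" for \<delta>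
      proof -
        have "f ` ?S \<delta> = pr m \<delta> ` g ` X"
          unfolding imX[OF that, symmetric] image_image using fp[OF that] by (rule image_cong[OF refl])
        then show ?thesis using gX imX[OF that] by simp
      qed
      moreover have "f (pr \<delta> \<gamma> z) = pr \<delta> \<gamma> (f z)" if \<delta>\<gamma>: "\<delta> \<in> \<Delta>" "\<gamma> \<in> upset \<Delta> r \<delta>" and z: "z \<in> ?S \<delta>" for \<delta> \<gamma> z
      proof -
        have \<gamma>: "\<gamma> \<in> \<Delta>" using \<delta>\<gamma>(2) by (simp add: upset_iff)
        obtain x where x: "x \<in> X" "z = pr m \<delta> x" using imX[OF \<delta>\<gamma>(1)] z by auto
        have c: "pr \<delta> \<gamma> (pr m \<delta> y) = pr m \<gamma> y" if "y \<in> X" for y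
          using comp[OF m(1) _ \<delta>\<gamma>(2)] \<delta>\<gamma>(1) up that by (simp add: X_def)
        show ?thesis using fp[OF \<delta>\<gamma>(1) x(1)] fp[OF \<gamma> x(1)] x c[OF x(1)] c[OF Bij_apply[OF gB x(1)]] by simp
      qed
      ultimately show "f \<in> wreath_proj \<Delta> r N SS pr" unfolding wreath_proj_def using fB by simp
    qed
  qed
qed

text \<open>Projections and restrictions have the same kernels, so the group depends only on the
  lowest part with its restrictions.\<close>

lemma level_realizable_Wr_proj:
  assumes sk: "countable_linear_skeleton \<Delta> r N" and min: "has_minimum \<Delta> r"
    and ps: "projection_system \<Delta> r N SS pr" and c: "countable SS"
    and hom: "locally_homogeneous_proj \<Delta> r N SS pr" and Max: "SS \<subseteq> local_Max \<Delta> r N"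
    and iso: "\<G> \<cong>\<^sub>t Wr_proj \<Delta> r N SS pr"
  shows "level_realizable \<G>"
proof -
  obtain m where m: "m \<in> \<Delta>" "\<forall>\<delta>\<in>\<Delta>. (m, \<delta>) \<in> r" using min by (auto simp: has_minimum_def)
  have lin: "linear_order_on \<Delta> r" and c\<Delta>: "countable \<Delta>"
    using sk by (auto simp: countable_linear_skeleton_def countable_skeleton_def)
  define X where "X = local_part \<Delta> r N SS m"
  note wp = wreath_proj_eq_ladder_perms[OF lin m ps, folded X_def]
  have inj: "inj_on (pr m m) X" using wp(3) by (metis inj_onI)
  have perms: "level_perms \<Delta> X (pr m) = level_perms \<Delta> X (\<lambda>\<delta> x. x |` upset \<Delta> r \<delta>)"
    by (rule level_perms_cong) (rule wp(5))
  have up: "upset \<Delta> r m = \<Delta>" using m(2) by (intro upset_minimum) blast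
  have "level_system \<Delta> r X (\<lambda>\<delta> x. x |` upset \<Delta> r \<delta>)"
  proof (rule level_system_restrict[OF lin c\<Delta>])
    show "countable X" using c by (simp add: X_def local_part_def)
    show "X \<noteq> {}" using ps m(1) by (simp add: X_def projection_system_def local_family_def)
    show "X \<subseteq> supp_domain \<Delta> N (Max_sets \<Delta> r)"
    proof
      fix z assume z: "z \<in> X"
      then have "z \<in> local_Max \<Delta> r N" using Max by (auto simp: X_def local_part_def)
      then obtain x \<delta> where x: "\<delta> \<in> \<Delta>" "x \<in> supp_domain \<Delta> N (Max_sets \<Delta> r)" "z = x |` upset \<Delta> r \<delta>"
        by (auto simp: local_Max_def)
      have dx: "dom x = \<Delta>" using x(2) by (simp add: supp_domain_def skel_prod_def)
      \<comment> \<open>An element of the lowest part has full domain, so the restriction that puts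
        it into \<open>local_Max\<close> restricts nothing, and the condition on supports applies to
        \<open>z\<close> itself.\<close>
      have "dom z = \<Delta>" using dom_local_part[OF z[unfolded X_def]] up by simp
      then have "\<Delta> \<subseteq> upset \<Delta> r \<delta>" unfolding x(3) by auto
      then have "z \<gamma> = x \<gamma>" for \<gamma>
        using dx unfolding x(3) by (cases "\<gamma> \<in> \<Delta>") (auto simp: restrict_map_def domIff)
      then have "z = x" by (rule ext)
      then show "z \<in> supp_domain \<Delta> N (Max_sets \<Delta> r)" using x(2) by simp
    qed
    show "\<exists>g\<in>level_perms \<Delta> X (\<lambda>\<delta> x. x |` upset \<Delta> r \<delta>). g x = y" if xy: "x \<in> X" "y \<in> X" for x y
    proof -
      have "\<forall>x\<in>X. \<forall>y\<in>X. \<exists>f\<in>wreath_proj \<Delta> r N SS pr. f x = y"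
        using hom m(1) unfolding locally_homogeneous_proj_def X_def by (rule bspec)
      then obtain f where f: "f \<in> ladder_perms \<Delta> X (pr m)" "f x = y"
        using xy unfolding wp(1) by meson
      then obtain g where g: "g \<in> level_perms \<Delta> X (pr m)" "f (pr m m x) = pr m m (g x)"
        unfolding ladder_perms_def using m(1) xy(1) by auto
      have "g x \<in> X" using Bij_apply[OF subsetD[OF level_perms_Bij g(1)] xy(1)] .
      then have "g x = y" using g(2) f(2) wp(3) xy(1) by simp
      then show ?thesis using g(1) perms by auto
    qed
  qed
  moreover have "Wr_proj \<Delta> r N SS pr \<cong>\<^sub>t level_group \<Delta> X (\<lambda>\<delta> x. x |` upset \<Delta> r \<delta>)"
    unfolding Wr_proj_def wp(1) perms[symmetric] by (rule ladder_group_iso(2)[OF wp(4) m(1) inj wp(2)])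
  ultimately show ?thesis by (blast intro: level_realizableI topgroup_iso_trans[OF iso])
qed

text \<open>Local domains are treated as systems whose projections are the restrictions; their
  source level is irrelevant, hence the ignored argument.\<close>

lemma wreath_local_eq_wreath_proj:
  "wreath_local \<Delta> r N SS = wreath_proj \<Delta> r N SS (\<lambda>_ \<gamma> z. z |` upset \<Delta> r \<gamma>)"
  by (simp add: wreath_local_def wreath_proj_def)

lemma Wr_local_eq_Wr_proj:
  "Wr_local \<Delta> r N SS = Wr_proj \<Delta> r N SS (\<lambda>_ \<gamma> z. z |` upset \<Delta> r \<gamma>)"
  by (simp add: Wr_local_def Wr_proj_def wreath_local_eq_wreath_proj)

lemma locally_homogeneous_eq_proj:
  "locally_homogeneous \<Delta> r N SS = locally_homogeneous_proj \<Delta> r N SS (\<lambda>_ \<gamma> z. z |` upset \<Delta> r \<gamma>)"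
  by (simp add: locally_homogeneous_def locally_homogeneous_proj_def wreath_local_eq_wreath_proj)

lemma upset_mono:
  assumes "linear_order_on \<Delta> r" "\<gamma> \<in> upset \<Delta> r \<delta>"
  shows "upset \<Delta> r \<gamma> \<subseteq> upset \<Delta> r \<delta>"
  using assms(2) linear_orderD(3)[OF assms(1)] by (auto simp: upset_iff)

lemma restrict_upset_restrict:
  assumes "linear_order_on \<Delta> r" "\<gamma> \<in> upset \<Delta> r \<delta>"
  shows "x |` upset \<Delta> r \<delta> |` upset \<Delta> r \<gamma> = x |` upset \<Delta> r \<gamma>"
  using upset_mono[OF assms] by (simp add: inf.absorb2)

lemma projection_system_restrict:
  assumes lin: "linear_order_on \<Delta> r" and "local_domains \<Delta> r N SS"
  shows "projection_system \<Delta> r N SS (\<lambda>_ \<gamma> z. z |` upset \<Delta> r \<gamma>)"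
  using assms(2) upset_mono[OF lin]
  unfolding local_domains_def projection_system_def by (simp add: inf.absorb2)

section \<open>Local domains of finite support\<close>

definition local_family_of :: "'d set \<Rightarrow> 'd rel \<Rightarrow> ('d \<rightharpoonup> nat) set \<Rightarrow> ('d \<rightharpoonup> nat) set" where
  "local_family_of \<Delta> r S = (\<Union>\<delta>\<in>\<Delta>. (\<lambda>x. x |` upset \<Delta> r \<delta>) ` S)"

lemma fun_upd_Fin_supp:
  assumes "x \<in> supp_domain \<Delta> N (Fin \<Delta> r)" "\<delta> \<in> \<Delta>" "i \<in> below (N \<delta>)"
  shows "x(\<delta> \<mapsto> i) \<in> supp_domain \<Delta> N (Fin \<Delta> r)"
proof -
  have "supp (x(\<delta> \<mapsto> i)) \<subseteq> insert \<delta> (supp x)" by (auto simp: supp_def)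
  then show ?thesis using assms
    by (auto simp: supp_domain_def Fin_def skel_prod_def intro: finite_subset)
qed

text \<open>The domain of a restriction reveals its level, as different levels have different upper
  sets.\<close>

lemma local_part_local_family_of:
  assumes lin: "linear_order_on \<Delta> r" and S: "S \<subseteq> skel_prod N \<Delta>" and \<delta>: "\<delta> \<in> \<Delta>"
  shows "local_part \<Delta> r N (local_family_of \<Delta> r S) \<delta> = (\<lambda>x. x |` upset \<Delta> r \<delta>) ` S"
proof
  have domr: "dom (x |` upset \<Delta> r \<gamma>) = upset \<Delta> r \<gamma>" if "x \<in> S" for x \<gamma>
  proof -
    have "dom x = \<Delta>" using S that by (auto simp: skel_prod_def)
    then show ?thesis by (auto simp: upset_def)
  qed
  show "local_part \<Delta> r N (local_family_of \<Delta> r S) \<delta> \<subseteq> (\<lambda>x. x |` upset \<Delta> r \<delta>) ` S"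
  proof
    fix z assume z: "z \<in> local_part \<Delta> r N (local_family_of \<Delta> r S) \<delta>"
    then obtain x \<gamma> where x: "\<gamma> \<in> \<Delta>" "x \<in> S" "z = x |` upset \<Delta> r \<gamma>"
      unfolding local_part_def local_family_of_def by auto
    then have "\<gamma> = \<delta>" using dom_local_part[OF z] domr[OF x(2)] upset_inj[OF lin x(1) \<delta>] by simp
    then show "z \<in> (\<lambda>x. x |` upset \<Delta> r \<delta>) ` S" using x by simp
  qed
  show "(\<lambda>x. x |` upset \<Delta> r \<delta>) ` S \<subseteq> local_part \<Delta> r N (local_family_of \<Delta> r S) \<delta>"
  proof
    fix z assume "z \<in> (\<lambda>x. x |` upset \<Delta> r \<delta>) ` S"
    then obtain x where x: "x \<in> S" "z = x |` upset \<Delta> r \<delta>" by auto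
    have "z \<in> skel_prod N (upset \<Delta> r \<delta>)"
      using domr[OF x(1)] S x by (auto simp: skel_prod_def upset_iff)
    then show "z \<in> local_part \<Delta> r N (local_family_of \<Delta> r S) \<delta>"
      using x \<delta> by (auto simp: local_part_def local_family_of_def)
  qed
qed

lemma local_domains_local_family_of:
  assumes sk: "countable_linear_skeleton \<Delta> r N"
  shows "local_domains \<Delta> r N (local_family_of \<Delta> r (supp_domain \<Delta> N (Fin \<Delta> r)))"
proof -
  let ?S = "supp_domain \<Delta> N (Fin \<Delta> r)"
  have lin: "linear_order_on \<Delta> r" and N: "\<And>\<delta>. \<delta> \<in> \<Delta> \<Longrightarrow> N \<delta> \<noteq> 0"
    using sk by (auto simp: countable_linear_skeleton_def countable_skeleton_def)
  have S: "?S \<subseteq> skel_prod N \<Delta>" by (auto simp: supp_domain_def)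
  note lp = local_part_local_family_of[OF lin S]
  show ?thesis
    unfolding local_domains_def local_family_def
  proof (intro conjI ballI)
    show "local_family_of \<Delta> r ?S \<subseteq> (\<Union>\<delta>\<in>\<Delta>. skel_prod N (upset \<Delta> r \<delta>))"
    proof
      fix z assume "z \<in> local_family_of \<Delta> r ?S"
      then obtain \<delta> where "\<delta> \<in> \<Delta>" "z \<in> local_part \<Delta> r N (local_family_of \<Delta> r ?S) \<delta>"
        using lp by (auto simp: local_family_of_def)
      then show "z \<in> (\<Union>\<delta>\<in>\<Delta>. skel_prod N (upset \<Delta> r \<delta>))" by (auto simp: local_part_def)
    qed
    show "local_part \<Delta> r N (local_family_of \<Delta> r ?S) \<delta> \<noteq> {}" if "\<delta> \<in> \<Delta>" for \<delta>
      using lp[OF that] supp_domain_Fin_nonempty[OF N] by simp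
    fix \<delta> assume \<delta>: "\<delta> \<in> \<Delta>"
    have \<delta>up: "\<delta> \<in> upset \<Delta> r \<delta>" using \<delta> linear_orderD(2)[OF lin] by (simp add: upset_iff)
    show "z(\<delta> \<mapsto> i) \<in> local_part \<Delta> r N (local_family_of \<Delta> r ?S) \<delta>"
      if z: "z \<in> local_part \<Delta> r N (local_family_of \<Delta> r ?S) \<delta>" and i: "i \<in> below (N \<delta>)" for z i
    proof -
      obtain x where x: "x \<in> ?S" "z = x |` upset \<Delta> r \<delta>" using lp[OF \<delta>] z by auto
      have "z(\<delta> \<mapsto> i) = (x(\<delta> \<mapsto> i)) |` upset \<Delta> r \<delta>"
        using \<delta>up unfolding x(2) by (auto simp: restrict_map_def fun_eq_iff)
      then show ?thesis unfolding lp[OF \<delta>] using fun_upd_Fin_supp[OF x(1) \<delta> i] by (rule image_eqI)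
    qed
    fix \<gamma> assume \<gamma>: "\<gamma> \<in> upset \<Delta> r \<delta>"
    have "\<gamma> \<in> \<Delta>" using \<gamma> by (simp add: upset_iff)
    show "local_part \<Delta> r N (local_family_of \<Delta> r ?S) \<gamma> =
      (\<lambda>z. z |` upset \<Delta> r \<gamma>) ` local_part \<Delta> r N (local_family_of \<Delta> r ?S) \<delta>"
      unfolding lp[OF \<delta>] lp[OF \<open>\<gamma> \<in> \<Delta>\<close>] image_image restrict_upset_restrict[OF lin \<gamma>] ..
  qed
qed

text \<open>The lowest part is the set of functions of finite support itself. Homogeneity on any
  level follows by extending two local functions to that part, exchanging the extensions there and
  lifting the permutation.\<close>

lemma local_family_of_props:
  assumes sk: "countable_linear_skeleton \<Delta> r N" and min: "has_minimum \<Delta> r"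
  defines "SS \<equiv> local_family_of \<Delta> r (supp_domain \<Delta> N (Fin \<Delta> r))"
  shows "countable SS" and "SS \<subseteq> local_Max \<Delta> r N" and "locally_homogeneous \<Delta> r N SS"
    and "Wr_Fin_star \<Delta> r N \<cong>\<^sub>t Wr_local \<Delta> r N SS"
proof -
  let ?S = "supp_domain \<Delta> N (Fin \<Delta> r)" and ?p = "\<lambda>\<delta> x. x |` upset \<Delta> r \<delta>"
  have lin: "linear_order_on \<Delta> r" and c: "countable \<Delta>"
    using sk by (auto simp: countable_linear_skeleton_def countable_skeleton_def)
  obtain m where m: "m \<in> \<Delta>" "\<forall>\<delta>\<in>\<Delta>. (m, \<delta>) \<in> r" using min by (auto simp: has_minimum_def)
  have up: "upset \<Delta> r m = \<Delta>" using m(2) by (intro upset_minimum) blast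
  have S: "?S \<subseteq> skel_prod N \<Delta>" by (auto simp: supp_domain_def)
  show "countable SS"
    unfolding SS_def local_family_of_def using c countable_supp_domain_Fin[OF c] by auto
  show "SS \<subseteq> local_Max \<Delta> r N"
    unfolding SS_def local_family_of_def local_Max_def
    using supp_domain_mono[OF Fin_subset_Max_sets[OF lin]] by blast
  have "x |` \<Delta> = x" if "x \<in> ?S" for x
  proof
    fix a
    have "dom x = \<Delta>" using that by (simp add: supp_domain_def skel_prod_def)
    then show "(x |` \<Delta>) a = x a" by (cases "a \<in> \<Delta>") (auto simp: restrict_map_def)
  qed
  then have "(\<lambda>x. x |` upset \<Delta> r m) ` ?S = ?S" by (simp add: up)
  then have bottom: "local_part \<Delta> r N SS m = ?S"
    using local_part_local_family_of[OF lin S m(1)] by (simp add: SS_def)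
  note wp = wreath_proj_eq_ladder_perms[OF lin m
      projection_system_restrict[OF lin local_domains_local_family_of[OF sk]], folded SS_def,
      unfolded bottom]
  have wl: "wreath_local \<Delta> r N SS = ladder_perms \<Delta> ?S ?p"
    using wp(1) by (simp add: wreath_local_eq_wreath_proj)
  have inj: "inj_on (?p m) ?S" using wp(3) by (metis inj_onI)
  show "locally_homogeneous \<Delta> r N SS"
    unfolding locally_homogeneous_def wl
  proof (intro ballI)
    fix \<delta> z z' assume \<delta>: "\<delta> \<in> \<Delta>" and z: "z \<in> local_part \<Delta> r N SS \<delta>" "z' \<in> local_part \<Delta> r N SS \<delta>"
    obtain x y where x: "x \<in> ?S" "z = ?p \<delta> x" and y: "y \<in> ?S" "z' = ?p \<delta> y"
      using z local_part_local_family_of[OF lin S \<delta>] unfolding SS_def by auto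
    obtain g where g: "g \<in> level_perms \<Delta> ?S ?p" "g x = y" using wreath_Fin_transitive[OF x(1) y(1)] by auto
    have "\<exists>f\<in>ladder_perms \<Delta> ?S ?p. \<forall>\<delta>\<in>\<Delta>. \<forall>x\<in>?S. f (?p \<delta> x) = ?p \<delta> (g x)"
      by (rule ladder_lift[OF _ g(1)]) (rule wp(4))
    then obtain f where "f \<in> ladder_perms \<Delta> ?S ?p" "\<forall>\<delta>\<in>\<Delta>. \<forall>x\<in>?S. f (?p \<delta> x) = ?p \<delta> (g x)"
      by auto
    then show "\<exists>f\<in>ladder_perms \<Delta> ?S ?p. f z = z'" using x y g(2) \<delta> by (intro bexI[of _ f]) auto
  qed
  show "Wr_Fin_star \<Delta> r N \<cong>\<^sub>t Wr_local \<Delta> r N SS"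
    unfolding Wr_Fin_star_eq_level_group Wr_local_def wl
    by (rule ladder_group_iso(1)[OF wp(4) m(1) inj wp(2)])
qed

lemma closedin_tau:
  assumes "has_minimum \<Delta> r" "S \<subseteq> skel_prod N \<Delta>"
  shows "closedin (tau \<Delta> r N) S"
proof -
  obtain m where m: "m \<in> \<Delta>" "\<And>\<delta>. \<delta> \<in> \<Delta> \<Longrightarrow> (m, \<delta>) \<in> r" using assms(1) by (auto simp: has_minimum_def)
  have "topspace (tau \<Delta> r N) = skel_prod N \<Delta>"
    unfolding tau_def topology_generated_by_topspace using m(1) by blast
  then have "tau \<Delta> r N = discrete_topology (skel_prod N \<Delta>)"
    using subtopology_tau_eq_discrete[OF m order_refl, where N = N] by (metis subtopology_topspace)
  then show ?thesis using assms(2) by simp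
qed

text \<open>Finite supports provide the domain wanted for a given skeleton. With a minimum the
  topology is discrete, so closedness is immediate and separability is countability.\<close>

lemma Fin_domain_props:
  assumes sk: "countable_linear_skeleton \<Delta> r N" and min: "has_minimum \<Delta> r"
  defines "S \<equiv> supp_domain \<Delta> N (Fin \<Delta> r)"
  shows "is_domain \<Delta> r N S" and "approx_homogeneous \<Delta> r S" and "closedin (tau \<Delta> r N) S"
    and "separable_space (subtopology (tau \<Delta> r N) S)" and "S \<subseteq> supp_domain \<Delta> N (Max_sets \<Delta> r)"
    and "Wr_Fin_star \<Delta> r N = Wr \<Delta> r N S"
proof -
  have lin: "linear_order_on \<Delta> r" and c: "countable \<Delta>"
    using sk by (auto simp: countable_linear_skeleton_def countable_skeleton_def)
  obtain m where m: "m \<in> \<Delta>" "\<And>\<delta>. \<delta> \<in> \<Delta> \<Longrightarrow> (m, \<delta>) \<in> r" using min by (auto simp: has_minimum_def)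
  have S: "S \<subseteq> skel_prod N \<Delta>" by (auto simp: S_def supp_domain_def)
  show "is_domain \<Delta> r N S"
    unfolding is_domain_def
  proof (intro conjI ballI)
    fix x \<delta> i assume x: "x \<in> S" and \<delta>: "\<delta> \<in> \<Delta>" and i: "i \<in> below (N \<delta>)"
    have "\<delta> \<notin> upset \<Delta> r \<gamma>" if "\<gamma> \<in> upset \<Delta> r \<delta> - {\<delta>}" for \<gamma>
      using that linear_orderD(4)[OF lin] by (auto simp: upset_iff)
    then have "\<forall>\<gamma>\<in>upset \<Delta> r \<delta> - {\<delta>}. x(\<delta> \<mapsto> i) |` upset \<Delta> r \<gamma> = x |` upset \<Delta> r \<gamma>"
      by simp
    then show "\<exists>y\<in>S. y \<delta> = Some i \<and> (\<forall>\<gamma>\<in>upset \<Delta> r \<delta> - {\<delta>}. y |` upset \<Delta> r \<gamma> = x |` upset \<Delta> r \<gamma>)"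
      using fun_upd_Fin_supp[OF x[unfolded S_def] \<delta> i] by (intro bexI[of _ "x(\<delta> \<mapsto> i)"]) (auto simp: S_def)
  qed (rule S)
  show "approx_homogeneous \<Delta> r S"
    unfolding approx_homogeneous_def wreath_eq_level_perms S_def
  proof (intro ballI)
    fix x y \<delta> assume "x \<in> supp_domain \<Delta> N (Fin \<Delta> r)" "y \<in> supp_domain \<Delta> N (Fin \<Delta> r)"
    from wreath_Fin_transitive[OF this]
    show "\<exists>g\<in>level_perms \<Delta> (supp_domain \<Delta> N (Fin \<Delta> r)) (\<lambda>\<delta> x. x |` upset \<Delta> r \<delta>).
        g x |` upset \<Delta> r \<delta> = y |` upset \<Delta> r \<delta>" by auto
  qed
  show "closedin (tau \<Delta> r N) S" by (rule closedin_tau[OF min S])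
  show "separable_space (subtopology (tau \<Delta> r N) S)"
    using subtopology_tau_eq_discrete[OF m S] countable_supp_domain_Fin[OF c, of N r]
    by (simp add: separable_space_discrete_topology S_def)
  show "S \<subseteq> supp_domain \<Delta> N (Max_sets \<Delta> r)"
    unfolding S_def by (rule supp_domain_mono[OF Fin_subset_Max_sets[OF lin]])
  show "Wr_Fin_star \<Delta> r N = Wr \<Delta> r N S"
    using Wr_eq_level_group[OF m S] by (simp add: Wr_Fin_star_eq_level_group S_def)
qed

section \<open>The equivalences\<close>

lemma all_equivalentI: "list_all (\<lambda>P. P \<longleftrightarrow> Q) Ps \<Longrightarrow> all_equivalent Ps"
  by (auto simp: all_equivalent_def list_all_iff)

lemma ex_ultrametric_Iso:
  assumes "level_realizable \<G>"
  shows "\<exists>U :: ('u::infinite) metric.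
    polish_ultrametric U \<and> homogeneous_metric U \<and> uniformly_discrete_metric_space U \<and> \<G> \<cong>\<^sub>t Iso U"
proof -
  obtain \<Delta> :: "nat set" and r and X :: "'u set" and q :: "nat \<Rightarrow> 'u \<Rightarrow> 'u set" and l h
    where B: "bounded_level_system \<Delta> r X q l h" and iso: "\<G> \<cong>\<^sub>t level_group \<Delta> X q"
    using level_realizableE[OF assms] by blast
  interpret bounded_level_system \<Delta> r X q l h by fact
  obtain U where "polish_ultrametric U" "homogeneous_metric U" "uniformly_discrete_metric_space U"
    "Iso U = level_group \<Delta> X q" using ex_ultrametric by blast
  then show ?thesis using iso by (intro exI[of _ U]) simp
qed

lemma ex_tree_Aut:
  assumes "level_realizable \<G>"
  shows "\<exists>(L :: ('l::infinite) set) rL (T :: ('t::infinite) set) rT lev.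
    linear_order_on L rL \<and> has_minimum L rL \<and> L_tree L rL T rT lev \<and> countable T \<and>
    homogeneous_tree T rT lev \<and> pruned_tree L rL T rT lev \<and> \<G> \<cong>\<^sub>t Aut T rT lev"
proof -
  obtain \<Delta> :: "'l set" and r and X :: "nat set" and q :: "'l \<Rightarrow> nat \<Rightarrow> nat set" and l h
    where B: "bounded_level_system \<Delta> r X q l h" and iso: "\<G> \<cong>\<^sub>t level_group \<Delta> X q"
    using level_realizableE[OF assms] by blast
  interpret bounded_level_system \<Delta> r X q l h by fact
  obtain T :: "'t set" and rT lev where "L_tree \<Delta> r T rT lev" "countable T" "homogeneous_tree T rT lev"
    "pruned_tree \<Delta> r T rT lev" and T: "level_group \<Delta> X q \<cong>\<^sub>t Aut T rT lev" using ex_tree by blast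
  moreover have "has_minimum \<Delta> r" using lowest(1,2) by (auto simp: has_minimum_def)
  ultimately show ?thesis using lin topgroup_iso_trans[OF iso T] by blast
qed

lemma ex_skeleton_Wr_LF:
  assumes "level_realizable \<G>"
  shows "\<exists>(\<Delta> :: ('d::infinite) set) r N.
    countable_linear_skeleton \<Delta> r N \<and> has_minimum \<Delta> r \<and> \<G> \<cong>\<^sub>t Wr_LF \<Delta> r N"
proof -
  obtain \<Delta> :: "'d set" and r and X :: "nat set" and q :: "'d \<Rightarrow> nat \<Rightarrow> nat set" and l h
    where B: "bounded_level_system \<Delta> r X q l h" and iso: "\<G> \<cong>\<^sub>t level_group \<Delta> X q"
    using level_realizableE[OF assms] by blast
  interpret bounded_level_system \<Delta> r X q l h by fact
  have "has_minimum \<Delta> r" using lowest(1,2) by (auto simp: has_minimum_def)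
  then show ?thesis
    using countable_skeleton_branching topgroup_iso_trans[OF iso level_group_iso_Wr_LF] by blast
qed

text \<open>The minimum is retained because this skeleton also has to serve the conditions on
  domains, local domains and projections.\<close>

lemma ex_skeleton_Wr_Fin_star:
  assumes "level_realizable \<G>"
  obtains \<Delta> :: "('d::infinite) set" and r N
  where "countable_linear_skeleton \<Delta> r N" "has_minimum \<Delta> r" "\<G> \<cong>\<^sub>t Wr_Fin_star \<Delta> r N"
  using ex_skeleton_Wr_LF[OF assms] Wr_LF_eq_Wr_Fin_star by metis

theorem theorem6p5:
  fixes \<G> :: "'g topgroup"
  assumes "topological_group \<G>"
  shows "all_equivalent
   [\<exists>U :: ('u::infinite) metric.
      polish_ultrametric U \<and> homogeneous_metric U \<and> discrete_metric_space U \<and> \<G> \<cong>\<^sub>t Iso U,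
    \<exists>U :: ('u::infinite) metric.
      polish_ultrametric U \<and> homogeneous_metric U \<and> uniformly_discrete_metric_space U \<and>
      \<G> \<cong>\<^sub>t Iso U,
    \<exists>(L :: ('l::infinite) set) rL (T :: ('t::infinite) set) rT lev.
      linear_order_on L rL \<and> has_minimum L rL \<and>
      L_tree L rL T rT lev \<and> countable T \<and> homogeneous_tree T rT lev \<and>
      pruned_tree L rL T rT lev \<and> \<G> \<cong>\<^sub>t Aut T rT lev,
    \<exists>(\<Delta> :: ('d::infinite) set) r N.
      countable_linear_skeleton \<Delta> r N \<and> has_minimum \<Delta> r \<and> \<G> \<cong>\<^sub>t Wr_LF \<Delta> r N,
    \<exists>(\<Delta> :: ('d::infinite) set) r N S.
      countable_linear_skeleton \<Delta> r N \<and> has_minimum \<Delta> r \<and>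
      is_domain \<Delta> r N S \<and> approx_homogeneous \<Delta> r S \<and> closedin (tau \<Delta> r N) S \<and>
      separable_space (subtopology (tau \<Delta> r N) S) \<and>
      S \<subseteq> supp_domain \<Delta> N (Max_sets \<Delta> r) \<and> \<G> \<cong>\<^sub>t Wr \<Delta> r N S,
    \<exists>(\<Delta> :: ('d::infinite) set) r N SS.
      countable_linear_skeleton \<Delta> r N \<and> has_minimum \<Delta> r \<and>
      local_domains \<Delta> r N SS \<and> countable SS \<and> locally_homogeneous \<Delta> r N SS \<and>
      SS \<subseteq> local_Max \<Delta> r N \<and> \<G> \<cong>\<^sub>t Wr_local \<Delta> r N SS,
    \<exists>(\<Delta> :: ('d::infinite) set) r N SS pr.
      countable_linear_skeleton \<Delta> r N \<and> has_minimum \<Delta> r \<and>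
      projection_system \<Delta> r N SS pr \<and> countable SS \<and> locally_homogeneous_proj \<Delta> r N SS pr \<and>
      SS \<subseteq> local_Max \<Delta> r N \<and> \<G> \<cong>\<^sub>t Wr_proj \<Delta> r N SS pr,
    \<exists>(\<Delta> :: ('d::infinite) set) r N.
      countable_linear_skeleton \<Delta> r N \<and> \<G> \<cong>\<^sub>t Wr_Fin_star \<Delta> r N]"
proof (rule all_equivalentI[where Q = "level_realizable \<G>"], unfold list.pred_inject, intro conjI iffI TrueI list.pred_inject(1),
    goal_cases)
  \<comment> \<open>Odd cases lead from a condition to \<open>level_realizable\<close>, even cases
    back.\<close>
  case 1
  then show ?case using level_realizable_Iso by blast
next
  case 2
  then show ?case using ex_ultrametric_Iso discrete_if_uniformly_discrete by blast
next
  case 3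
  then show ?case using level_realizable_Iso discrete_if_uniformly_discrete by blast
next
  case 4
  then show ?case by (rule ex_ultrametric_Iso)
next
  case 5
  then show ?case using level_realizable_Aut by blast
next
  case 6
  then show ?case by (rule ex_tree_Aut)
next
  case 7
  then show ?case using level_realizable_Wr_Fin_star Wr_LF_eq_Wr_Fin_star by metis
next
  case 8
  then show ?case by (rule ex_skeleton_Wr_LF)
next
  case 9
  then show ?case using level_realizable_Wr by blast
next
  case 10
  then obtain \<Delta> :: "'d set" and r N
    where D: "countable_linear_skeleton \<Delta> r N" "has_minimum \<Delta> r" and iso: "\<G> \<cong>\<^sub>t Wr_Fin_star \<Delta> r N"
    by (rule ex_skeleton_Wr_Fin_star)
  show ?case using D Fin_domain_props[OF D] iso by metis
next
  case 11
  then obtain \<Delta> :: "'d set" and r N SS where *: "countable_linear_skeleton \<Delta> r N" "has_minimum \<Delta> r"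
    "local_domains \<Delta> r N SS" "countable SS" "locally_homogeneous \<Delta> r N SS" "SS \<subseteq> local_Max \<Delta> r N"
    "\<G> \<cong>\<^sub>t Wr_local \<Delta> r N SS" by blast
  have "linear_order_on \<Delta> r" using *(1) by (simp add: countable_linear_skeleton_def)
  then show ?case
    using level_realizable_Wr_proj[OF *(1,2) projection_system_restrict[OF _ *(3)] *(4) _ *(6)] *(5,7)
    by (simp add: locally_homogeneous_eq_proj Wr_local_eq_Wr_proj)
next
  case 12
  then obtain \<Delta> :: "'d set" and r N
    where D: "countable_linear_skeleton \<Delta> r N" "has_minimum \<Delta> r" and iso: "\<G> \<cong>\<^sub>t Wr_Fin_star \<Delta> r N"
    by (rule ex_skeleton_Wr_Fin_star)
  show ?case
    using D local_domains_local_family_of[OF D(1)] local_family_of_props(1-3)[OF D]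
      topgroup_iso_trans[OF iso local_family_of_props(4)[OF D]] by blast
next
  case 13
  then show ?case using level_realizable_Wr_proj by blast
next
  case 14
  then obtain \<Delta> :: "'d set" and r N
    where D: "countable_linear_skeleton \<Delta> r N" "has_minimum \<Delta> r" and iso: "\<G> \<cong>\<^sub>t Wr_Fin_star \<Delta> r N"
    by (rule ex_skeleton_Wr_Fin_star)
  have "linear_order_on \<Delta> r" using D(1) by (simp add: countable_linear_skeleton_def)
  note ps = projection_system_restrict[OF this local_domains_local_family_of[OF D(1)]]
  show ?case
    using D ps local_family_of_props(1-3)[OF D] topgroup_iso_trans[OF iso local_family_of_props(4)[OF D]]
    unfolding locally_homogeneous_eq_proj Wr_local_eq_Wr_proj by blast
next
  case 15
  then show ?case using level_realizable_Wr_Fin_star by blast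
next
  case 16
  then show ?case using ex_skeleton_Wr_Fin_star by metis
qed

end
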